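(* Let $(U_1,U_2,A)$ be strip-admissible with values in $U(2)$ and $GL(2,\mathbb C)$, admitting a dominated splitting with stable line field $\ell_s$, and let $\tilde\ell\colon\Omega_\delta^\circ\to\mathbb{CP}^1$ be the holomorphic equivariant extension of $\ell_s$ to a strip (described in the context; it exists for some $\delta>0$). Then there is a real-analytic unit section $e_{\mathrm{an}}\colon\mathbb R^2\to\mathbb C^2$ of $\ell_s$ (that is, $|e_{\mathrm{an}}(w)|=1$ and $e_{\mathrm{an}}(w)\in\ell_s(w)$) satisfying $$e_{\mathrm{an}}(w+e_1)=U_1(w)e_{\mathrm{an}}(w),\qquad e_{\mathrm{an}}(w+e_2)=\mathrm e^{2\pi\mathrm i m w_1}U_2(w)e_{\mathrm{an}}(w)\qquad(w\in\mathbb R^2)$$ with $m=m(\ell_s)$ the charge of $\ell_s$.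
   Context: Notation. $w=(w_1,w_2)$, $e_1=(1,0)$, $e_2=(0,1)$, $\tau\in\mathbb R^2$, $Sw=w+\tau$ (acting on $\mathbb C^2$ as well). $\mathbb{CP}^1$ is the space of lines in $\mathbb C^2$. For $\delta>0$, $\Omega_\delta=\{w\in\mathbb C^2:|\operatorname{Im}w_1|\le\delta,|\operatorname{Im}w_2|\le\delta\}$ with interior $\Omega_\delta^\circ$. Sewing system and cocycle. A continuous unitary sewing system is a pair of continuous $U_1,U_2\colon\mathbb R^2\to U(2)$ with (K1) $U_1(w+e_2)U_2(w)=U_2(w+e_1)U_1(w)$. A continuous equivariant cocycle is a continuous $A\colon\mathbb R^2\to GL(2,\mathbb C)$ with (K2) $A(w+e_j)U_j(w)=U_j(Sw)A(w)$, $j=1,2$. An invariant line is a continuous $\ell\colon\mathbb R^2\to\mathbb{CP}^1$ with $\ell(w+e_j)=U_j(w)\ell(w)$ and $A(w)\ell(w)=\ell(Sw)$. Charge. For an invariant line $\ell$ there exists a continuous unit section $e\colon\mathbb R^2\to\mathbb C^2$, $|e|=1$, $e(w)\in\ell(w)$, with $e(w+e_1)=U_1(w)e(w)$, $e(w+e_2)=\mathrm e^{2\pi\mathrm i m w_1}U_2(w)e(w)$ for an integer $m$; this integer is unique and is called the charge $m(\ell)$. Strip-admissible. For some $\delta_0>0$ the maps $U_1,U_2,A$ extend to matrix functions holomorphic on an open neighborhood of $\Omega_{\delta_0}$ and bounded on $\Omega_{\delta_0}$, with $U_j(w)$ unitary and $\det A(w)\ne0$ for real $w$, and (K1), (K2)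 holding on $\mathbb R^2$. Dominated splitting. A pair of invariant lines $\ell_s,\ell_u$ with $\ell_s(w)\ne\ell_u(w)$ for all $w$, such that for some integer $N\ge1$ and $0<\kappa_0<1$, $\|A^{(N)}(z)|_{\ell_s(z)}\|/\mathfrak m(A^{(N)}(z)|_{\ell_u(z)})\le\kappa_0^2$ for all $z\in\mathbb R^2$, where $A^{(N)}(w)=A(S^{N-1}w)\cdots A(w)$ and $\mathfrak m(M)=\min_{|v|=1}|Mv|$. Holomorphic equivariant extension. For some sufficiently small $\delta>0$ (with $U_j$, $A$ invertible on $\Omega_\delta$), $\tilde\ell\colon\Omega_\delta^\circ\to\mathbb{CP}^1$ is a holomorphic map with $\tilde\ell(w+e_j)=U_j(w)\tilde\ell(w)$ for $j=1,2$, $A^{(\mathcal N)}(w)^{-1}\tilde\ell(S^{\mathcal N}w)=\tilde\ell(w)$ for a suitable block length $\mathcal N\ge1$, and $\tilde\ell|_{\mathbb R^2}=\ell_s$. *)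

theory Defs
  imports "HOL-Analysis.Analysis"
begin

section \<open>The projective line\<close>

definition complex_line :: "complex^2 \<Rightarrow> (complex^2) set" where
  "complex_line v = range (\<lambda>c. c *s v)"

definition CP1 :: "(complex^2) set set" where
  "CP1 = complex_line ` {v. v \<noteq> 0}"

text \<open>The quotient topology induced by the map from the nonzero vectors onto the lines they span.\<close>

definition CP1_topology :: "(complex^2) set topology" where
  "CP1_topology = topology (\<lambda>U. U \<subseteq> CP1 \<and> open {v. v \<noteq> 0 \<and> complex_line v \<in> U})"

lemma openin_CP1_topology:
  "openin CP1_topology U \<longleftrightarrow> U \<subseteq> CP1 \<and> open {v. v \<noteq> 0 \<and> complex_line v \<in> U}"
proof -
  have "istopology (\<lambda>U. U \<subseteq> CP1 \<and> open {v. v \<noteq> 0 \<and> complex_line v \<in> U})"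
    unfolding istopology_def
  proof (intro conjI allI impI)
    fix S T
    assume S: "S \<subseteq> CP1 \<and> open {v. v \<noteq> 0 \<and> complex_line v \<in> S}"
      and T: "T \<subseteq> CP1 \<and> open {v. v \<noteq> 0 \<and> complex_line v \<in> T}"
    then show "S \<inter> T \<subseteq> CP1" by blast
    have "{v. v \<noteq> 0 \<and> complex_line v \<in> S \<inter> T} =
        {v. v \<noteq> 0 \<and> complex_line v \<in> S} \<inter> {v. v \<noteq> 0 \<and> complex_line v \<in> T}" by blast
    then show "open {v. v \<noteq> 0 \<and> complex_line v \<in> S \<inter> T}" using S T by (simp add: open_Int)
  next
    fix K
    assume K: "\<forall>S\<in>K. S \<subseteq> CP1 \<and> open {v. v \<noteq> 0 \<and> complex_line v \<in> S}"
    then show "\<Union>K \<subseteq> CP1" by blast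
    have "{v. v \<noteq> 0 \<and> complex_line v \<in> \<Union>K} = (\<Union>S\<in>K. {v. v \<noteq> 0 \<and> complex_line v \<in> S})"
      by blast
    then show "open {v. v \<noteq> 0 \<and> complex_line v \<in> \<Union>K}" using K by auto
  qed
  then show ?thesis
    unfolding CP1_topology_def by (simp add: topology_inverse')
qed

lemma topspace_CP1_topology: "topspace CP1_topology = CP1"
proof -
  have "{v. v \<noteq> 0 \<and> complex_line v \<in> CP1} = - {0}"
    by (auto simp: CP1_def)
  then have "openin CP1_topology CP1"
    by (simp add: openin_CP1_topology open_delete Compl_eq_Diff_UNIV)
  moreover have "topspace CP1_topology \<subseteq> CP1"
    using openin_topspace[of CP1_topology] unfolding openin_CP1_topology by blast
  ultimately show ?thesis
    by (simp add: openin_subset subset_antisym)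
qed

text \<open>The action of a matrix on lines.\<close>

definition mat_line :: "complex^2^2 \<Rightarrow> (complex^2) set \<Rightarrow> (complex^2) set" where
  "mat_line M L = (*v) M ` L"


section \<open>Holomorphic and real-analytic maps of two variables\<close>

text \<open>Meant for open \<open>X\<close>: the real Frechet derivative exists and is complex-linear.\<close>

definition holomorphic2 :: "(complex^2 \<Rightarrow> complex) \<Rightarrow> (complex^2) set \<Rightarrow> bool" where
  "holomorphic2 f X \<longleftrightarrow>
     (\<forall>w\<in>X. \<exists>D. (f has_derivative D) (at w) \<and> (\<forall>c h. D (c *s h) = c * D h))"

definition holomorphic2_mat :: "(complex^2 \<Rightarrow> complex^2^2) \<Rightarrow> (complex^2) set \<Rightarrow> bool" where
  "holomorphic2_mat F X \<longleftrightarrow> (\<forall>i j. holomorphic2 (\<lambda>w. F w $ i $ j) X)"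

text \<open>The standard charts of the projective line: where the \<open>i\<close>-th homogeneous coordinate does not
  vanish, the affine coordinate is \<open>v $ j / v $ i\<close>, for \<open>(i, j) = (1, 2)\<close> or \<open>(2, 1)\<close>.\<close>

definition chart_domain :: "2 \<Rightarrow> (complex^2) set set" where
  "chart_domain i = {L \<in> CP1. \<exists>v\<in>L. v $ i \<noteq> 0}"

definition chart :: "2 \<Rightarrow> 2 \<Rightarrow> (complex^2) set \<Rightarrow> complex" where
  "chart i j L = (THE z. \<exists>v\<in>L. v $ i \<noteq> 0 \<and> z = v $ j / v $ i)"

definition holomorphic2_CP1 :: "(complex^2 \<Rightarrow> (complex^2) set) \<Rightarrow> (complex^2) set \<Rightarrow> bool" where
  "holomorphic2_CP1 l X \<longleftrightarrow>
     continuous_map (top_of_set X) CP1_topology l \<and>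
     (\<forall>(i, j) \<in> {(1, 2), (2, 1)}.
        holomorphic2 (\<lambda>w. chart i j (l w)) {w \<in> X. l w \<in> chart_domain i})"

definition real_analytic2 :: "(real^2 \<Rightarrow> complex^2) \<Rightarrow> bool" where
  "real_analytic2 f \<longleftrightarrow>
     (\<forall>p. \<exists>r>0. \<exists>a :: nat \<Rightarrow> nat \<Rightarrow> complex^2. \<forall>h :: real^2. \<bar>h $ 1\<bar> < r \<and> \<bar>h $ 2\<bar> < r \<longrightarrow>
        ((\<lambda>(j, k). (h $ 1 ^ j * h $ 2 ^ k) *\<^sub>R a j k) has_sum f (p + h)) UNIV)"


section \<open>Sewing systems, cocycles, invariant lines, charge\<close>

abbreviation e\<^sub>1 :: "('a::zero_neq_one)^2" where "e\<^sub>1 \<equiv> axis 1 1"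
abbreviation e\<^sub>2 :: "('a::zero_neq_one)^2" where "e\<^sub>2 \<equiv> axis 2 1"

definition unitary_mat :: "complex^2^2 \<Rightarrow> bool" where
  "unitary_mat M \<longleftrightarrow>
     (let M_adj = (\<chi> i j. cnj (M $ j $ i)) in M_adj ** M = mat 1 \<and> M ** M_adj = mat 1)"

definition sewing_system :: "(real^2 \<Rightarrow> complex^2^2) \<Rightarrow> (real^2 \<Rightarrow> complex^2^2) \<Rightarrow> bool" where
  "sewing_system U1 U2 \<longleftrightarrow>
     continuous_on UNIV U1 \<and> continuous_on UNIV U2 \<and>
     (\<forall>w. unitary_mat (U1 w) \<and> unitary_mat (U2 w)) \<and>
     (\<forall>w. U1 (w + e\<^sub>2) ** U2 w = U2 (w + e\<^sub>1) ** U1 w)"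

definition equivariant_cocycle ::
  "real^2 \<Rightarrow> (real^2 \<Rightarrow> complex^2^2) \<Rightarrow> (real^2 \<Rightarrow> complex^2^2) \<Rightarrow> (real^2 \<Rightarrow> complex^2^2) \<Rightarrow> bool"
  where
  "equivariant_cocycle \<tau> U1 U2 A \<longleftrightarrow>
     continuous_on UNIV A \<and> (\<forall>w. det (A w) \<noteq> 0) \<and>
     (\<forall>w. A (w + e\<^sub>1) ** U1 w = U1 (w + \<tau>) ** A w) \<and>
     (\<forall>w. A (w + e\<^sub>2) ** U2 w = U2 (w + \<tau>) ** A w)"

definition invariant_line ::
  "real^2 \<Rightarrow> (real^2 \<Rightarrow> complex^2^2) \<Rightarrow> (real^2 \<Rightarrow> complex^2^2) \<Rightarrow> (real^2 \<Rightarrow> complex^2^2) \<Rightarrow>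
   (real^2 \<Rightarrow> (complex^2) set) \<Rightarrow> bool"
  where
  "invariant_line \<tau> U1 U2 A l \<longleftrightarrow>
     continuous_map euclidean CP1_topology l \<and>
     (\<forall>w. l (w + e\<^sub>1) = mat_line (U1 w) (l w)) \<and>
     (\<forall>w. l (w + e\<^sub>2) = mat_line (U2 w) (l w)) \<and>
     (\<forall>w. mat_line (A w) (l w) = l (w + \<tau>))"

definition unit_section :: "(real^2 \<Rightarrow> (complex^2) set) \<Rightarrow> (real^2 \<Rightarrow> complex^2) \<Rightarrow> bool" where
  "unit_section l e \<longleftrightarrow> (\<forall>w. norm (e w) = 1 \<and> e w \<in> l w)"

definition quasi_periodic ::
  "(real^2 \<Rightarrow> complex^2^2) \<Rightarrow> (real^2 \<Rightarrow> complex^2^2) \<Rightarrow> int \<Rightarrow> (real^2 \<Rightarrow> complex^2) \<Rightarrow> bool"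
  where
  "quasi_periodic U1 U2 m e \<longleftrightarrow>
     (\<forall>w. e (w + e\<^sub>1) = U1 w *v e w) \<and>
     (\<forall>w. e (w + e\<^sub>2) =
        exp (2 * complex_of_real pi * \<i> * of_int m * complex_of_real (w $ 1)) *s (U2 w *v e w))"

definition charge ::
  "(real^2 \<Rightarrow> complex^2^2) \<Rightarrow> (real^2 \<Rightarrow> complex^2^2) \<Rightarrow> (real^2 \<Rightarrow> (complex^2) set) \<Rightarrow> int" where
  "charge U1 U2 l =
     (THE m. \<exists>e. continuous_on UNIV e \<and> unit_section l e \<and> quasi_periodic U1 U2 m e)"


section \<open>Dominated splittings\<close>

text \<open>\<open>block n \<tau> A w\<close> is the product of the matrices \<open>A (w + k \<tau>)\<close>, with \<open>k\<close> decreasing from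
  \<open>n - 1\<close> to \<open>0\<close>; it is used over the reals and over the complex numbers.\<close>

primrec block :: "nat \<Rightarrow> 'a::real_vector \<Rightarrow> ('a \<Rightarrow> complex^2^2) \<Rightarrow> 'a \<Rightarrow> complex^2^2" where
  "block 0 \<tau> A w = mat 1"
| "block (Suc n) \<tau> A w = A (w + real n *\<^sub>R \<tau>) ** block n \<tau> A w"

definition norm_on :: "complex^2^2 \<Rightarrow> (complex^2) set \<Rightarrow> real" where
  "norm_on M L = (SUP v\<in>{v \<in> L. norm v = 1}. norm (M *v v))"

definition conorm_on :: "complex^2^2 \<Rightarrow> (complex^2) set \<Rightarrow> real" where
  "conorm_on M L = (INF v\<in>{v \<in> L. norm v = 1}. norm (M *v v))"

definition dominated_splitting ::
  "real^2 \<Rightarrow> (real^2 \<Rightarrow> complex^2^2) \<Rightarrow> (real^2 \<Rightarrow> complex^2^2) \<Rightarrow> (real^2 \<Rightarrow> complex^2^2) \<Rightarrow>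
   (real^2 \<Rightarrow> (complex^2) set) \<Rightarrow> (real^2 \<Rightarrow> (complex^2) set) \<Rightarrow> bool"
  where
  "dominated_splitting \<tau> U1 U2 A ls lu \<longleftrightarrow>
     invariant_line \<tau> U1 U2 A ls \<and> invariant_line \<tau> U1 U2 A lu \<and>
     (\<forall>w. ls w \<noteq> lu w) \<and>
     (\<exists>N\<ge>1. \<exists>\<kappa>>0. \<kappa> < 1 \<and>
        (\<forall>z. norm_on (block N \<tau> A z) (ls z) / conorm_on (block N \<tau> A z) (lu z) \<le> \<kappa>\<^sup>2))"


section \<open>Extensions to a complex strip\<close>

definition cvec :: "real^2 \<Rightarrow> complex^2" where
  "cvec w = (\<chi> i. complex_of_real (w $ i))"

definition strip :: "real \<Rightarrow> (complex^2) set" where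
  "strip \<delta> = {w. \<bar>Im (w $ 1)\<bar> \<le> \<delta> \<and> \<bar>Im (w $ 2)\<bar> \<le> \<delta>}"

definition strip_extension ::
  "real \<Rightarrow> (real^2 \<Rightarrow> complex^2^2) \<Rightarrow> (complex^2 \<Rightarrow> complex^2^2) \<Rightarrow> bool" where
  "strip_extension \<delta> F G \<longleftrightarrow>
     (\<forall>w. G (cvec w) = F w) \<and>
     (\<exists>W. open W \<and> strip \<delta> \<subseteq> W \<and> holomorphic2_mat G W) \<and>
     bounded (G ` strip \<delta>)"

text \<open>The strip width \<open>\<delta>\<^sub>0\<close> and the extensions \<open>V1\<close>, \<open>V2\<close>, \<open>B\<close> of \<open>U1\<close>, \<open>U2\<close>, \<open>A\<close> are
  parameters, because a holomorphic equivariant extension of a line field refers to them. On the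
  strip the extensions are uniquely determined by \<open>U1\<close>, \<open>U2\<close>, \<open>A\<close>.\<close>

definition strip_admissible ::
  "real^2 \<Rightarrow> (real^2 \<Rightarrow> complex^2^2) \<Rightarrow> (real^2 \<Rightarrow> complex^2^2) \<Rightarrow> (real^2 \<Rightarrow> complex^2^2) \<Rightarrow>
   real \<Rightarrow> (complex^2 \<Rightarrow> complex^2^2) \<Rightarrow> (complex^2 \<Rightarrow> complex^2^2) \<Rightarrow> (complex^2 \<Rightarrow> complex^2^2) \<Rightarrow>
   bool"
  where
  "strip_admissible \<tau> U1 U2 A \<delta>\<^sub>0 V1 V2 B \<longleftrightarrow>
     sewing_system U1 U2 \<and> equivariant_cocycle \<tau> U1 U2 A \<and> \<delta>\<^sub>0 > 0 \<and>
     strip_extension \<delta>\<^sub>0 U1 V1 \<and> strip_extension \<delta>\<^sub>0 U2 V2 \<and> strip_extension \<delta>\<^sub>0 A B"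

definition holomorphic_equivariant_extension ::
  "real^2 \<Rightarrow> (complex^2 \<Rightarrow> complex^2^2) \<Rightarrow> (complex^2 \<Rightarrow> complex^2^2) \<Rightarrow> (complex^2 \<Rightarrow> complex^2^2) \<Rightarrow>
   real \<Rightarrow> (real^2 \<Rightarrow> (complex^2) set) \<Rightarrow> (complex^2 \<Rightarrow> (complex^2) set) \<Rightarrow> bool"
  where
  "holomorphic_equivariant_extension \<tau> V1 V2 B \<delta> ls l \<longleftrightarrow>
     (\<forall>w\<in>strip \<delta>. invertible (V1 w) \<and> invertible (V2 w) \<and> invertible (B w)) \<and>
     holomorphic2_CP1 l (interior (strip \<delta>)) \<and>
     (\<forall>w\<in>interior (strip \<delta>).
        l (w + e\<^sub>1) = mat_line (V1 w) (l w) \<and> l (w + e\<^sub>2) = mat_line (V2 w) (l w)) \<and>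
     (\<exists>N\<ge>1. \<forall>w\<in>interior (strip \<delta>).
        mat_line (matrix_inv (block N (cvec \<tau>) B w)) (l (w + real N *\<^sub>R cvec \<tau>)) = l w) \<and>
     (\<forall>w. l (cvec w) = ls w)"

end

theory Submission
  imports Defs "HOL-Complex_Analysis.Cauchy_Integral_Formula"
begin

text \<open>A continuous unit section \<open>e\<close> with the required quasi-periodicity exists for topological reasons; it
remains to replace it by an analytic one without changing the integer \<open>m\<close>. Since a small perturbation of
\<open>e\<close> inside the line bundle is still nowhere zero and can be normalised, it is enough to approximate \<open>e\<close>
uniformly by real-analytic maps with the same quasi-periodicity.

Write \<open>T\<^sub>n\<close>, for \<open>n\<close> in the lattice of integer vectors, for the unitary transition matrices, so that
\<open>e (w + n) = T\<^sub>n(w) e(w)\<close>. Pick a fine grid of mesh \<open>1/M\<close> in the unit square and put at each grid point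
\<open>p\<close> the vector \<open>e(p)\<close>, multiplied by a Gaussian of width \<open>1/M\<close> centred at \<open>p\<close>. Summing
\<open>T\<^sub>n(w)\<inverse> g(w + n)\<close> over all \<open>n\<close> makes such a function \<open>g\<close> equivariant, exactly as for a Poincare series.
Each summand extends holomorphically to the strip, because the inverse of a unitary matrix is its
adjoint, and the adjoint extends by reflection \<open>w \<mapsto> X(cnj w)\<^sup>*\<close>. On the strip the transition matrices grow
at most exponentially in \<open>n\<close>, and the Gaussians beat every exponential; so the sum converges locally
uniformly and is holomorphic (\<open>poincare_analytic\<close>). On the real plane the value of the sum at \<open>w\<close> is a
combination of vectors \<open>T\<^sub>n(w)\<inverse> e(p)\<close>, which are close to \<open>e(w)\<close> when \<open>p\<close> is close to \<open>w + n\<close>; the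
remaining terms have small weight. Hence the sum differs from \<open>\<theta>(w) e(w)\<close>, with \<open>\<theta>\<close> the sum of the
weights, by less than \<open>\<theta>(w)\<close> (\<open>poincare_close\<close>).

The orthogonal projection onto the line field is real-analytic, since locally the line is spanned by a
vector read off from an affine chart of the holomorphic extension (\<open>analytic_at_projection\<close>), and it
commutes with the unitary sewing. Projecting the series and dividing by the norm gives the section.

The existence of \<open>e\<close> and the uniqueness of \<open>m\<close> (\<open>unit_section_exists\<close>, \<open>charge_unique\<close>) are classical:
lift the line field over the unit square, measure the mismatch of the lift on opposite edges by two
continuous angles, whose increments around the square differ by \<open>2 \<pi> m\<close>, twist the lift by a phase
that absorbs the angles up to the factor \<open>exp (2 \<pi> \<i> m w\<^sub>1)\<close>, and continue it equivariantly to the plane.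
For two charges, a continuous angle between the two sections forces the charges to agree.\<close>

section \<open>Holomorphic functions of two variables\<close>

text \<open>Holomorphy along every complex line, together with continuity, passes to locally uniform limits by the
one-variable theorem. Total differentiability is not visibly preserved by such limits.\<close>

definition line_holomorphic :: "(complex^2 \<Rightarrow> complex) \<Rightarrow> (complex^2) set \<Rightarrow> bool" where
  "line_holomorphic f X \<longleftrightarrow> continuous_on X f \<and>
     (\<forall>a b. (\<lambda>z. f (a + z *s b)) holomorphic_on {z. a + z *s b \<in> X})"

lemma continuous_on_line [continuous_intros]:
  "continuous_on S (\<lambda>z. a + z *s b :: complex^2)"
  unfolding vector_scalar_mult_def by (intro continuous_intros)

lemma open_line:
  fixes X :: "(complex^2) set"
  assumes "open X"
  shows "open {z. a + z *s b \<in> X}"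
  using open_vimage[OF assms, of "\<lambda>z. a + z *s b"] continuous_on_line by (auto simp: vimage_def)

lemma line_holomorphic_subset:
  "line_holomorphic f X \<Longrightarrow> Y \<subseteq> X \<Longrightarrow> line_holomorphic f Y"
  unfolding line_holomorphic_def
  by (auto intro: continuous_on_subset holomorphic_on_subset[of _ "{z. _ + z *s _ \<in> X}"])

lemma line_holomorphic_const: "line_holomorphic (\<lambda>w. c) X"
  by (simp add: line_holomorphic_def)

lemma line_holomorphic_coord: "line_holomorphic (\<lambda>w. w $ i) X"
  by (auto simp: line_holomorphic_def intro!: continuous_intros holomorphic_intros)

lemma line_holomorphic_add:
  "line_holomorphic f X \<Longrightarrow> line_holomorphic g X \<Longrightarrow> line_holomorphic (\<lambda>w. f w + g w) X"
  by (auto simp: line_holomorphic_def intro!: continuous_intros holomorphic_intros)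

lemma line_holomorphic_mult:
  "line_holomorphic f X \<Longrightarrow> line_holomorphic g X \<Longrightarrow> line_holomorphic (\<lambda>w. f w * g w) X"
  by (auto simp: line_holomorphic_def intro!: continuous_intros holomorphic_intros)

lemma line_holomorphic_compose:
  assumes f: "line_holomorphic f X" and g: "g holomorphic_on Y" and fX: "f ` X \<subseteq> Y"
  shows "line_holomorphic (\<lambda>w. g (f w)) X"
  unfolding line_holomorphic_def
proof (intro conjI allI)
  show "continuous_on X (\<lambda>w. g (f w))"
    using f fX holomorphic_on_imp_continuous_on[OF g]
    by (auto simp: line_holomorphic_def intro: continuous_on_compose2)
next
  fix a b
  show "(\<lambda>z. g (f (a + z *s b))) holomorphic_on {z. a + z *s b \<in> X}"
    using holomorphic_on_compose_gen[of "\<lambda>z. f (a + z *s b)" "{z. a + z *s b \<in> X}" g Y] f g fX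
    by (auto simp: line_holomorphic_def o_def)
qed

lemma line_holomorphic_shift:
  assumes "line_holomorphic f X"
  shows "line_holomorphic (\<lambda>w. f (w + c)) {w. w + c \<in> X}"
  unfolding line_holomorphic_def
proof (intro conjI allI)
  show "continuous_on {w. w + c \<in> X} (\<lambda>w. f (w + c))"
    using assms by (auto simp: line_holomorphic_def intro!: continuous_on_compose2[of X f] continuous_intros)
next
  fix a b
  have "(\<lambda>z. f ((a + c) + z *s b)) holomorphic_on {z. (a + c) + z *s b \<in> X}"
    using assms by (auto simp: line_holomorphic_def)
  then show "(\<lambda>z. f (a + z *s b + c)) holomorphic_on {z. a + z *s b \<in> {w. w + c \<in> X}}"
    by (simp add: algebra_simps)
qed

definition vcnj :: "complex^2 \<Rightarrow> complex^2" where
  "vcnj w = (\<chi> i. cnj (w $ i))"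

lemma continuous_on_vcnj [continuous_intros]: "continuous_on S vcnj"
  unfolding vcnj_def by (intro continuous_intros)

lemma vcnj_cvec [simp]: "vcnj (cvec w) = cvec w"
  by (simp add: vcnj_def cvec_def vec_eq_iff)

lemma vcnj_line: "vcnj (a + z *s b) = vcnj a + cnj z *s vcnj b"
  by (simp add: vcnj_def vec_eq_iff)

text \<open>The reflection \<open>w \<mapsto> cnj (f (cnj w))\<close> extends the complex conjugate of \<open>f\<close> from the real plane. It is
what makes conjugates, adjoints and inverses of unitary matrices holomorphic.\<close>

lemma line_holomorphic_reflect:
  assumes f: "line_holomorphic f X" and X: "open X"
  shows "line_holomorphic (\<lambda>w. cnj (f (vcnj w))) {w. vcnj w \<in> X}"
  unfolding line_holomorphic_def
proof (intro conjI allI)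
  show "continuous_on {w. vcnj w \<in> X} (\<lambda>w. cnj (f (vcnj w)))"
    using f by (auto simp: line_holomorphic_def intro!: continuous_on_compose2[of X f] continuous_intros)
next
  fix a b
  let ?S = "{z. vcnj a + z *s vcnj b \<in> X}"
  have cnjS: "cnj ` {z. a + z *s b \<in> {w. vcnj w \<in> X}} = ?S"
    by (auto simp: vcnj_line image_iff intro!: exI[of _ "cnj _"])
  have "{z. a + z *s b \<in> {w. vcnj w \<in> X}} = cnj -` ?S"
    by (auto simp: vcnj_line)
  then have op: "open {z. a + z *s b \<in> {w. vcnj w \<in> X}}"
    using open_vimage[OF open_line[OF X], of cnj "vcnj a" "vcnj b"] by (auto intro: continuous_intros)
  have "(\<lambda>z. f (vcnj a + z *s vcnj b)) holomorphic_on ?S"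
    using f by (auto simp: line_holomorphic_def)
  then have "(cnj \<circ> (\<lambda>z. f (vcnj a + z *s vcnj b)) \<circ> cnj) holomorphic_on {z. a + z *s b \<in> {w. vcnj w \<in> X}}"
    using op by (intro holomorphic_on_compose_cnj_cnj) (simp_all only: cnjS)
  then show "(\<lambda>z. cnj (f (vcnj (a + z *s b)))) holomorphic_on {z. a + z *s b \<in> {w. vcnj w \<in> X}}"
    by (simp add: o_def vcnj_line)
qed

lemma holomorphic2_imp_line_holomorphic:
  assumes "holomorphic2 f X"
  shows "line_holomorphic f X"
  unfolding line_holomorphic_def
proof (intro conjI allI)
  show "continuous_on X f"
    using assms has_derivative_continuous unfolding holomorphic2_def
    by (metis continuous_at_imp_continuous_on)
next
  fix a b
  show "(\<lambda>z. f (a + z *s b)) holomorphic_on {z. a + z *s b \<in> X}"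
    unfolding holomorphic_on_def field_differentiable_def
  proof (intro ballI)
    fix z assume z: "z \<in> {z. a + z *s b \<in> X}"
    then obtain D where D: "(f has_derivative D) (at (a + z *s b))" "\<And>c h. D (c *s h) = c * D h"
      using assms by (auto simp: holomorphic2_def)
    have L: "((\<lambda>z. a + z *s b) has_derivative (\<lambda>h. h *s b)) (at z)"
    proof -
      have "bounded_linear (\<lambda>h. h *s b)"
        unfolding linear_conv_bounded_linear[symmetric]
        by (rule linearI) (auto simp: vec_eq_iff algebra_simps)
      then show ?thesis
        by (auto intro!: derivative_eq_intros bounded_linear_imp_has_derivative)
    qed
    have "((\<lambda>z. f (a + z *s b)) has_derivative (\<lambda>h. D (h *s b))) (at z)"
      using has_derivative_compose[OF L D(1)] .
    then have "((\<lambda>z. f (a + z *s b)) has_field_derivative D b) (at z)"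
      by (simp add: D(2) has_field_derivative_def mult.commute[of _ "D b"] mult_commute_abs)
    then show "\<exists>f'. ((\<lambda>z. f (a + z *s b)) has_field_derivative f') (at z within {z. a + z *s b \<in> X})"
      using has_field_derivative_at_within by blast
  qed
qed

lemma line_holomorphic_sum:
  assumes "finite K" "\<And>k. line_holomorphic (f k) X"
  shows "line_holomorphic (\<lambda>w. \<Sum>k\<in>K. f k w) X"
  using assms(1) by (induction K rule: finite_induct)
    (auto intro: line_holomorphic_add assms(2) line_holomorphic_const)

text \<open>The Weierstrass M-test with a majorant near each point, applied on small discs of each complex line.\<close>

lemma line_holomorphic_infsum:
  fixes f :: "'k \<Rightarrow> complex^2 \<Rightarrow> complex"
  assumes X: "open X" and f: "\<And>k. line_holomorphic (f k) X"
    and M: "\<And>w. w \<in> X \<Longrightarrow> \<exists>N M. open N \<and> w \<in> N \<and> N \<subseteq> X \<and> M summable_on UNIV \<and>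
              (\<forall>k. \<forall>v\<in>N. norm (f k v) \<le> M k)"
  shows "line_holomorphic (\<lambda>w. \<Sum>\<^sub>\<infinity>k. f k w) X"
  unfolding line_holomorphic_def
proof (intro conjI allI)
  let ?F = "finite_subsets_at_top (UNIV :: 'k set)"
  have sum: "line_holomorphic (\<lambda>w. \<Sum>k\<in>K. f k w) X" if "finite K" for K
    by (rule line_holomorphic_sum[OF that f])
  have ul: "\<exists>N. open N \<and> w \<in> N \<and> N \<subseteq> X \<and>
      uniform_limit N (\<lambda>K v. \<Sum>k\<in>K. f k v) (\<lambda>v. \<Sum>\<^sub>\<infinity>k. f k v) ?F" if w: "w \<in> X" for w
  proof -
    obtain N M where "open N" "w \<in> N" "N \<subseteq> X" "M summable_on UNIV"
      "\<And>k v. v \<in> N \<Longrightarrow> norm (f k v) \<le> M k"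
      using M[OF w] by meson
    then show ?thesis
      using Weierstrass_m_test_general[of UNIV N f M] by blast
  qed
  show "continuous_on X (\<lambda>w. \<Sum>\<^sub>\<infinity>k. f k w)"
  proof (rule continuous_at_imp_continuous_on, intro ballI)
    fix w assume "w \<in> X"
    then obtain N where N: "open N" "w \<in> N" "N \<subseteq> X"
      "uniform_limit N (\<lambda>K v. \<Sum>k\<in>K. f k v) (\<lambda>v. \<Sum>\<^sub>\<infinity>k. f k v) ?F"
      using ul by blast
    have "continuous_on N (\<lambda>w. \<Sum>\<^sub>\<infinity>k. f k w)"
    proof (rule uniform_limit_theorem[OF _ N(4)])
      show "\<forall>\<^sub>F K in ?F. continuous_on N (\<lambda>v. \<Sum>k\<in>K. f k v)"
        using sum N(3) by (intro eventually_finite_subsets_at_top_weakI)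
          (auto simp: line_holomorphic_def intro: continuous_on_subset)
    qed simp
    then show "isCont (\<lambda>w. \<Sum>\<^sub>\<infinity>k. f k w) w"
      using N continuous_on_eq_continuous_at by blast
  qed
next
  let ?F = "finite_subsets_at_top (UNIV :: 'k set)"
  fix a b
  have sum: "line_holomorphic (\<lambda>w. \<Sum>k\<in>K. f k w) X" if "finite K" for K
    by (rule line_holomorphic_sum[OF that f])
  let ?S = "{z. a + z *s b \<in> X}"
  have "\<exists>g'. ((\<lambda>z. \<Sum>\<^sub>\<infinity>k. f k (a + z *s b)) has_field_derivative g') (at z)" if z: "z \<in> ?S" for z
  proof -
    obtain N M where N: "open N" "a + z *s b \<in> N" "N \<subseteq> X" "M summable_on UNIV"
      "\<And>k v. v \<in> N \<Longrightarrow> norm (f k v) \<le> M k"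
      using M[of "a + z *s b"] z by (auto 4 4)
    have "open {z. a + z *s b \<in> N}" by (rule open_line[OF N(1)])
    then obtain r where r: "r > 0" "cball z r \<subseteq> {z. a + z *s b \<in> N}"
      using N(2) open_contains_cball by (metis mem_Collect_eq)
    have "uniform_limit (cball z r) (\<lambda>K v. \<Sum>k\<in>K. f k (a + v *s b)) (\<lambda>v. \<Sum>\<^sub>\<infinity>k. f k (a + v *s b)) ?F"
      using Weierstrass_m_test_general[of UNIV "cball z r" "\<lambda>k v. f k (a + v *s b)" M] N(4,5) r(2) by (auto simp: subset_eq)
    moreover have "\<forall>\<^sub>F K in ?F. continuous_on (cball z r) (\<lambda>v. \<Sum>k\<in>K. f k (a + v *s b)) \<and>
        (\<lambda>v. \<Sum>k\<in>K. f k (a + v *s b)) holomorphic_on ball z r"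
    proof (intro eventually_finite_subsets_at_top_weakI)
      fix K :: "'k set" assume "finite K"
      then have "(\<lambda>v. \<Sum>k\<in>K. f k (a + v *s b)) holomorphic_on ?S"
        using sum unfolding line_holomorphic_def by blast
      moreover have "cball z r \<subseteq> ?S" using r N by auto
      ultimately have "(\<lambda>v. \<Sum>k\<in>K. f k (a + v *s b)) holomorphic_on cball z r"
        by (rule holomorphic_on_subset)
      then show "continuous_on (cball z r) (\<lambda>v. \<Sum>k\<in>K. f k (a + v *s b)) \<and>
        (\<lambda>v. \<Sum>k\<in>K. f k (a + v *s b)) holomorphic_on ball z r"
        using holomorphic_on_subset[OF _ ball_subset_cball] holomorphic_on_imp_continuous_on by blast
    qed
    ultimately have "(\<lambda>v. \<Sum>\<^sub>\<infinity>k. f k (a + v *s b)) holomorphic_on ball z r"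
      using holomorphic_uniform_limit[of z r "\<lambda>K v. \<Sum>k\<in>K. f k (a + v *s b)" ?F] by auto
    then show ?thesis
      using r(1) by (auto simp: holomorphic_on_open)
  qed
  then show "(\<lambda>z. \<Sum>\<^sub>\<infinity>k. f k (a + z *s b)) holomorphic_on ?S"
    using open_line[OF X] by (auto simp: holomorphic_on_open)
qed

section \<open>Double power series\<close>

lemma summable_on_prod_mult:
  fixes f :: "'a \<Rightarrow> real" and g :: "'b \<Rightarrow> real"
  assumes f: "f summable_on UNIV" "\<And>x. 0 \<le> f x" and g: "g summable_on UNIV" "\<And>y. 0 \<le> g y"
  shows "(\<lambda>(x, y). f x * g y) summable_on UNIV"
    and "(\<Sum>\<^sub>\<infinity>(x, y). f x * g y) = (\<Sum>\<^sub>\<infinity>x. f x) * (\<Sum>\<^sub>\<infinity>y. g y)"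
proof -
  have inner: "((\<lambda>y. case (x, y) of (x, y) \<Rightarrow> f x * g y) has_sum f x * infsum g UNIV) UNIV" for x
    using has_sum_cmult_right[OF has_sum_infsum[OF g(1)], of "f x"] by simp
  have outer: "((\<lambda>x. f x * infsum g UNIV) has_sum (\<Sum>\<^sub>\<infinity>x. f x) * (\<Sum>\<^sub>\<infinity>y. g y)) UNIV"
    using has_sum_cmult_left[OF has_sum_infsum[OF f(1)]] by simp
  have "(\<lambda>(x, y). f x * g y) summable_on (UNIV \<times> UNIV)"
    by (rule summable_on_SigmaI[OF inner])
      (use outer f(2) g(2) in \<open>auto simp: summable_on_def\<close>)
  moreover from this have "((\<lambda>(x, y). f x * g y) has_sum (\<Sum>\<^sub>\<infinity>x. f x) * (\<Sum>\<^sub>\<infinity>y. g y)) (UNIV \<times> UNIV)"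
    by (intro has_sum_SigmaI[OF inner outer]) 
  ultimately show "(\<lambda>(x, y). f x * g y) summable_on UNIV"
    "(\<Sum>\<^sub>\<infinity>(x, y). f x * g y) = (\<Sum>\<^sub>\<infinity>x. f x) * (\<Sum>\<^sub>\<infinity>y. g y)"
    by (auto dest: infsumI)
qed

lemma Cauchy_coefficient_bound:
  assumes "f holomorphic_on ball 0 R" "\<And>z. norm z < R \<Longrightarrow> norm (f z) \<le> M" "0 < r" "r < R"
  shows "norm ((deriv ^^ n) f 0 / fact n) \<le> M / r ^ n"
proof -
  have "f holomorphic_on cball 0 r"
    using assms(1,4) by (auto intro: holomorphic_on_subset)
  then have "norm ((deriv ^^ n) f 0) \<le> fact n * M / r ^ n"
    using assms(2-4) holomorphic_on_subset[OF _ ball_subset_cball]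
    by (intro Cauchy_inequality holomorphic_on_imp_continuous_on) auto
  then show ?thesis
    by (simp add: norm_divide field_simps)
qed

text \<open>The coefficient \<open>c\<^sub>j\<close> of \<open>z\<^sub>1\<^sup>j\<close>, as a function of \<open>z\<^sub>2\<close>, is the limit of
\<open>(F - \<Sum>i<j. c\<^sub>i z\<^sub>1\<^sup>i) / z\<^sub>1\<^sup>j\<close> as \<open>z\<^sub>1 \<rightarrow> 0\<close>, and the limit is uniform in \<open>z\<^sub>2\<close> by the Cauchy estimates. So
holomorphy follows by strong induction on \<open>j\<close>, without differentiating under an integral.\<close>

lemma holomorphic_power_coefficient:
  fixes F :: "complex \<Rightarrow> complex \<Rightarrow> complex"
  assumes h1: "\<And>z2. norm z2 < R \<Longrightarrow> (\<lambda>z1. F z1 z2) holomorphic_on ball 0 R"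
    and h2: "\<And>z1. norm z1 < R \<Longrightarrow> (\<lambda>z2. F z1 z2) holomorphic_on ball 0 R"
    and M: "\<And>z1 z2. norm z1 < R \<Longrightarrow> norm z2 < R \<Longrightarrow> norm (F z1 z2) \<le> M"
    and R: "R > 0"
  shows "(\<lambda>z2. (deriv ^^ j) (\<lambda>z1. F z1 z2) 0 / fact j) holomorphic_on ball 0 R"
proof (induction j rule: less_induct)
  case (less j)
  define c where "c i z2 = (deriv ^^ i) (\<lambda>z1. F z1 z2) 0 / fact i" for i z2
  have IH: "c i holomorphic_on ball 0 R" if "i < j" for i
    using less[OF that] by (simp add: c_def[abs_def])
  define r where "r = R / 2"
  have r: "0 < r" "r < R" using R by (auto simp: r_def)
  have cb: "norm (c i z2) \<le> M / r ^ i" if "norm z2 < R" for i z2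
    unfolding c_def using Cauchy_coefficient_bound[OF h1[OF that] M[OF _ that] r] .
  have M0: "0 \<le> M" using order_trans[OF norm_ge_zero M[of 0 0]] R by simp
  define g where "g z1 z2 = (F z1 z2 - (\<Sum>i<j. c i z2 * z1 ^ i)) / z1 ^ j" for z1 z2
  \<comment> \<open>The error is \<open>z\<^sub>1\<close> times a tail of the Taylor series, dominated by a geometric series of ratio \<open>1/2\<close>.\<close>
  have est: "norm (g z1 z2 - c j z2) \<le> norm z1 * (2 * M / r ^ (j + 1))"
    if z1: "z1 \<noteq> 0" "norm z1 \<le> r / 2" and z2: "norm z2 < R" for z1 z2
  proof -
    have "(\<lambda>i. c i z2 * z1 ^ i) sums F z1 z2"
      using holomorphic_power_series[OF h1[OF z2], of z1] z1 r by (simp add: c_def)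
    then have "(\<lambda>i. c (i + j) z2 * z1 ^ (i + j)) sums (F z1 z2 - (\<Sum>i<j. c i z2 * z1 ^ i))"
      by (rule sums_split_initial_segment)
    from sums_divide[OF this, of "z1 ^ j"] have "(\<lambda>i. c (i + j) z2 * z1 ^ i) sums g z1 z2"
      using z1(1) by (simp add: g_def power_add)
    from sums_split_initial_segment[OF this, of 1]
    have "(\<lambda>i. z1 * (c (i + 1 + j) z2 * z1 ^ i)) sums (g z1 z2 - c j z2)"
      by (simp add: mult_ac)
    then have eq: "g z1 z2 - c j z2 = (\<Sum>i. z1 * (c (i + 1 + j) z2 * z1 ^ i))"
      by (rule sums_unique)
    have "norm (z1 * (c (i + 1 + j) z2 * z1 ^ i)) \<le> norm z1 * (M / r ^ (j + 1)) * (1/2) ^ i" for i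
    proof -
      have "norm (c (i + 1 + j) z2) * norm z1 ^ i \<le> M / r ^ (i + 1 + j) * (r / 2) ^ i"
        by (rule mult_mono[OF cb[OF z2] power_mono[OF z1(2)]]) (use M0 r in auto)
      also have "\<dots> = M / r ^ (j + 1) * (1/2) ^ i"
        using r by (simp add: field_simps power_add)
      finally show ?thesis
        using mult_left_mono[OF _ norm_ge_zero[of z1]] by (simp only: norm_mult norm_power mult.assoc)
    qed
    moreover have "(\<lambda>i. norm z1 * (M / r ^ (j + 1)) * (1/2) ^ i) sums (norm z1 * (M / r ^ (j + 1)) * 2)"
      using sums_mult[OF geometric_sums[of "1/2 :: real"], of "norm z1 * (M / r ^ (j + 1))"] by simp
    ultimately have "norm (g z1 z2 - c j z2) \<le> norm z1 * (M / r ^ (j + 1)) * 2"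
      unfolding eq by (metis (no_types, lifting) norm_suminf_le sums_summable sums_unique)
    then show ?thesis by (simp add: mult_ac)
  qed
  define t where "t n = complex_of_real (r / 2 / real (Suc n))" for n
  have nt: "norm (t n) = r / 2 / real (Suc n)" for n
    using r(1) unfolding t_def norm_of_real by simp
  have t: "t n \<noteq> 0" "norm (t n) \<le> r / 2" for n
  proof -
    show "t n \<noteq> 0" using nt[of n] r(1) by auto
    show "norm (t n) \<le> r / 2" unfolding nt using r(1) by (simp add: field_simps)
  qed
  have ul: "uniform_limit (ball 0 R) (\<lambda>n. g (t n)) (c j) sequentially"
  proof (rule uniform_limitI)
    fix e :: real assume "e > 0"
    have "(\<lambda>n. r / 2 / real (Suc n) * (2 * M / r ^ (j + 1))) \<longlonglongrightarrow> 0"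
      by (rule tendsto_mult_left_zero) (rule LIMSEQ_Suc[OF lim_const_over_n])
    then have "\<forall>\<^sub>F n in sequentially. r / 2 / real (Suc n) * (2 * M / r ^ (j + 1)) < e"
      using \<open>e > 0\<close> by (auto dest: order_tendstoD)
    then show "\<forall>\<^sub>F n in sequentially. \<forall>x\<in>ball 0 R. dist (g (t n) x) (c j x) < e"
    proof eventually_elim
      case (elim n)
      show ?case
      proof
        fix x :: complex assume "x \<in> ball 0 R"
        then have "norm (g (t n) x - c j x) \<le> norm (t n) * (2 * M / r ^ (j + 1))"
          by (intro est t) auto
        then show "dist (g (t n) x) (c j x) < e"
          using elim unfolding nt dist_norm by linarith
      qed
    qed
  qed
  have hg: "g (t n) holomorphic_on ball 0 R" for n
    unfolding g_def[abs_def] using t[of n] r IH h2[of "t n"]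
    by (intro holomorphic_intros) auto
  have "c j holomorphic_on ball 0 \<rho>" if "\<rho> < R" for \<rho>
  proof (rule holomorphic_uniform_limit[of 0 \<rho> "\<lambda>n. g (t n)" sequentially])
    have sub: "cball 0 \<rho> \<subseteq> ball (0::complex) R" using that by auto
    then have "g (t n) holomorphic_on cball 0 \<rho>" for n
      using hg holomorphic_on_subset by blast
    then show "\<forall>\<^sub>F n in sequentially. continuous_on (cball 0 \<rho>) (g (t n)) \<and> g (t n) holomorphic_on ball 0 \<rho>"
      using holomorphic_on_subset[OF _ ball_subset_cball] holomorphic_on_imp_continuous_on
      by (auto intro!: always_eventually)
    show "uniform_limit (cball 0 \<rho>) (\<lambda>n. g (t n)) (c j) sequentially"
      by (rule uniform_limit_on_subset[OF ul sub])
  qed auto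
  then have "c j field_differentiable (at z)" if "norm z < R" for z
    using that dense[OF that] by (auto simp: holomorphic_on_open field_differentiable_def)
  then show ?case
    by (auto simp: c_def[abs_def] holomorphic_on_def field_differentiable_at_within)
qed

text \<open>A bounded separately holomorphic function on a bidisc is the sum of a double power series: expand in \<open>z\<^sub>1\<close>,
then expand the coefficients in \<open>z\<^sub>2\<close>. The Cauchy estimates for both expansions give absolute convergence,
which allows the iterated sum to be read as an unordered double sum.\<close>

lemma osgood_power_series:
  fixes F :: "complex \<Rightarrow> complex \<Rightarrow> complex"
  assumes h1: "\<And>z2. norm z2 < R \<Longrightarrow> (\<lambda>z1. F z1 z2) holomorphic_on ball 0 R"
    and h2: "\<And>z1. norm z1 < R \<Longrightarrow> (\<lambda>z2. F z1 z2) holomorphic_on ball 0 R"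
    and M: "\<And>z1 z2. norm z1 < R \<Longrightarrow> norm z2 < R \<Longrightarrow> norm (F z1 z2) \<le> M"
    and R: "R > 0"
  obtains a where "\<And>z1 z2. norm z1 < R \<Longrightarrow> norm z2 < R \<Longrightarrow>
      ((\<lambda>(j, k). z1 ^ j * z2 ^ k * a j k) has_sum F z1 z2) UNIV"
proof
  define c where "c j z2 = (deriv ^^ j) (\<lambda>z1. F z1 z2) 0 / fact j" for j z2
  define a where "a j k = (deriv ^^ k) (c j) 0 / fact k" for j k
  have hc: "c j holomorphic_on ball 0 R" for j
    using holomorphic_power_coefficient[OF h1 h2 M R] by (simp add: c_def[abs_def])
  fix z1 z2 :: complex assume z: "norm z1 < R" "norm z2 < R"
  obtain r where r: "norm z1 < r" "norm z2 < r" "r < R"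
    using dense[of "max (norm z1) (norm z2)" R] z by auto
  have r0: "0 < r" using r(1) norm_ge_zero le_less_trans by blast
  have cb: "norm (c j z) \<le> M / r ^ j" if "norm z < R" for j z
    unfolding c_def using Cauchy_coefficient_bound[OF h1[OF that] M[OF _ that] r0 r(3)] .
  have ab: "norm (a j k) \<le> M / r ^ j / r ^ k" for j k
    unfolding a_def using Cauchy_coefficient_bound[OF hc cb r0 r(3)] .
  have M0: "0 \<le> M" using order_trans[OF norm_ge_zero M[of 0 0]] R by simp
  define x y where "x = norm z1 / r" and "y = norm z2 / r"
  have xy: "0 \<le> x" "x < 1" "0 \<le> y" "y < 1" using r r0 by (auto simp: x_def y_def)
  have geo: "(\<lambda>n. q ^ n) summable_on UNIV" if "0 \<le> q" "q < 1" for q :: real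
    using that by (intro norm_summable_imp_summable_on) (auto simp: summable_geometric)
  have tb: "norm (z1 ^ j * z2 ^ k * a j k) \<le> M * (x ^ j * y ^ k)" for j k
  proof -
    have "norm (z1 ^ j * z2 ^ k * a j k) \<le> norm z1 ^ j * norm z2 ^ k * (M / r ^ j / r ^ k)"
      unfolding norm_mult norm_power by (intro mult_left_mono ab) auto
    also have "\<dots> = M * (x ^ j * y ^ k)"
      using r0 by (simp add: x_def y_def power_divide field_simps)
    finally show ?thesis .
  qed
  have "(\<lambda>(j, k). M * (x ^ j * y ^ k)) summable_on UNIV"
    using summable_on_cmult_right[OF summable_on_prod_mult(1)[OF geo[OF xy(1,2)] _ geo[OF xy(3,4)]], of M] xy
    by (simp add: case_prod_unfold)
  then have "(\<lambda>p. norm (case p of (j, k) \<Rightarrow> z1 ^ j * z2 ^ k * a j k)) summable_on UNIV"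
    by (rule summable_on_comparison_test) (use tb in auto)
  then have "(\<lambda>(j, k). z1 ^ j * z2 ^ k * a j k) summable_on UNIV \<times> UNIV"
    by (simp add: abs_summable_summable)
  moreover have "((\<lambda>k. case (j, k) of (j, k) \<Rightarrow> z1 ^ j * z2 ^ k * a j k) has_sum z1 ^ j * c j z2) UNIV" for j
  proof -
    have "(\<lambda>k. z1 ^ j * z2 ^ k * a j k) sums (z1 ^ j * c j z2)"
      using sums_mult[OF holomorphic_power_series[OF hc[of j], of z2], of "z1 ^ j"] z
      by (simp add: a_def mult_ac)
    moreover have "summable (\<lambda>k. norm (z1 ^ j * z2 ^ k * a j k))"
    proof (rule summable_comparison_test')
      show "summable (\<lambda>k. M * (x ^ j * y ^ k))"
        using xy by (intro summable_mult summable_geometric) auto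
      show "norm (norm (z1 ^ j * z2 ^ k * a j k)) \<le> M * (x ^ j * y ^ k)" if "k \<ge> 0" for k
        using tb by simp
    qed
    ultimately show ?thesis
      by (simp add: norm_summable_imp_has_sum)
  qed
  moreover have "((\<lambda>j. z1 ^ j * c j z2) has_sum F z1 z2) UNIV"
  proof -
    have "(\<lambda>j. z1 ^ j * c j z2) sums F z1 z2"
      using holomorphic_power_series[OF h1[OF z(2)], of z1] z by (simp add: c_def mult_ac)
    moreover have "summable (\<lambda>j. norm (z1 ^ j * c j z2))"
    proof (rule summable_comparison_test')
      show "summable (\<lambda>j. M * x ^ j)"
        using xy by (intro summable_mult summable_geometric) auto
      show "norm (norm (z1 ^ j * c j z2)) \<le> M * x ^ j" if "j \<ge> 0" for j
      proof -
        have "norm z1 ^ j * norm (c j z2) \<le> norm z1 ^ j * (M / r ^ j)"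
          by (intro mult_left_mono cb z) auto
        then show ?thesis by (simp add: norm_mult norm_power x_def power_divide mult_ac)
      qed
    qed
    ultimately show ?thesis by (simp add: norm_summable_imp_has_sum)
  qed
  ultimately have "((\<lambda>(j, k). z1 ^ j * z2 ^ k * a j k) has_sum F z1 z2) (UNIV \<times> UNIV)"
    by (intro has_sum_SigmaI[where g = "\<lambda>j. z1 ^ j * c j z2"])
  then show "((\<lambda>(j, k). z1 ^ j * z2 ^ k * a j k) has_sum F z1 z2) UNIV"
    by simp
qed

section \<open>Real-analytic functions on the plane\<close>

text \<open>Real-analyticity at \<open>p\<close>, encoded by a holomorphic extension to a complex neighbourhood of \<open>p\<close>. In this form
it is inherited by algebraic operations and by composition with holomorphic functions, and power series
appear only once, in \<open>analytic_at_power_series\<close>.\<close>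

definition analytic_at :: "(real^2 \<Rightarrow> complex) \<Rightarrow> real^2 \<Rightarrow> bool" where
  "analytic_at g p \<longleftrightarrow> (\<exists>X F. open X \<and> cvec p \<in> X \<and> line_holomorphic F X \<and>
     (\<forall>x. cvec x \<in> X \<longrightarrow> F (cvec x) = g x))"

lemma analytic_atI:
  "open X \<Longrightarrow> cvec p \<in> X \<Longrightarrow> line_holomorphic F X \<Longrightarrow> (\<And>x. cvec x \<in> X \<Longrightarrow> F (cvec x) = g x)
    \<Longrightarrow> analytic_at g p"
  unfolding analytic_at_def by blast

lemma analytic_at_const: "analytic_at (\<lambda>x. c) p"
  by (rule analytic_atI[of UNIV _ "\<lambda>w. c"]) (auto simp: line_holomorphic_const)

lemma analytic_at_add:
  assumes "analytic_at f p" "analytic_at g p"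
  shows "analytic_at (\<lambda>x. f x + g x) p"
proof -
  obtain X F where X: "open X" "cvec p \<in> X" "line_holomorphic F X" "\<And>x. cvec x \<in> X \<Longrightarrow> F (cvec x) = f x"
    using assms(1) unfolding analytic_at_def by blast
  obtain Y G where Y: "open Y" "cvec p \<in> Y" "line_holomorphic G Y" "\<And>x. cvec x \<in> Y \<Longrightarrow> G (cvec x) = g x"
    using assms(2) unfolding analytic_at_def by blast
  show ?thesis
    by (rule analytic_atI[of "X \<inter> Y" _ "\<lambda>w. F w + G w"])
      (use X Y in \<open>auto intro: line_holomorphic_add line_holomorphic_subset\<close>)
qed

lemma analytic_at_mult:
  assumes "analytic_at f p" "analytic_at g p"
  shows "analytic_at (\<lambda>x. f x * g x) p"
proof -
  obtain X F where X: "open X" "cvec p \<in> X" "line_holomorphic F X" "\<And>x. cvec x \<in> X \<Longrightarrow> F (cvec x) = f x"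
    using assms(1) unfolding analytic_at_def by blast
  obtain Y G where Y: "open Y" "cvec p \<in> Y" "line_holomorphic G Y" "\<And>x. cvec x \<in> Y \<Longrightarrow> G (cvec x) = g x"
    using assms(2) unfolding analytic_at_def by blast
  show ?thesis
    by (rule analytic_atI[of "X \<inter> Y" _ "\<lambda>w. F w * G w"])
      (use X Y in \<open>auto intro: line_holomorphic_mult line_holomorphic_subset\<close>)
qed

lemma analytic_at_cnj:
  assumes "analytic_at f p"
  shows "analytic_at (\<lambda>x. cnj (f x)) p"
proof -
  obtain X F where X: "open X" "cvec p \<in> X" "line_holomorphic F X" "\<And>x. cvec x \<in> X \<Longrightarrow> F (cvec x) = f x"
    using assms unfolding analytic_at_def by blast
  have "open (vcnj -` X)"
    using X(1) by (intro open_vimage continuous_on_vcnj)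
  then show ?thesis
    using line_holomorphic_reflect[OF X(3,1)] X
    by (intro analytic_atI[of "vcnj -` X" _ "\<lambda>w. cnj (F (vcnj w))"]) (auto simp: vimage_def)
qed

lemma analytic_at_compose:
  assumes "analytic_at f p" "h holomorphic_on Y" "open Y" "f p \<in> Y"
  shows "analytic_at (\<lambda>x. h (f x)) p"
proof -
  obtain X F where X: "open X" "cvec p \<in> X" "line_holomorphic F X" "\<And>x. cvec x \<in> X \<Longrightarrow> F (cvec x) = f x"
    using assms(1) unfolding analytic_at_def by blast
  have "open (X \<inter> F -` Y)"
    using X(1,3) assms(3) by (intro continuous_open_preimage) (auto simp: line_holomorphic_def)
  moreover have "line_holomorphic (\<lambda>w. h (F w)) (X \<inter> F -` Y)"
    by (rule line_holomorphic_compose[OF line_holomorphic_subset[OF X(3)] assms(2)]) auto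
  ultimately show ?thesis
    using X assms(4) by (intro analytic_atI[of "X \<inter> F -` Y" _ "\<lambda>w. h (F w)"]) auto
qed

lemma analytic_at_transform:
  assumes "analytic_at f p" "open N" "p \<in> N" "\<And>x. x \<in> N \<Longrightarrow> f x = g x"
  shows "analytic_at g p"
proof -
  obtain X F where X: "open X" "cvec p \<in> X" "line_holomorphic F X" "\<And>x. cvec x \<in> X \<Longrightarrow> F (cvec x) = f x"
    using assms(1) unfolding analytic_at_def by blast
  define re where "re w = (\<chi> i. Re (w $ i))" for w :: "complex^2"
  have re: "re (cvec x) = x" for x by (simp add: re_def cvec_def vec_eq_iff)
  have "open (re -` N)"
    using assms(2) unfolding re_def by (intro open_vimage continuous_intros) auto
  then show ?thesis
    using X assms re
    by (intro analytic_atI[of "X \<inter> re -` N" _ F]) (auto intro: line_holomorphic_subset)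
qed

lemma norm_vec2_le: "norm (v :: complex^2) \<le> norm (v $ 1) + norm (v $ 2)"
  using L2_set_le_sum[of UNIV "\<lambda>i. norm (v $ i)"] by (simp add: norm_vec_def sum_2)

lemma cvec_add: "cvec (x + y) = cvec x + cvec y"
  by (simp add: cvec_def vec_eq_iff)

lemma analytic_at_power_series:
  assumes "analytic_at g p"
  shows "\<exists>r a. r > 0 \<and> (\<forall>h :: real^2. \<bar>h $ 1\<bar> < r \<and> \<bar>h $ 2\<bar> < r \<longrightarrow>
    ((\<lambda>(j, k). (h $ 1 ^ j * h $ 2 ^ k) *\<^sub>R a j k) has_sum g (p + h)) UNIV)"
proof -
  obtain X F where X: "open X" "cvec p \<in> X" "line_holomorphic F X" "\<And>x. cvec x \<in> X \<Longrightarrow> F (cvec x) = g x"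
    using assms unfolding analytic_at_def by blast
  define Y where "Y = X \<inter> F -` ball (F (cvec p)) 1"
  have "open Y" "cvec p \<in> Y"
    using X unfolding Y_def by (auto intro!: continuous_open_preimage simp: line_holomorphic_def)
  then obtain d where d: "d > 0" "ball (cvec p) d \<subseteq> Y"
    using open_contains_ball by blast
  define R where "R = d / 2"
  define q where "q z1 z2 = cvec p + z1 *s axis 1 1 + z2 *s axis 2 1" for z1 z2
  have q: "q z1 z2 \<in> Y" if "norm z1 < R" "norm z2 < R" for z1 z2
  proof -
    have "dist (cvec p) (q z1 z2) \<le> norm z1 + norm z2"
      using norm_vec2_le[of "cvec p - q z1 z2"]
      by (simp add: q_def dist_norm axis_def)
    then have "q z1 z2 \<in> ball (cvec p) d" using that by (simp add: R_def)
    then show ?thesis using d(2) by blast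
  qed
  have F: "line_holomorphic F Y"
    using X(3) by (rule line_holomorphic_subset) (auto simp: Y_def)
  obtain a where a: "\<And>z1 z2. norm z1 < R \<Longrightarrow> norm z2 < R \<Longrightarrow>
      ((\<lambda>(j, k). z1 ^ j * z2 ^ k * a j k) has_sum F (q z1 z2)) UNIV"
  proof (rule osgood_power_series[of R "\<lambda>z1 z2. F (q z1 z2)" "norm (F (cvec p)) + 1"])
    fix z2 :: complex assume z2: "norm z2 < R"
    have "(\<lambda>z1. F ((cvec p + z2 *s axis 2 1) + z1 *s axis 1 1)) holomorphic_on
        {z1. (cvec p + z2 *s axis 2 1) + z1 *s axis 1 1 \<in> Y}"
      using F by (auto simp: line_holomorphic_def)
    moreover have eq: "(cvec p + z2 *s axis 2 1) + z1 *s axis 1 1 = q z1 z2" for z1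
      by (simp add: q_def)
    ultimately show "(\<lambda>z1. F (q z1 z2)) holomorphic_on ball 0 R"
      unfolding eq using q z2 by (auto intro: holomorphic_on_subset)
  next
    fix z1 :: complex assume z1: "norm z1 < R"
    have "(\<lambda>z2. F ((cvec p + z1 *s axis 1 1) + z2 *s axis 2 1)) holomorphic_on
        {z2. (cvec p + z1 *s axis 1 1) + z2 *s axis 2 1 \<in> Y}"
      using F by (auto simp: line_holomorphic_def)
    then show "(\<lambda>z2. F (q z1 z2)) holomorphic_on ball 0 R"
      unfolding q_def[symmetric] using q z1 by (auto intro: holomorphic_on_subset)
  next
    fix z1 z2 :: complex assume "norm z1 < R" "norm z2 < R"
    then have "dist (F (cvec p)) (F (q z1 z2)) < 1"
      using q by (auto simp: Y_def)
    then show "norm (F (q z1 z2)) \<le> norm (F (cvec p)) + 1"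
      using norm_triangle_ineq2[of "F (q z1 z2)" "F (cvec p)"] by (simp add: dist_norm norm_minus_commute)
  qed (use d in \<open>auto simp: R_def\<close>)
  show ?thesis
  proof (intro exI[of _ R] exI[of _ a] conjI allI impI)
    show "R > 0" using d by (simp add: R_def)
    fix h :: "real^2" assume h: "\<bar>h $ 1\<bar> < R \<and> \<bar>h $ 2\<bar> < R"
    have eq: "q (of_real (h $ 1)) (of_real (h $ 2)) = cvec (p + h)"
      by (simp add: q_def cvec_def vec_eq_iff forall_2 axis_def)
    have "cvec (p + h) \<in> X"
      using q[of "of_real (h $ 1)" "of_real (h $ 2)"] h by (simp add: eq Y_def)
    then show "((\<lambda>(j, k). (h $ 1 ^ j * h $ 2 ^ k) *\<^sub>R a j k) has_sum g (p + h)) UNIV"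
      using a[of "of_real (h $ 1)" "of_real (h $ 2)"] h X(4)
      by (simp add: eq scaleR_conv_of_real)
  qed
qed

lemma real_analytic2I:
  assumes "\<And>i p. analytic_at (\<lambda>w. f w $ i) p"
  shows "real_analytic2 f"
  unfolding real_analytic2_def
proof
  fix p
  define Q where "Q i r a \<longleftrightarrow> r > 0 \<and> (\<forall>h :: real^2. \<bar>h $ 1\<bar> < r \<and> \<bar>h $ 2\<bar> < r \<longrightarrow>
    ((\<lambda>(j, k). (h $ 1 ^ j * h $ 2 ^ k) *\<^sub>R a j k) has_sum f (p + h) $ i) UNIV)"
    for i and r :: real and a :: "nat \<Rightarrow> nat \<Rightarrow> complex"
  have Q: "\<exists>r a. Q i r a" for i
    unfolding Q_def by (rule analytic_at_power_series[OF assms])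
  obtain r1 a1 r2 a2 where "Q 1 r1 a1" "Q 2 r2 a2"
    using Q[of 1] Q[of 2] by blast
  then have r1: "r1 > 0" "\<And>h :: real^2. \<bar>h $ 1\<bar> < r1 \<and> \<bar>h $ 2\<bar> < r1 \<Longrightarrow>
      ((\<lambda>(j, k). (h $ 1 ^ j * h $ 2 ^ k) *\<^sub>R a1 j k) has_sum f (p + h) $ 1) UNIV"
    and r2: "r2 > 0" "\<And>h :: real^2. \<bar>h $ 1\<bar> < r2 \<and> \<bar>h $ 2\<bar> < r2 \<Longrightarrow>
      ((\<lambda>(j, k). (h $ 1 ^ j * h $ 2 ^ k) *\<^sub>R a2 j k) has_sum f (p + h) $ 2) UNIV"
    unfolding Q_def by simp_all
  have bl: "bounded_linear (axis i :: complex \<Rightarrow> complex^2)" for i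
    unfolding linear_conv_bounded_linear[symmetric]
    by (rule linearI) (auto simp: vec_eq_iff axis_def)
  let ?a = "\<lambda>j k. axis 1 (a1 j k) + axis 2 (a2 j k) :: complex^2"
  have main: "((\<lambda>(j, k). (h $ 1 ^ j * h $ 2 ^ k) *\<^sub>R ?a j k) has_sum f (p + h)) UNIV"
    if h: "\<bar>h $ 1\<bar> < min r1 r2 \<and> \<bar>h $ 2\<bar> < min r1 r2" for h
  proof -
    have "((\<lambda>x. axis 1 (case x of (j, k) \<Rightarrow> (h $ 1 ^ j * h $ 2 ^ k) *\<^sub>R a1 j k) +
        axis 2 (case x of (j, k) \<Rightarrow> (h $ 1 ^ j * h $ 2 ^ k) *\<^sub>R a2 j k))
        has_sum (axis 1 (f (p + h) $ 1) + axis 2 (f (p + h) $ 2) :: complex^2)) UNIV"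
      using h by (intro has_sum_add has_sum_bounded_linear[OF bl] r1(2) r2(2)) auto
    moreover have "axis 1 (f (p + h) $ 1) + axis 2 (f (p + h) $ 2) = f (p + h)"
      by (simp add: vec_eq_iff forall_2 axis_def)
    moreover have "(\<lambda>x. axis 1 (case x of (j, k) \<Rightarrow> (h $ 1 ^ j * h $ 2 ^ k) *\<^sub>R a1 j k) +
        axis 2 (case x of (j, k) \<Rightarrow> (h $ 1 ^ j * h $ 2 ^ k) *\<^sub>R a2 j k)) =
        (\<lambda>(j, k). (h $ 1 ^ j * h $ 2 ^ k) *\<^sub>R ?a j k)"
      by (auto simp: vec_eq_iff axis_def fun_eq_iff)
    ultimately show ?thesis by simp
  qed
  have "min r1 r2 > 0" using r1(1) r2(1) by simp
  then show "\<exists>r>0. \<exists>a :: nat \<Rightarrow> nat \<Rightarrow> complex^2. \<forall>h :: real^2. \<bar>h $ 1\<bar> < r \<and> \<bar>h $ 2\<bar> < r \<longrightarrow>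
        ((\<lambda>(j, k). (h $ 1 ^ j * h $ 2 ^ k) *\<^sub>R a j k) has_sum f (p + h)) UNIV"
    by (intro exI[of _ "min r1 r2"] exI[of _ ?a] conjI allI impI main) auto
qed

section \<open>Hermitian geometry and lines\<close>

definition herm :: "complex^2 \<Rightarrow> complex^2 \<Rightarrow> complex" where
  "herm x y = x $ 1 * cnj (y $ 1) + x $ 2 * cnj (y $ 2)"

definition adjoint_mat :: "complex^2^2 \<Rightarrow> complex^2^2" where
  "adjoint_mat M = (\<chi> i j. cnj (M $ j $ i))"

lemma herm_diff_left: "herm (x - y) z = herm x z - herm y z"
  by (simp add: herm_def algebra_simps)

lemma herm_scale_left: "herm (c *s x) y = c * herm x y"
  by (simp add: herm_def algebra_simps)

lemma herm_scale_right: "herm x (c *s y) = cnj c * herm x y"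
  by (simp add: herm_def algebra_simps)

lemma norm_vec2: "norm (v :: complex^2) = sqrt ((norm (v $ 1))\<^sup>2 + (norm (v $ 2))\<^sup>2)"
  by (simp add: norm_vec_def L2_set_def sum_2)

lemma herm_self: "herm x x = of_real ((norm x)\<^sup>2)"
proof -
  have "(norm x)\<^sup>2 = (norm (x $ 1))\<^sup>2 + (norm (x $ 2))\<^sup>2"
    by (simp add: norm_vec2)
  then show ?thesis
    by (simp only: herm_def of_real_add complex_norm_square)
qed

lemma norm_smult: "norm (c *s v) = norm c * norm (v :: complex^2)"
proof -
  have "(norm (c *s v))\<^sup>2 = (norm c * norm v)\<^sup>2"
    by (simp add: norm_vec2 norm_mult power_mult_distrib algebra_simps)
  then show ?thesis by (simp add: power2_eq_iff_nonneg)
qed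

lemma norm_herm_le: "norm (herm x y) \<le> norm x * norm y"
proof -
  have "norm (herm x y) \<le> (\<Sum>i\<in>UNIV. norm (x $ i) * norm (y $ i))"
    unfolding herm_def sum_2 by (rule order_trans[OF norm_triangle_ineq]) (simp add: norm_mult)
  also have "\<dots> \<le> norm x * norm y"
    using L2_set_mult_ineq[of "\<lambda>i. norm (x $ i)" "\<lambda>i. norm (y $ i)" UNIV] by (simp add: norm_vec_def)
  finally show ?thesis .
qed

lemma herm_adjoint: "herm (M *v x) y = herm x (adjoint_mat M *v y)"
  by (simp add: herm_def adjoint_mat_def matrix_vector_mult_def sum_2 algebra_simps)

lemma adjoint_adjoint [simp]: "adjoint_mat (adjoint_mat M) = M"
  by (simp add: adjoint_mat_def vec_eq_iff)

lemma adjoint_mult: "adjoint_mat (A ** B) = adjoint_mat B ** adjoint_mat A"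
  by (simp add: adjoint_mat_def matrix_matrix_mult_def vec_eq_iff mult.commute)

lemma unitary_mat_iff:
  "unitary_mat M \<longleftrightarrow> adjoint_mat M ** M = mat 1 \<and> M ** adjoint_mat M = mat 1"
  by (simp add: unitary_mat_def adjoint_mat_def Let_def)

lemma unitary_adjoint: "unitary_mat M \<Longrightarrow> unitary_mat (adjoint_mat M)"
  by (simp add: unitary_mat_iff)

lemma herm_unitary: "unitary_mat M \<Longrightarrow> herm (M *v x) (M *v y) = herm x y"
  by (simp add: herm_adjoint matrix_vector_mul_assoc unitary_mat_iff)

lemma norm_unitary: "unitary_mat M \<Longrightarrow> norm (M *v x) = norm x"
  using herm_unitary[of M x x] by (simp add: herm_self power2_eq_iff_nonneg flip: of_real_power)

lemma continuous_on_herm [continuous_intros]: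
  "continuous_on S f \<Longrightarrow> continuous_on S g \<Longrightarrow> continuous_on S (\<lambda>x. herm (f x) (g x))"
  unfolding herm_def by (intro continuous_intros)

lemma continuous_on_mat_vec [continuous_intros]:
  fixes f :: "'a::topological_space \<Rightarrow> complex^2^2"
  shows "continuous_on S f \<Longrightarrow> continuous_on S g \<Longrightarrow> continuous_on S (\<lambda>x. f x *v g x)"
  unfolding matrix_vector_mult_def by (intro continuous_intros)

lemma tendsto_mat_vec:
  fixes f :: "'a \<Rightarrow> complex^2^2"
  shows "(f \<longlongrightarrow> a) F \<Longrightarrow> (g \<longlongrightarrow> b) F \<Longrightarrow> ((\<lambda>x. f x *v g x) \<longlongrightarrow> a *v b) F"
  unfolding matrix_vector_mult_def by (intro tendsto_intros)

lemma continuous_on_smult [continuous_intros]: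
  fixes f :: "'a::topological_space \<Rightarrow> complex" and g :: "'a \<Rightarrow> complex^2"
  shows "continuous_on S f \<Longrightarrow> continuous_on S g \<Longrightarrow> continuous_on S (\<lambda>x. f x *s g x)"
  unfolding vector_scalar_mult_def by (intro continuous_intros)

lemma continuous_on_adjoint [continuous_intros]:
  "continuous_on S f \<Longrightarrow> continuous_on S (\<lambda>x. adjoint_mat (f x))"
  unfolding adjoint_mat_def by (intro continuous_intros)

lemma CP1_nonzero:
  assumes "L \<in> CP1" obtains v where "v \<noteq> 0" "L = complex_line v"
  using assms by (auto simp: CP1_def)

lemma CP1_eq_complex_line:
  assumes L: "L \<in> CP1" and v: "v \<in> L" "v \<noteq> 0"
  shows "L = complex_line v"
proof -
  obtain u where u: "u \<noteq> 0" "L = complex_line u" using CP1_nonzero[OF L] .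
  then obtain c where c: "v = c *s u" using v(1) by (auto simp: complex_line_def)
  with v(2) have c0: "c \<noteq> 0" by auto
  have "a *s u \<in> complex_line v" for a
    using c0 by (auto simp: complex_line_def c image_iff intro!: exI[of _ "a / c"])
  moreover have "a *s v \<in> complex_line u" for a
    by (auto simp: complex_line_def c)
  ultimately show ?thesis unfolding u(2) by (auto simp: complex_line_def)
qed

lemma smult_in_CP1: "L \<in> CP1 \<Longrightarrow> v \<in> L \<Longrightarrow> c *s v \<in> L"
  by (auto simp: CP1_def complex_line_def)

lemma CP1_unit_expansion:
  assumes "L \<in> CP1" "e \<in> L" "norm e = 1" "x \<in> L"
  shows "x = herm x e *s e"
proof -
  have "L = complex_line e"
    using assms by (intro CP1_eq_complex_line) auto
  then obtain c where "x = c *s e" using assms(4) by (auto simp: complex_line_def)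
  then show ?thesis using assms(3) by (simp add: herm_scale_left herm_self)
qed

text \<open>The orthogonal projection \<open>v v\<^sup>* / |v|\<^sup>2\<close>. The vector chosen in \<open>L\<close> does not matter, see
\<open>line_proj_complex_line\<close>.\<close>

definition line_proj :: "(complex^2) set \<Rightarrow> complex^2^2" where
  "line_proj L = (let v = SOME v. v \<in> L \<and> v \<noteq> 0 in
     \<chi> i j. v $ i * cnj (v $ j) / of_real ((norm v)\<^sup>2))"

lemma line_proj_complex_line:
  assumes "v \<noteq> 0"
  shows "line_proj (complex_line v) = (\<chi> i j. v $ i * cnj (v $ j) / of_real ((norm v)\<^sup>2))"
proof -
  define u where "u = (SOME u. u \<in> complex_line v \<and> u \<noteq> 0)"
  have "v \<in> complex_line v" by (auto simp: complex_line_def image_iff intro!: exI[of _ 1])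
  then have "u \<in> complex_line v \<and> u \<noteq> 0"
    unfolding u_def using assms by (intro someI) auto
  then obtain c where c: "u = c *s v" "c \<noteq> 0" by (auto simp: complex_line_def)
  have cc: "complex_of_real ((norm c)\<^sup>2) = c * cnj c" by (rule complex_norm_square)
  show ?thesis
    unfolding line_proj_def u_def[symmetric] Let_def c(1) norm_smult power_mult_distrib of_real_mult cc
    using c(2) by (simp add: vec_eq_iff)
qed

lemma line_proj_apply:
  assumes "v \<noteq> 0"
  shows "line_proj (complex_line v) *v x = (herm x v / of_real ((norm v)\<^sup>2)) *s v"
  using assms by (simp add: line_proj_complex_line herm_def vec_eq_iff matrix_vector_mult_def sum_2
      add_divide_distrib distrib_left distrib_right mult_ac del: of_real_power)

lemma line_proj_in:
  assumes "L \<in> CP1" shows "line_proj L *v x \<in> L"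
proof -
  obtain v where v: "v \<noteq> 0" "L = complex_line v" using CP1_nonzero[OF assms(1)] .
  show ?thesis unfolding v(2) line_proj_apply[OF v(1)] unfolding complex_line_def by (rule rangeI)
qed

lemma line_proj_id:
  assumes "L \<in> CP1" "x \<in> L" 
  shows "line_proj L *v x = x"
proof -
  obtain v where v: "v \<noteq> 0" "L = complex_line v" using CP1_nonzero[OF assms(1)] .
  then obtain c where "x = c *s v" using assms(2) by (auto simp: complex_line_def)
  then show ?thesis using v by (simp add: line_proj_apply herm_scale_left herm_self)
qed

text \<open>The quotient topology on the projective line is the one that makes this a statement about the map
\<open>v \<mapsto> v v\<^sup>* / |v|\<^sup>2\<close> on nonzero vectors. It turns a continuous line field into a continuous matrix function.\<close>

lemma continuous_map_line_proj: "continuous_map CP1_topology euclidean line_proj"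
  unfolding continuous_map_def
proof (intro conjI allI impI)
  fix U :: "(complex^2^2) set" assume "openin euclidean U"
  then have U: "open U" by simp
  let ?p = "\<lambda>v::complex^2. (\<chi> i j. v $ i * cnj (v $ j) / of_real ((norm v)\<^sup>2)) :: complex^2^2"
  have c: "continuous_on (- {0}) ?p"
    by (intro continuous_intros) auto
  have "open (- {0} \<inter> ?p -` U)"
    by (rule continuous_open_preimage[OF c _ U]) auto
  also have "- {0} \<inter> ?p -` U = {v. v \<noteq> 0 \<and> complex_line v \<in> {L \<in> topspace CP1_topology. line_proj L \<in> U}}"
    by (auto simp: topspace_CP1_topology line_proj_complex_line CP1_def)
  finally show "openin CP1_topology {L \<in> topspace CP1_topology. line_proj L \<in> U}"
    by (auto simp: openin_CP1_topology topspace_CP1_topology)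
qed auto

lemma mat_line_mem: "v \<in> L \<Longrightarrow> M *v v \<in> mat_line M L"
  by (auto simp: mat_line_def)

section \<open>Continuous lifts and equivariant continuation\<close>

text \<open>Contract \<open>Q\<close> to the origin along rays, in \<open>K\<close> steps, and transport a unit vector of the line at the origin
outwards by projecting it onto the line reached at each step and normalising. By uniform continuity two
consecutive lines on a ray are so close, for \<open>K\<close> large, that the projection of a unit vector is nonzero.\<close>

lemma unit_section_on_starlike_compact:
  fixes l :: "real^2 \<Rightarrow> (complex^2) set"
  assumes l: "continuous_map euclidean CP1_topology l"
    and Q: "compact Q" "\<And>w t. w \<in> Q \<Longrightarrow> 0 \<le> t \<Longrightarrow> t \<le> 1 \<Longrightarrow> t *\<^sub>R w \<in> Q"
  obtains e where "continuous_on Q e" "\<And>w. w \<in> Q \<Longrightarrow> norm (e w) = 1 \<and> e w \<in> l w"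
proof -
  have lC: "l w \<in> CP1" for w
    using l by (auto simp: continuous_map_def topspace_CP1_topology)
  have "continuous_map euclidean euclidean (line_proj \<circ> l)"
    using continuous_map_compose[OF l continuous_map_line_proj] .
  then have cp: "continuous_on UNIV (\<lambda>w. line_proj (l w))"
    by (simp add: o_def)
  obtain B where B: "B > 0" "\<And>w. w \<in> Q \<Longrightarrow> norm w \<le> B"
    using compact_imp_bounded[OF Q(1)] bounded_pos by blast
  let ?S = "Q \<times> sphere (0::complex^2) 1"
  have "continuous_on ?S (\<lambda>(w, x). line_proj (l w) *v x)"
    unfolding case_prod_unfold
    by (intro continuous_intros continuous_on_compose2[OF cp]) auto
  then have "uniformly_continuous_on ?S (\<lambda>(w, x). line_proj (l w) *v x)"
    by (rule compact_uniformly_continuous) (auto intro: compact_Times Q)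
  then obtain d where d: "d > 0" "\<And>w x w' x'. (w, x) \<in> ?S \<Longrightarrow> (w', x') \<in> ?S \<Longrightarrow>
      dist (w', x') (w, x) < d \<Longrightarrow> dist (line_proj (l w') *v x') (line_proj (l w) *v x) < 1"
    unfolding uniformly_continuous_on_def by (metis (no_types, lifting) case_prod_conv zero_less_one)
  obtain K :: nat where K: "B / d < K" using reals_Archimedean2 by blast
  have K0: "K > 0" using K B(1) d(1) by (metis divide_pos_pos gr0I not_less_iff_gr_or_eq of_nat_0 order_less_trans)
  have "\<exists>e. continuous_on Q e \<and> (\<forall>w\<in>Q. norm (e w) = 1 \<and> e w \<in> l ((real k / real K) *\<^sub>R w))"
    if "k \<le> K" for k
    using that
  proof (induction k)
    case 0
    obtain v where v: "v \<noteq> 0" "l 0 = complex_line v" using CP1_nonzero[OF lC[of 0]] .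
    have "v \<in> l 0" unfolding v(2) complex_line_def by (auto simp: image_iff intro!: exI[of _ 1])
    then have "of_real (inverse (norm v)) *s v \<in> l 0"
      by (rule smult_in_CP1[OF lC])
    moreover have "norm (of_real (inverse (norm v)) *s v) = 1"
      using v(1) unfolding norm_smult norm_of_real by simp
    ultimately show ?case
      by (intro exI[of _ "\<lambda>_. of_real (inverse (norm v)) *s v"]) auto
  next
    case (Suc k)
    then obtain e where e: "continuous_on Q e" "\<And>w. w \<in> Q \<Longrightarrow> norm (e w) = 1 \<and> e w \<in> l ((real k / real K) *\<^sub>R w)"
      by auto
    define p where "p w = line_proj (l ((real (Suc k) / real K) *\<^sub>R w)) *v e w" for w
    have p0: "p w \<noteq> 0" if w: "w \<in> Q" for w
    proof -
      let ?w = "(real k / real K) *\<^sub>R w" and ?w' = "(real (Suc k) / real K) *\<^sub>R w"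
      have "?w \<in> Q" "?w' \<in> Q"
        using Suc.prems K0 by (auto intro!: Q(2) w)
      have "?w' - ?w = (1 / real K) *\<^sub>R w"
        unfolding scaleR_diff_left[symmetric] by (simp add: diff_divide_distrib[symmetric])
      then have "dist ?w' ?w \<le> B / K"
        using B(2)[OF w] K0 by (simp add: dist_norm divide_right_mono)
      also have "\<dots> < d"
        using K K0 d(1) by (simp add: field_simps)
      finally have "dist (?w', e w) (?w, e w) < d"
        by (simp add: dist_Pair_Pair)
      then have "dist (line_proj (l ?w') *v e w) (line_proj (l ?w) *v e w) < 1"
        using \<open>?w \<in> Q\<close> \<open>?w' \<in> Q\<close> e(2)[OF w] by (intro d(2)) auto
      then have "dist (p w) (e w) < 1"
        using e(2)[OF w] by (simp add: p_def line_proj_id[OF lC])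
      then show ?thesis using e(2)[OF w] by (auto simp: dist_norm)
    qed
    have "continuous_on Q p"
      unfolding p_def by (intro continuous_intros e continuous_on_compose2[OF cp]) auto
    then have "continuous_on Q (\<lambda>w. of_real (inverse (norm (p w))) *s p w)"
      using p0 by (intro continuous_intros) auto
    moreover have "norm (of_real (inverse (norm (p w))) *s p w) = 1" if "w \<in> Q" for w
      using p0[OF that] unfolding norm_smult norm_of_real by simp
    moreover have "of_real (inverse (norm (p w))) *s p w \<in> l ((real (Suc k) / real K) *\<^sub>R w)" for w
      unfolding p_def by (intro smult_in_CP1 line_proj_in lC)
    ultimately show ?case by blast
  qed
  from this[of K] K0 show ?thesis using that by auto
qed

text \<open>With \<open>X = Y\<inverse>\<close>, the fixed points of \<open>twisted_shift X d\<close> are the maps \<open>h\<close> with \<open>h (w + d) = Y w *v h w\<close>.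
Working with this operator instead of transition matrices hides all matrix products; the type of the
argument is left open, because real and complex arguments are both needed.\<close>

definition twisted_shift :: "('a::real_vector \<Rightarrow> complex^2^2) \<Rightarrow> 'a \<Rightarrow> ('a \<Rightarrow> complex^2) \<Rightarrow> 'a \<Rightarrow> complex^2" where
  "twisted_shift X d h w = X w *v h (w + d)"

text \<open>Integer powers of \<open>twisted_shift X d\<close>. The inverse operator is again of this form, with \<open>Y (w - d)\<close> and \<open>- d\<close>
in place of \<open>X w\<close> and \<open>d\<close>. It is an inverse only where \<open>X\<close> and \<open>Y\<close> are inverse to each other; on the complex
strip the definition makes sense without that.\<close>

definition twisted_shift_pow ::
  "('a::real_vector \<Rightarrow> complex^2^2) \<Rightarrow> ('a \<Rightarrow> complex^2^2) \<Rightarrow> 'a \<Rightarrow> int \<Rightarrow> ('a \<Rightarrow> complex^2) \<Rightarrow> 'a \<Rightarrow> complex^2"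
  where "twisted_shift_pow X Y d n h =
    (if n \<ge> 0 then (twisted_shift X d ^^ nat n) h else (twisted_shift (\<lambda>w. Y (w - d)) (- d) ^^ nat (- n)) h)"

lemma twisted_shift_pow_0 [simp]: "twisted_shift_pow X Y d 0 h = h"
  by (simp add: twisted_shift_pow_def)

lemma twisted_shift_pow_Suc:
  assumes "\<And>w. X w ** Y w = mat 1"
  shows "twisted_shift_pow X Y d (n + 1) h = twisted_shift X d (twisted_shift_pow X Y d n h)"
proof (cases "n \<ge> 0")
  case True
  then show ?thesis by (simp add: twisted_shift_pow_def nat_add_distrib)
next
  case False
  define m where "m = nat (- n - 1)"
  have n: "n = - int (Suc m)" using False by (simp add: m_def)
  have "twisted_shift X d (twisted_shift (\<lambda>w. Y (w - d)) (- d) g) = g" for g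
    using assms by (simp add: twisted_shift_def fun_eq_iff matrix_vector_mul_assoc)
  moreover have "twisted_shift_pow X Y d (n + 1) h = (twisted_shift (\<lambda>w. Y (w - d)) (- d) ^^ m) h"
    by (cases m) (auto simp: twisted_shift_pow_def n nat_add_distrib)
  moreover have "nat (int m + 1) = Suc m" by simp
  ultimately show ?thesis
    by (simp add: twisted_shift_pow_def n)
qed

text \<open>For a property invariant under the shift by \<open>d\<close>, it is enough to look at a fundamental domain of the shift.\<close>

lemma shift_induct:
  fixes S :: "'a::real_vector set" and f :: "'a \<Rightarrow> real"
  assumes f: "\<And>w. f (w + d) = f w + 1" and S: "\<And>w. w + d \<in> S \<longleftrightarrow> w \<in> S"
    and R: "\<And>w. w \<in> S \<Longrightarrow> R (w + d) \<longleftrightarrow> R w"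
    and base: "\<And>w. w \<in> S \<Longrightarrow> 0 \<le> f w \<Longrightarrow> f w < 1 \<Longrightarrow> R w"
    and w: "w \<in> S"
  shows "R w"
proof -
  have 1: "v + real n *\<^sub>R d \<in> S \<longleftrightarrow> v \<in> S" for v n
  proof (induction n)
    case (Suc n)
    have "v + real (Suc n) *\<^sub>R d = (v + real n *\<^sub>R d) + d" by (simp add: algebra_simps)
    then show ?case using S Suc by metis
  qed simp
  have 2: "v \<in> S \<Longrightarrow> R (v + real n *\<^sub>R d) \<longleftrightarrow> R v" for v n
  proof (induction n)
    case (Suc n)
    have "v + real (Suc n) *\<^sub>R d = (v + real n *\<^sub>R d) + d" by (simp add: algebra_simps)
    then show ?case using R 1 Suc by metis
  qed simp
  have 3: "f (v + real n *\<^sub>R d) = f v + real n" for v n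
  proof (induction n)
    case (Suc n)
    have "v + real (Suc n) *\<^sub>R d = (v + real n *\<^sub>R d) + d" by (simp add: algebra_simps)
    then show ?case using f Suc by (metis add.assoc of_nat_Suc add.commute)
  qed simp
  show ?thesis
  proof (cases "\<lfloor>f w\<rfloor> \<ge> 0")
    case True
    define n where "n = nat \<lfloor>f w\<rfloor>"
    define v where "v = w - real n *\<^sub>R d"
    have wv: "w = v + real n *\<^sub>R d" by (simp add: v_def)
    have "f w = f v + real n" using 3[of v n] by (simp add: wv)
    moreover have "real n = of_int \<lfloor>f w\<rfloor>" using True by (simp add: n_def)
    ultimately have "0 \<le> f v" "f v < 1" by linarith+
    then show ?thesis using 1[of v n] 2[of v n] base[of v] w by (simp add: wv)
  next
    case False
    define n where "n = nat (- \<lfloor>f w\<rfloor>)"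
    define v where "v = w + real n *\<^sub>R d"
    have "real n = - of_int \<lfloor>f w\<rfloor>" using False by (simp add: n_def)
    then have "0 \<le> f v" "f v < 1" using 3[of w n] unfolding v_def by linarith+
    then show ?thesis using 1[of w n] 2[of w n] base[of v] w by (simp add: v_def)
  qed
qed

text \<open>The extension moves \<open>w\<close> by the integer part of its \<open>i\<close>-th coordinate. On \<open>-1 \<le> w\<^sub>i \<le> 1\<close> it consists of
two continuous pieces on relatively closed sets, which agree on \<open>w\<^sub>i = 0\<close> by the matching condition; elsewhere
continuity follows from equivariance.\<close>

lemma equivariant_extension:
  fixes X Y :: "real^2 \<Rightarrow> complex^2^2" and i :: 2
  defines "d \<equiv> axis i 1"
  assumes XY: "\<And>w. X w ** Y w = mat 1" "\<And>w. Y w ** X w = mat 1"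
    and XYc: "continuous_on UNIV X" "continuous_on UNIV Y"
    and S: "\<And>w. w + d \<in> S \<longleftrightarrow> w \<in> S"
    and e0: "continuous_on {w \<in> S. 0 \<le> w $ i \<and> w $ i \<le> 1} e0"
    and match: "\<And>w. w \<in> S \<Longrightarrow> w $ i = 0 \<Longrightarrow> e0 (w + d) = Y w *v e0 w"
  obtains e where "continuous_on S e" "\<And>w. e (w + d) = Y w *v e w"
    "\<And>w. w \<in> S \<Longrightarrow> 0 \<le> w $ i \<Longrightarrow> w $ i \<le> 1 \<Longrightarrow> e w = e0 w"
proof
  define e where "e w = twisted_shift_pow X Y d (- \<lfloor>w $ i\<rfloor>) e0 w" for w
  have di: "(w + d) $ i = w $ i + 1" for w :: "real^2" by (simp add: d_def)
  have eX: "e w = X w *v e (w + d)" for w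
  proof -
    have "e (w + d) = twisted_shift_pow X Y d (- \<lfloor>w $ i\<rfloor> - 1) e0 (w + d)"
      unfolding e_def di by simp
    then show ?thesis
      using twisted_shift_pow_Suc[of X Y d "- \<lfloor>w $ i\<rfloor> - 1" e0, OF XY(1)] by (simp add: e_def twisted_shift_def)
  qed
  show eY: "e (w + d) = Y w *v e w" for w
    by (simp add: eX[of w] matrix_vector_mul_assoc XY)
  show ee: "e w = e0 w" if "w \<in> S" "0 \<le> w $ i" "w $ i \<le> 1" for w
  proof (cases "w $ i = 1")
    case True
    define v where "v = w - d"
    have v: "w = v + d" "v $ i = 0" using True by (auto simp: v_def d_def)
    then have "v \<in> S" using S that by metis
    have "e v = e0 v" using v by (simp add: e_def)
    then show ?thesis using eY[of v] match[OF \<open>v \<in> S\<close> v(2)] v(1) by simp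
  next
    case False
    then have "\<lfloor>w $ i\<rfloor> = 0" using that by linarith
    then show ?thesis by (simp add: e_def)
  qed
  let ?A = "{w \<in> S. 0 \<le> w $ i \<and> w $ i \<le> 1}" and ?B = "{w \<in> S. - 1 \<le> w $ i \<and> w $ i \<le> 0}"
  have cA: "continuous_on ?A e"
    using e0 by (rule continuous_on_eq) (auto simp: ee)
  have "continuous_on ?B (\<lambda>w. X w *v e (w + d))"
    using S by (intro continuous_intros continuous_on_subset[OF XYc(1)] continuous_on_compose2[OF cA])
      (auto simp: d_def)
  then have cB: "continuous_on ?B e"
    by (rule continuous_on_eq) (auto simp: eX[symmetric])
  have cl: "closedin (top_of_set {w \<in> S. -1 \<le> w $ i \<and> w $ i \<le> 1}) ?A"
    "closedin (top_of_set {w \<in> S. -1 \<le> w $ i \<and> w $ i \<le> 1}) ?B"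
  proof -
    have c: "closed {w :: real^2. 0 \<le> w $ i}" "closed {w :: real^2. w $ i \<le> 0}"
      by (intro closed_Collect_le continuous_intros)+
    have "?A = {w \<in> S. -1 \<le> w $ i \<and> w $ i \<le> 1} \<inter> {w. 0 \<le> w $ i}"
      "?B = {w \<in> S. -1 \<le> w $ i \<and> w $ i \<le> 1} \<inter> {w. w $ i \<le> 0}" by auto
    then show "closedin (top_of_set {w \<in> S. -1 \<le> w $ i \<and> w $ i \<le> 1}) ?A"
      "closedin (top_of_set {w \<in> S. -1 \<le> w $ i \<and> w $ i \<le> 1}) ?B"
      using c by (auto simp: closedin_closed)
  qed
  have "?A \<union> ?B = {w \<in> S. -1 \<le> w $ i \<and> w $ i \<le> 1}" by auto
  then have cAB: "continuous_on {w \<in> S. -1 \<le> w $ i \<and> w $ i \<le> 1} e"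
    using continuous_on_Un_local[of ?A ?B e] cl cA cB by simp
  have "continuous (at w within S) e" if "w \<in> S" for w
  proof (rule shift_induct[of "\<lambda>w. w $ i" d S "\<lambda>w. continuous (at w within S) e", OF di S _ _ that])
    fix w assume w: "w \<in> S" "0 \<le> w $ i" "w $ i < 1"
    have op: "open {w :: real^2. - 1 < w $ i \<and> w $ i < 1}"
      by (intro open_Collect_conj open_Collect_less continuous_intros)
    have "continuous_on ({w. - 1 < w $ i \<and> w $ i < 1} \<inter> S) e"
      using cAB by (rule continuous_on_subset) auto
    then have "continuous (at w within ({w. - 1 < w $ i \<and> w $ i < 1} \<inter> S)) e"
      using w by (auto simp: continuous_on_eq_continuous_within)
    then show "continuous (at w within S) e"
    proof -
      have "at w within ({w. - 1 < w $ i \<and> w $ i < 1} \<inter> S) = at w within S"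
        by (rule at_within_nhd[OF _ op]) (use w in auto)
      then show ?thesis using \<open>continuous (at w within ({w. - 1 < w $ i \<and> w $ i < 1} \<inter> S)) e\<close>
        by (simp only:)
    qed
  next
    fix w assume w: "w \<in> S"
    have shift: "filterlim (\<lambda>v. v + c) (at (v + c) within S) (at v within S)"
      if "\<And>v. v + c \<in> S \<longleftrightarrow> v \<in> S" for c v :: "real^2"
      unfolding filterlim_at using that
      by (auto intro!: tendsto_eq_intros simp: eventually_at_filter)
    have X: "(X \<longlongrightarrow> X w) (at w within S)" and Y: "(Y \<longlongrightarrow> Y w) (at (w + d + - d) within S)"
      using XYc by (auto simp: continuous_on_eq_continuous_at isCont_def intro: tendsto_within_subset)
    have S': "v + - d \<in> S \<longleftrightarrow> v \<in> S" for v using S[of "v - d"] by simp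
    show "continuous (at (w + d) within S) e \<longleftrightarrow> continuous (at w within S) e"
    proof
      assume "continuous (at (w + d) within S) e"
      then have "((\<lambda>v. e (v + d)) \<longlongrightarrow> e (w + d)) (at w within S)"
        unfolding continuous_within by (rule filterlim_compose[OF _ shift[OF S]])
      from tendsto_mat_vec[OF X this] show "continuous (at w within S) e"
        by (simp add: continuous_within eX[symmetric])
    next
      assume "continuous (at w within S) e"
      then have "continuous (at (w + d + - d) within S) e" by simp
      then have "((\<lambda>v. e (v + - d)) \<longlongrightarrow> e (w + d + - d)) (at (w + d) within S)"
        unfolding continuous_within by (rule filterlim_compose[OF _ shift[OF S']])
      moreover have "((\<lambda>v. Y (v + - d)) \<longlongrightarrow> Y w) (at (w + d) within S)"
        by (rule filterlim_compose[OF Y shift[OF S']])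
      ultimately have "((\<lambda>v. Y (v + - d) *v e (v + - d)) \<longlongrightarrow> Y w *v e w) (at (w + d) within S)"
        using tendsto_mat_vec by fastforce
      moreover have "Y (v + - d) *v e (v + - d) = e v" for v
        using eY[of "v - d"] by simp
      ultimately show "continuous (at (w + d) within S) e"
        by (simp add: continuous_within eY)
    qed
  qed
  then show "continuous_on S e"
    by (auto simp: continuous_on_eq_continuous_within)
qed

section \<open>The charge\<close>

definition scale_mat :: "complex \<Rightarrow> complex^2^2 \<Rightarrow> complex^2^2" where
  "scale_mat c M = (\<chi> i j. c * M $ i $ j)"

lemma scale_mat_vec: "scale_mat c M *v x = c *s (M *v x)"
  by (simp add: scale_mat_def matrix_vector_mult_def vec_eq_iff sum_2 algebra_simps)

lemma scale_mat_mult: "scale_mat c M ** scale_mat d N = scale_mat (c * d) (M ** N)"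
  by (simp add: scale_mat_def matrix_matrix_mult_def vec_eq_iff sum_2 algebra_simps)

lemma unitary_scale_mat:
  assumes "unitary_mat M" "norm c = 1"
  shows "unitary_mat (scale_mat c M)"
proof -
  have "adjoint_mat (scale_mat c M) = scale_mat (cnj c) (adjoint_mat M)"
    by (simp add: adjoint_mat_def scale_mat_def vec_eq_iff)
  moreover have "cnj c * c = 1"
    using assms(2) complex_norm_square[of c] by (simp add: mult.commute)
  moreover have "scale_mat 1 N = N" for N by (simp add: scale_mat_def vec_eq_iff)
  ultimately show ?thesis
    using assms(1) by (simp add: unitary_mat_iff scale_mat_mult mult.commute)
qed

definition point :: "real \<Rightarrow> real \<Rightarrow> real^2" where
  "point x y = x *\<^sub>R axis 1 1 + y *\<^sub>R axis 2 1"

lemma point_nth [simp]: "point x y $ 1 = x" "point x y $ 2 = y"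
  by (simp_all add: point_def axis_def)

lemma point_eqI: "w $ 1 = x \<Longrightarrow> w $ 2 = y \<Longrightarrow> w = point x y"
  by (simp add: vec_eq_iff forall_2)

lemma point_add_axis: "point x y + axis 1 1 = point (x + 1) y" "point x y + axis 2 1 = point x (y + 1)"
  by (simp_all add: vec_eq_iff forall_2 axis_def)

lemma continuous_on_point [continuous_intros]:
  "continuous_on S f \<Longrightarrow> continuous_on S g \<Longrightarrow> continuous_on S (\<lambda>x. point (f x) (g x))"
  unfolding point_def by (intro continuous_intros)

lemma unit_circle_continuous_log:
  fixes c :: "'a::real_normed_vector \<Rightarrow> complex"
  assumes "continuous_on S c" "convex S" "\<And>x. x \<in> S \<Longrightarrow> norm (c x) = 1"
  obtains a where "continuous_on S a" "\<And>x. x \<in> S \<Longrightarrow> exp (\<i> * complex_of_real (a x)) = c x"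
proof -
  have "contractible S" using assms(2) by (rule convex_imp_contractible)
  moreover have "c x \<noteq> 0" if "x \<in> S" for x using assms(3)[OF that] by auto
  ultimately obtain g where g: "continuous_on S g" "\<And>x. x \<in> S \<Longrightarrow> c x = exp (g x)"
    using continuous_logarithm_on_contractible[OF assms(1)] by metis
  show ?thesis
  proof
    show "continuous_on S (\<lambda>x. Im (g x))" by (intro continuous_intros g)
    fix x assume x: "x \<in> S"
    have "Re (g x) = 0" using assms(3)[OF x] g(2)[OF x] by simp
    then have "g x = \<i> * complex_of_real (Im (g x))" by (simp add: complex_eq_iff)
    then show "exp (\<i> * complex_of_real (Im (g x))) = c x" using g(2)[OF x] by simp
  qed
qed

text \<open>A continuous line field over the plane that descends to the torus through the sewing.\<close>

locale sewn_line =
  fixes U1 U2 :: "real^2 \<Rightarrow> complex^2^2" and l :: "real^2 \<Rightarrow> (complex^2) set"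
  assumes sewing: "sewing_system U1 U2"
    and l_continuous: "continuous_map euclidean CP1_topology l"
    and l_shift: "l (w + e\<^sub>1) = mat_line (U1 w) (l w)" "l (w + e\<^sub>2) = mat_line (U2 w) (l w)"
begin

lemma l_CP1: "l w \<in> CP1"
  using l_continuous by (auto simp: continuous_map_def topspace_CP1_topology)

lemma unitary: "unitary_mat (U1 w)" "unitary_mat (U2 w)"
  using sewing by (auto simp: sewing_system_def)

lemma U_continuous: "continuous_on UNIV U1" "continuous_on UNIV U2"
  using sewing by (auto simp: sewing_system_def)

lemma sewing_relation: "U1 (w + e\<^sub>2) ** U2 w = U2 (w + e\<^sub>1) ** U1 w"
  using sewing by (auto simp: sewing_system_def)

text \<open>The phase of the charge is absorbed into the second sewing matrix. The new pair still satisfies the sewing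
relation (\<open>twisted_U2_relation\<close>), because \<open>exp (2 \<pi> \<i> m w\<^sub>1)\<close> has period 1 in \<open>w\<^sub>1\<close>. So a section of charge \<open>m\<close> is
just a map equivariant under a unitary sewing system.\<close>

definition twisted_U2 :: "int \<Rightarrow> real^2 \<Rightarrow> complex^2^2" where
  "twisted_U2 m w = scale_mat (exp (2 * complex_of_real pi * \<i> * of_int m * complex_of_real (w $ 1))) (U2 w)"

lemma quasi_periodic_iff:
  "quasi_periodic U1 U2 m e \<longleftrightarrow>
    (\<forall>w. e (w + e\<^sub>1) = U1 w *v e w) \<and> (\<forall>w. e (w + e\<^sub>2) = twisted_U2 m w *v e w)"
  by (simp add: quasi_periodic_def twisted_U2_def scale_mat_vec)

lemma norm_phase: "norm (exp (2 * complex_of_real pi * \<i> * of_int m * complex_of_real x)) = 1"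
  by simp

lemma unitary_twisted_U2: "unitary_mat (twisted_U2 m w)"
  unfolding twisted_U2_def by (intro unitary_scale_mat unitary norm_phase)

lemma twisted_U2_continuous: "continuous_on UNIV (twisted_U2 m)"
  unfolding twisted_U2_def[abs_def] scale_mat_def
  by (intro continuous_intros U_continuous)

lemma twisted_U2_relation: "U1 (w + e\<^sub>2) ** twisted_U2 m w = twisted_U2 m (w + e\<^sub>1) ** U1 w"
proof -
  have "exp (2 * complex_of_real pi * \<i> * of_int m * complex_of_real ((w + e\<^sub>1) $ 1)) =
      exp (2 * complex_of_real pi * \<i> * of_int m * complex_of_real (w $ 1))"
  proof -
    have "2 * complex_of_real pi * \<i> * of_int m * complex_of_real ((w + e\<^sub>1) $ 1) =
      2 * complex_of_real pi * \<i> * of_int m * complex_of_real (w $ 1) + of_int (2 * m) * complex_of_real pi * \<i>"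
      by (simp add: algebra_simps)
    then show ?thesis by (simp only: exp_eq) (auto intro: exI[of _ m])
  qed
  moreover have "M ** scale_mat c N = scale_mat c (M ** N)" "scale_mat c M ** N = scale_mat c (M ** N)" for c M N
    by (simp_all add: scale_mat_def matrix_matrix_mult_def vec_eq_iff sum_2 algebra_simps)
  ultimately show ?thesis
    by (simp add: twisted_U2_def sewing_relation)
qed

text \<open>Let \<open>f\<close> be a lift on the unit square that jumps by the angles \<open>a y\<close> across the vertical edges and \<open>b x\<close>
across the horizontal ones. The sewing relation at the corner says that the increments of \<open>a\<close> and \<open>b\<close>
differ by a multiple of \<open>2 \<pi>\<close>, and this multiple is the charge. After a change of phase the lift matches on
opposite edges and is continued first in direction 1 and then in direction 2.\<close>

lemma unit_section_exists:
  obtains m e where "continuous_on UNIV e" "unit_section l e" "quasi_periodic U1 U2 m e"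
proof -
  define Q where "Q = cbox (0 :: real^2) 1"
  have Q: "w \<in> Q \<longleftrightarrow> 0 \<le> w $ 1 \<and> w $ 1 \<le> 1 \<and> 0 \<le> w $ 2 \<and> w $ 2 \<le> 1" for w
    by (auto simp: Q_def mem_box_cart forall_2)
  obtain e where e: "continuous_on Q e" "\<And>w. w \<in> Q \<Longrightarrow> norm (e w) = 1 \<and> e w \<in> l w"
  proof (rule unit_section_on_starlike_compact[OF l_continuous, of Q])
    show "compact Q" by (simp add: Q_def)
    show "t *\<^sub>R w \<in> Q" if "w \<in> Q" "0 \<le> t" "t \<le> 1" for w t
      using that by (auto simp: Q intro: mult_le_one)
  qed blast
  have pQ: "point x y \<in> Q \<longleftrightarrow> 0 \<le> x \<and> x \<le> 1 \<and> 0 \<le> y \<and> y \<le> 1" for x y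
    by (simp add: Q)
  have right: "U1 (point 0 y) *v e (point 0 y) \<in> l (point 1 y)" if "y \<in> {0..1}" for y
    using l_shift(1)[of "point 0 y"] e(2)[of "point 0 y"] that by (auto simp: point_add_axis pQ mat_line_mem)
  have top: "U2 (point x 0) *v e (point x 0) \<in> l (point x 1)" if "x \<in> {0..1}" for x
    using l_shift(2)[of "point x 0"] e(2)[of "point x 0"] that by (auto simp: point_add_axis pQ mat_line_mem)
  define c1 where "c1 y = herm (e (point 1 y)) (U1 (point 0 y) *v e (point 0 y))" for y
  define c2 where "c2 x = herm (e (point x 1)) (U2 (point x 0) *v e (point x 0))" for x
  have e1: "e (point 1 y) = c1 y *s (U1 (point 0 y) *v e (point 0 y))" if "y \<in> {0..1}" for y
    unfolding c1_def using right[OF that] e(2) that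
    by (intro CP1_unit_expansion[OF l_CP1]) (auto simp: norm_unitary unitary pQ)
  have e2: "e (point x 1) = c2 x *s (U2 (point x 0) *v e (point x 0))" if "x \<in> {0..1}" for x
    unfolding c2_def using top[OF that] e(2) that
    by (intro CP1_unit_expansion[OF l_CP1]) (auto simp: norm_unitary unitary pQ)
  have n1: "norm (c1 y) = 1" if "y \<in> {0..1}" for y
    using arg_cong[OF e1[OF that], of norm] e(2) that by (simp add: norm_smult norm_unitary unitary pQ)
  have n2: "norm (c2 x) = 1" if "x \<in> {0..1}" for x
    using arg_cong[OF e2[OF that], of norm] e(2) that by (simp add: norm_smult norm_unitary unitary pQ)
  have cc: "continuous_on {0..1} c1" "continuous_on {0..1} c2"
    unfolding c1_def[abs_def] c2_def[abs_def]
    by (intro continuous_intros continuous_on_compose2[OF e(1)] continuous_on_compose2[OF U_continuous(1)]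
        continuous_on_compose2[OF U_continuous(2)]; auto simp: pQ)+
  obtain a where a: "continuous_on {0..1} a" "\<And>y. y \<in> {0..1} \<Longrightarrow> exp (\<i> * complex_of_real (a y)) = c1 y"
    using unit_circle_continuous_log[OF cc(1) _ n1] by auto
  obtain b where b: "continuous_on {0..1} b" "\<And>x. x \<in> {0..1} \<Longrightarrow> exp (\<i> * complex_of_real (b x)) = c2 x"
    using unit_circle_continuous_log[OF cc(2) _ n2] by auto
  \<comment> \<open>The two ways around the square from its lower left to its upper right corner.\<close>
  have "c1 1 * c2 0 = c2 1 * c1 0"
  proof -
    let ?u = "U2 (point 1 0) *v (U1 (point 0 0) *v e (point 0 0))"
    have "U1 (point 0 1) *v (U2 (point 0 0) *v e (point 0 0)) = ?u"
      using sewing_relation[of "point 0 0"] by (simp add: point_add_axis matrix_vector_mul_assoc)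
    then have "e (point 1 1) = (c1 1 * c2 0) *s ?u"
      using e1[of 1] e2[of 0] by (simp add: vector_scalar_commute)
    moreover have "e (point 1 1) = (c2 1 * c1 0) *s ?u"
      using e2[of 1] e1[of 0] by (simp add: vector_scalar_commute)
    moreover have "norm ?u = 1"
      using e(2)[of "point 0 0"] by (simp add: norm_unitary unitary pQ)
    ultimately show ?thesis
      by (metis norm_zero vector_mul_rcancel zero_neq_one)
  qed
  then have "exp (\<i> * complex_of_real (a 1) + \<i> * complex_of_real (b 0)) =
      exp (\<i> * complex_of_real (b 1) + \<i> * complex_of_real (a 0))"
    using a(2)[of 0] a(2)[of 1] b(2)[of 0] b(2)[of 1] by (simp add: exp_add)
  then obtain n :: int where "\<i> * complex_of_real (a 1) + \<i> * complex_of_real (b 0) =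
      \<i> * complex_of_real (b 1) + \<i> * complex_of_real (a 0) + complex_of_real (real_of_int (2 * n) * pi) * \<i>"
    unfolding exp_eq by blast
  from arg_cong[OF this, of Im] have n: "a 1 + b 0 = b 1 + a 0 + 2 * pi * n" by simp
  define m where "m = - n"
  \<comment> \<open>The first two terms interpolate linearly between opposite edges; the bilinear term corrects both of them
      at once, which is possible because the two corner defects agree by the choice of \<open>m\<close>.\<close>
  define \<phi> where "\<phi> x y = - x * a y + y * (2 * pi * m * x - b x) - x * y * (a 0 - a 1)" for x y
  have \<phi>1: "\<phi> 1 y = \<phi> 0 y - a y" for y
    using n by (simp add: \<phi>_def m_def algebra_simps flip: distrib_left)
  have \<phi>2: "\<phi> x 1 = \<phi> x 0 + 2 * pi * m * x - b x" for x
    by (simp add: \<phi>_def algebra_simps)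
  define f where "f w = exp (\<i> * complex_of_real (\<phi> (w $ 1) (w $ 2))) *s e w" for w
  have f: "continuous_on Q f"
    unfolding f_def[abs_def] \<phi>_def
    by (intro continuous_intros e continuous_on_compose2[OF a(1)] continuous_on_compose2[OF b(1)]) (auto simp: Q)
  have fQ: "norm (f w) = 1 \<and> f w \<in> l w" if "w \<in> Q" for w
    using e(2)[OF that] by (simp add: f_def norm_smult smult_in_CP1 l_CP1)
  have f1: "f (point 1 y) = U1 (point 0 y) *v f (point 0 y)" if "y \<in> {0..1}" for y
    using e1[OF that] a(2)[OF that, symmetric]
    by (simp add: f_def \<phi>1 vector_scalar_commute right_diff_distrib flip: exp_add)
  have f2: "f (point x 1) = twisted_U2 m (point x 0) *v f (point x 0)" if "x \<in> {0..1}" for x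
  proof -
    have "exp (\<i> * complex_of_real (\<phi> x 1)) * c2 x =
        exp (2 * complex_of_real pi * \<i> * of_int m * complex_of_real x) * exp (\<i> * complex_of_real (\<phi> x 0))"
      unfolding b(2)[OF that, symmetric] exp_add[symmetric]
      by (rule arg_cong[of _ _ exp]) (simp add: \<phi>2 algebra_simps)
    then show ?thesis
      using e2[OF that] by (simp add: f_def vector_scalar_commute twisted_U2_def scale_mat_vec)
  qed
  define S where "S = {w :: real^2. 0 \<le> w $ 2 \<and> w $ 2 \<le> 1}"
  obtain g where g: "continuous_on S g" "\<And>w. g (w + e\<^sub>1) = U1 w *v g w"
    "\<And>w. w \<in> S \<Longrightarrow> 0 \<le> w $ 1 \<Longrightarrow> w $ 1 \<le> 1 \<Longrightarrow> g w = f w"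
  proof (rule equivariant_extension[of "\<lambda>w. adjoint_mat (U1 w)" U1 1 S f])
    show "w + axis 1 1 \<in> S \<longleftrightarrow> w \<in> S" for w by (simp add: S_def axis_def)
    have "{w \<in> S. 0 \<le> w $ 1 \<and> w $ 1 \<le> 1} = Q" by (auto simp: S_def Q)
    then show "continuous_on {w \<in> S. 0 \<le> w $ 1 \<and> w $ 1 \<le> 1} f" using f by simp
    fix w assume w: "w \<in> S" "w $ 1 = 0"
    then obtain y where y: "w = point 0 y" using point_eqI by blast
    then show "f (w + axis 1 1) = U1 w *v f w"
      using f1[of y] w by (simp add: S_def point_add_axis)
  next
    show "continuous_on UNIV (\<lambda>w. adjoint_mat (U1 w))"
      by (intro continuous_intros U_continuous)
    show "adjoint_mat (U1 w) ** U1 w = mat 1" "U1 w ** adjoint_mat (U1 w) = mat 1" for w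
      using unitary[of w] by (simp_all add: unitary_mat_iff)
  qed (use U_continuous in blast)+
  have gS: "norm (g w) = 1 \<and> g w \<in> l w" if "w \<in> S" for w
  proof (rule shift_induct[of "\<lambda>w. w $ 1" "e\<^sub>1" S "\<lambda>w. norm (g w) = 1 \<and> g w \<in> l w", OF _ _ _ _ that])
    fix w
    have "U1 w *v g w \<in> l (w + e\<^sub>1) \<longleftrightarrow> g w \<in> l w"
    proof
      assume "U1 w *v g w \<in> l (w + e\<^sub>1)"
      then obtain v where v: "v \<in> l w" "U1 w *v g w = U1 w *v v"
        unfolding l_shift mat_line_def by auto
      then have "adjoint_mat (U1 w) *v (U1 w *v g w) = adjoint_mat (U1 w) *v (U1 w *v v)" by simp
      then show "g w \<in> l w"
        using v(1) unitary(1)[of w] by (simp add: matrix_vector_mul_assoc unitary_mat_iff)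
    qed (simp add: l_shift mat_line_mem)
    then show "norm (g (w + e\<^sub>1)) = 1 \<and> g (w + e\<^sub>1) \<in> l (w + e\<^sub>1) \<longleftrightarrow> norm (g w) = 1 \<and> g w \<in> l w"
      by (simp add: g norm_unitary unitary)
  next
    fix w assume "w \<in> S" "0 \<le> w $ 1" "w $ 1 < 1"
    then show "norm (g w) = 1 \<and> g w \<in> l w"
      using g(3)[of w] fQ[of w] by (simp add: S_def Q)
  qed (auto simp: S_def axis_def)
  have g2: "g (w + e\<^sub>2) = twisted_U2 m w *v g w" if "w $ 2 = 0" for w
  proof (rule shift_induct[of "\<lambda>w. w $ 1" "e\<^sub>1" "{w. w $ 2 = 0}" "\<lambda>w. g (w + e\<^sub>2) = twisted_U2 m w *v g w"])
    fix w :: "real^2"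
    have "g (w + e\<^sub>1 + e\<^sub>2) = U1 (w + e\<^sub>2) *v g (w + e\<^sub>2)"
      using g(2)[of "w + e\<^sub>2"] by (simp add: ac_simps)
    moreover have "twisted_U2 m (w + e\<^sub>1) *v g (w + e\<^sub>1) = U1 (w + e\<^sub>2) *v (twisted_U2 m w *v g w)"
      by (simp add: g(2) matrix_vector_mul_assoc twisted_U2_relation)
    moreover have "U1 v *v x = U1 v *v y \<longleftrightarrow> x = y" for v x y
    proof
      assume "U1 v *v x = U1 v *v y"
      then have "adjoint_mat (U1 v) *v (U1 v *v x) = adjoint_mat (U1 v) *v (U1 v *v y)" by simp
      then show "x = y" using unitary(1)[of v] by (simp add: matrix_vector_mul_assoc unitary_mat_iff)
    qed simp
    ultimately show "g (w + e\<^sub>1 + e\<^sub>2) = twisted_U2 m (w + e\<^sub>1) *v g (w + e\<^sub>1) \<longleftrightarrow> g (w + e\<^sub>2) = twisted_U2 m w *v g w"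
      by simp
  next
    fix w :: "real^2" assume "w \<in> {w. w $ 2 = 0}" "0 \<le> w $ 1" "w $ 1 < 1"
    then obtain x where w: "w = point x 0" "x \<in> {0..1}"
      using point_eqI[of w "w $ 1" 0] by auto
    have "g (point x 0) = f (point x 0)" "g (point x 1) = f (point x 1)"
      using w by (auto intro!: g(3) simp: S_def)
    then show "g (w + e\<^sub>2) = twisted_U2 m w *v g w"
      using f2[OF w(2)] by (simp add: w(1) point_add_axis)
  qed (use that in \<open>auto simp: axis_def\<close>)
  obtain h where h: "continuous_on UNIV h" "\<And>w. h (w + e\<^sub>2) = twisted_U2 m w *v h w"
    "\<And>w. w \<in> UNIV \<Longrightarrow> 0 \<le> w $ 2 \<Longrightarrow> w $ 2 \<le> 1 \<Longrightarrow> h w = g w"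
  proof (rule equivariant_extension[of "\<lambda>w. adjoint_mat (twisted_U2 m w)" "twisted_U2 m" 2 UNIV g])
    show "continuous_on {w \<in> UNIV. 0 \<le> w $ 2 \<and> w $ 2 \<le> 1} g" using g by (simp add: S_def)
    show "continuous_on UNIV (\<lambda>w. adjoint_mat (twisted_U2 m w))"
      by (intro continuous_intros twisted_U2_continuous)
    show "adjoint_mat (twisted_U2 m w) ** twisted_U2 m w = mat 1" "twisted_U2 m w ** adjoint_mat (twisted_U2 m w) = mat 1" for w
      using unitary_twisted_U2[of m w] by (simp_all add: unitary_mat_iff)
    show "g (w + e\<^sub>2) = twisted_U2 m w *v g w" if "w $ 2 = 0" for w
      by (rule g2[OF that])
  qed (use twisted_U2_continuous in \<open>blast | simp\<close>)+
  have h1: "h (w + e\<^sub>1) = U1 w *v h w" for w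
  proof (rule shift_induct[of "\<lambda>w. w $ 2" "e\<^sub>2" UNIV "\<lambda>w. h (w + e\<^sub>1) = U1 w *v h w"])
    fix w :: "real^2"
    have "h (w + e\<^sub>2 + e\<^sub>1) = twisted_U2 m (w + e\<^sub>1) *v h (w + e\<^sub>1)"
      using h(2)[of "w + e\<^sub>1"] by (simp add: ac_simps)
    moreover have "U1 (w + e\<^sub>2) *v h (w + e\<^sub>2) = twisted_U2 m (w + e\<^sub>1) *v (U1 w *v h w)"
      by (simp add: h(2) matrix_vector_mul_assoc twisted_U2_relation)
    moreover have "twisted_U2 m v *v x = twisted_U2 m v *v y \<longleftrightarrow> x = y" for v x y
    proof
      assume "twisted_U2 m v *v x = twisted_U2 m v *v y"
      then have "adjoint_mat (twisted_U2 m v) *v (twisted_U2 m v *v x) = adjoint_mat (twisted_U2 m v) *v (twisted_U2 m v *v y)" by simp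
      then show "x = y" using unitary_twisted_U2[of m v] by (simp add: matrix_vector_mul_assoc unitary_mat_iff)
    qed simp
    ultimately show "h (w + e\<^sub>2 + e\<^sub>1) = U1 (w + e\<^sub>2) *v h (w + e\<^sub>2) \<longleftrightarrow> h (w + e\<^sub>1) = U1 w *v h w"
      by simp
  next
    fix w :: "real^2" assume "0 \<le> w $ 2" "w $ 2 < 1"
    moreover have "(w + e\<^sub>1) $ 2 = w $ 2" by (simp add: axis_def)
    ultimately show "h (w + e\<^sub>1) = U1 w *v h w"
      using h(3)[of w] h(3)[of "w + e\<^sub>1"] g(2)[of w] by simp
  qed (auto simp: axis_def)
  have "norm (h w) = 1 \<and> h w \<in> l w" for w
  proof (rule shift_induct[of "\<lambda>w. w $ 2" "e\<^sub>2" UNIV "\<lambda>w. norm (h w) = 1 \<and> h w \<in> l w"])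
    fix w
    have "twisted_U2 m w *v h w \<in> l (w + e\<^sub>2) \<longleftrightarrow> h w \<in> l w"
    proof
      assume "twisted_U2 m w *v h w \<in> l (w + e\<^sub>2)"
      then have "exp (- (2 * complex_of_real pi * \<i> * of_int m * complex_of_real (w $ 1))) *s (twisted_U2 m w *v h w) \<in> l (w + e\<^sub>2)"
        by (intro smult_in_CP1 l_CP1)
      then have "U2 w *v h w \<in> l (w + e\<^sub>2)"
        unfolding twisted_U2_def scale_mat_vec vector_smult_assoc by (simp flip: exp_add)
      then obtain v where v: "v \<in> l w" "U2 w *v h w = U2 w *v v"
        unfolding l_shift mat_line_def by auto
      then have "adjoint_mat (U2 w) *v (U2 w *v h w) = adjoint_mat (U2 w) *v (U2 w *v v)" by simp
      then show "h w \<in> l w"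
        using v(1) unitary(2)[of w] by (simp add: matrix_vector_mul_assoc unitary_mat_iff)
    next
      assume "h w \<in> l w"
      then show "twisted_U2 m w *v h w \<in> l (w + e\<^sub>2)"
        unfolding twisted_U2_def scale_mat_vec by (intro smult_in_CP1 l_CP1) (simp add: l_shift mat_line_mem)
    qed
    then show "norm (h (w + e\<^sub>2)) = 1 \<and> h (w + e\<^sub>2) \<in> l (w + e\<^sub>2) \<longleftrightarrow> norm (h w) = 1 \<and> h w \<in> l w"
      by (simp add: h norm_unitary unitary_twisted_U2)
  next
    fix w :: "real^2" assume "0 \<le> w $ 2" "w $ 2 < 1"
    then show "norm (h w) = 1 \<and> h w \<in> l w"
      using h(3)[of w] gS[of w] by (simp add: S_def)
  qed (auto simp: axis_def)
  then show ?thesis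
    using that[of h m] h h1 by (simp add: unit_section_def quasi_periodic_iff)
qed

text \<open>The quotient \<open>c\<close> of two sections is a map to the unit circle with a continuous argument \<open>a\<close> on the plane.
Going from \<open>0\<close> to \<open>e\<^sub>1 + e\<^sub>2\<close> along the two edge paths of the unit square changes \<open>a\<close> by amounts that differ by
\<open>2 \<pi> (m - m')\<close>.\<close>

lemma charge_unique:
  assumes e: "continuous_on UNIV e" "unit_section l e" "quasi_periodic U1 U2 m e"
    and e': "continuous_on UNIV e'" "unit_section l e'" "quasi_periodic U1 U2 m' e'"
  shows "m = m'"
proof -
  define c where "c w = herm (e w) (e' w)" for w
  have ec: "e w = c w *s e' w" for w
    unfolding c_def using e(2) e'(2) by (intro CP1_unit_expansion[OF l_CP1]) (auto simp: unit_section_def)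
  have "norm (c w) = 1" for w
    using arg_cong[OF ec[of w], of norm] e(2) e'(2) by (simp add: norm_smult unit_section_def)
  moreover have "continuous_on UNIV c"
    unfolding c_def[abs_def] by (intro continuous_intros e e')
  ultimately obtain a where a: "continuous_on UNIV a" "\<And>w. exp (\<i> * complex_of_real (a w)) = c w"
    using unit_circle_continuous_log[of UNIV c] by auto
  have c1: "c (w + e\<^sub>1) = c w" for w
    using e(3) e'(3) by (simp add: c_def quasi_periodic_iff herm_unitary unitary)
  have c2: "c (w + e\<^sub>2) = exp (\<i> * complex_of_real (2 * pi * (m - m') * (w $ 1))) * c w" for w
  proof -
    have "c (w + e\<^sub>2) = herm (twisted_U2 m w *v e w) (twisted_U2 m' w *v e' w)"
      using e(3) e'(3) by (simp add: c_def quasi_periodic_iff)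
    also have "\<dots> = exp (2 * complex_of_real pi * \<i> * of_int m * complex_of_real (w $ 1)) *
        cnj (exp (2 * complex_of_real pi * \<i> * of_int m' * complex_of_real (w $ 1))) * c w"
      by (simp add: twisted_U2_def scale_mat_vec herm_scale_left herm_scale_right herm_unitary unitary c_def)
    finally show ?thesis
      by (simp add: exp_cnj algebra_simps flip: exp_add)
  qed
  have const: "f constant_on UNIV" if fc: "continuous_on UNIV f" and fZ: "\<And>w. f w / (2 * pi) \<in> \<int>" for f :: "real^2 \<Rightarrow> real"
  proof -
    have "(\<lambda>w. f w / (2 * pi)) constant_on UNIV"
    proof (rule continuous_discrete_range_constant)
      show "continuous_on UNIV (\<lambda>w. f w / (2 * pi))"
        by (intro continuous_intros fc) auto
      show "\<exists>e>0. \<forall>y. y \<in> UNIV \<and> f y / (2 * pi) \<noteq> f x / (2 * pi) \<longrightarrow> e \<le> norm (f y / (2 * pi) - f x / (2 * pi))" for x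
      proof (intro exI[of _ 1] conjI allI impI)
        fix y assume ne: "y \<in> UNIV \<and> f y / (2 * pi) \<noteq> f x / (2 * pi)"
        obtain i j :: int where ij: "f x / (2 * pi) = of_int i" "f y / (2 * pi) = of_int j"
          using fZ[of x] fZ[of y] unfolding Ints_def by blast
        then have "1 \<le> \<bar>j - i\<bar>" using ne by auto
        then show "1 \<le> norm (f y / (2 * pi) - f x / (2 * pi))"
          unfolding ij real_norm_def by linarith
      qed simp
    qed auto
    then obtain k where k: "\<And>w. f w / (2 * pi) = k" by (auto simp: constant_on_def)
    show ?thesis unfolding constant_on_def
      using k by (intro exI[of _ "k * (2 * pi)"]) (simp add: field_simps)
  qed
  have diff: "(s - t) / (2 * pi) \<in> \<int>"
    if "exp (\<i> * complex_of_real s) = exp (\<i> * complex_of_real t)" for s t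
  proof -
    obtain n :: int where "\<i> * complex_of_real s = \<i> * complex_of_real t + complex_of_real (real_of_int (2 * n) * pi) * \<i>"
      using \<open>exp _ = exp _\<close> unfolding exp_eq by blast
    from arg_cong[OF this, of Im] have "(s - t) / (2 * pi) = of_int n" by simp
    then show ?thesis by simp
  qed
  have sc: "continuous_on UNIV (\<lambda>w. a (w + v))" for v
    by (intro continuous_on_compose2[OF a(1)] continuous_intros) auto
  have "(\<lambda>w. a (w + e\<^sub>1) - a w) constant_on UNIV"
    by (intro const continuous_intros sc a diff) (simp add: a c1)
  then obtain k1 where k1: "\<And>w. a (w + e\<^sub>1) - a w = k1" by (auto simp: constant_on_def)
  have "(\<lambda>w. a (w + e\<^sub>2) - (2 * pi * (m - m') * (w $ 1) + a w)) constant_on UNIV"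
    by (intro const continuous_intros sc a diff) (simp add: a c2 distrib_left exp_add)
  then obtain k2 where k2: "\<And>w. a (w + e\<^sub>2) - (2 * pi * (m - m') * (w $ 1) + a w) = k2"
    by (auto simp: constant_on_def)
  have "a (0 + e\<^sub>2 + e\<^sub>1) = a (0 + e\<^sub>1 + e\<^sub>2)" by (simp add: add.commute)
  then have "a (e\<^sub>1 + e\<^sub>2) - a e\<^sub>2 = k1"
    using k1[of "e\<^sub>2"] by (simp add: add.commute)
  moreover have "a e\<^sub>1 - a 0 = k1" "a e\<^sub>2 - a 0 = k2"
    using k1[of 0] k2[of 0] by simp_all
  moreover have "a (e\<^sub>1 + e\<^sub>2) - (2 * pi * (m - m') + a e\<^sub>1) = k2"
    using k2[of "e\<^sub>1"] by simp
  ultimately have "2 * pi * (m - m') = 0"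
    by linarith
  then show ?thesis by simp
qed

lemma charge_section:
  obtains e where "continuous_on UNIV e" "unit_section l e" "quasi_periodic U1 U2 (charge U1 U2 l) e"
proof -
  obtain m e where "continuous_on UNIV e" "unit_section l e" "quasi_periodic U1 U2 m e"
    by (rule unit_section_exists)
  then have "\<exists>!m. \<exists>e. continuous_on UNIV e \<and> unit_section l e \<and> quasi_periodic U1 U2 m e"
    using charge_unique by blast
  from theI'[OF this] show ?thesis
    using that unfolding charge_def by blast
qed

end

section \<open>Powers of the twisted shift\<close>

lemma twisted_shift_funpow_smult:
  "(twisted_shift X d ^^ m) (\<lambda>w. \<gamma> w *s h w) w = \<gamma> (w + real m *\<^sub>R d) *s (twisted_shift X d ^^ m) h w"
  by (induction m arbitrary: w) (simp_all add: twisted_shift_def vector_scalar_commute algebra_simps)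

lemma twisted_shift_funpow_diff:
  "(twisted_shift X d ^^ m) (\<lambda>w. f w - g w) w = (twisted_shift X d ^^ m) f w - (twisted_shift X d ^^ m) g w"
  by (induction m arbitrary: w) (simp_all add: twisted_shift_def matrix_vector_mult_diff_distrib)

lemma twisted_shift_funpow_norm:
  assumes "\<And>w v. norm (X w *v v) = norm v"
  shows "norm ((twisted_shift X d ^^ m) h w) = norm (h (w + real m *\<^sub>R d))"
  by (induction m arbitrary: w) (simp_all add: twisted_shift_def assms algebra_simps)

lemma twisted_shift_funpow_norm_le:
  assumes "\<And>w v. w \<in> S \<Longrightarrow> norm (X w *v v) \<le> D * norm v" "\<And>w. w \<in> S \<Longrightarrow> w + d \<in> S" "w \<in> S" "D \<ge> 0"
  shows "norm ((twisted_shift X d ^^ m) h w) \<le> D ^ m * norm (h (w + real m *\<^sub>R d))"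
  using assms(3)
proof (induction m arbitrary: w)
  case (Suc m)
  have "norm ((twisted_shift X d ^^ Suc m) h w) \<le> D * norm ((twisted_shift X d ^^ m) h (w + d))"
    using assms(1)[OF Suc.prems] by (simp add: twisted_shift_def)
  also have "\<dots> \<le> D * (D ^ m * norm (h (w + d + real m *\<^sub>R d)))"
    by (intro mult_left_mono Suc assms)
  finally show ?case by (simp add: algebra_simps)
qed simp

lemma twisted_shift_pow_smult:
  "twisted_shift_pow X Y d n (\<lambda>w. \<gamma> w *s h w) w = \<gamma> (w + of_int n *\<^sub>R d) *s twisted_shift_pow X Y d n h w"
  by (simp add: twisted_shift_pow_def twisted_shift_funpow_smult)

lemma twisted_shift_pow_diff:
  "twisted_shift_pow X Y d n (\<lambda>w. f w - g w) w = twisted_shift_pow X Y d n f w - twisted_shift_pow X Y d n g w"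
  by (simp add: twisted_shift_pow_def twisted_shift_funpow_diff)

lemma twisted_shift_pow_norm:
  assumes "\<And>w v. norm (X w *v v) = norm v" "\<And>w v. norm (Y w *v v) = norm v"
  shows "norm (twisted_shift_pow X Y d n h w) = norm (h (w + of_int n *\<^sub>R d))"
  by (simp add: twisted_shift_pow_def twisted_shift_funpow_norm assms)

lemma twisted_shift_pow_norm_le:
  assumes "\<And>w v. w \<in> S \<Longrightarrow> norm (X w *v v) \<le> D * norm v" "\<And>w v. w \<in> S \<Longrightarrow> norm (Y w *v v) \<le> D * norm v"
    and S: "\<And>w. w + d \<in> S \<longleftrightarrow> w \<in> S" and w: "w \<in> S" and D: "D \<ge> 0"
  shows "norm (twisted_shift_pow X Y d n h w) \<le> D ^ nat \<bar>n\<bar> * norm (h (w + of_int n *\<^sub>R d))"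
proof (cases "n \<ge> 0")
  case True
  then show ?thesis
    using twisted_shift_funpow_norm_le[of S X D d w "nat n" h] assms by (simp add: twisted_shift_pow_def)
next
  case False
  have S': "w - d \<in> S \<longleftrightarrow> w \<in> S" for w using S[of "w - d"] by simp
  show ?thesis
    using twisted_shift_funpow_norm_le[of S "\<lambda>w. Y (w - d)" D "- d" w "nat (- n)" h] assms False
    by (simp add: twisted_shift_pow_def S')
qed

lemma twisted_shift_funpow_fixed:
  assumes "\<And>w. X w *v e (w + d) = e w"
  shows "(twisted_shift X d ^^ m) e = e"
  by (induction m) (auto simp: twisted_shift_def assms fun_eq_iff)

text \<open>With \<open>twisted_shift_pow_smult\<close> this computes the operator on scalar multiples of an equivariant map: the
scalar is translated and the map stays.\<close>

lemma twisted_shift_pow_fixed: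
  assumes "\<And>w. X w ** Y w = mat 1" "\<And>w. Y w ** X w = mat 1" "\<And>w. e (w + d) = Y w *v e w"
  shows "twisted_shift_pow X Y d n e = e"
proof -
  have "Y (w - d) *v e (w + - d) = e w" for w
    using assms(3)[of "w - d"] by simp
  then show ?thesis
    using assms by (simp add: twisted_shift_pow_def twisted_shift_funpow_fixed matrix_vector_mul_assoc)
qed

lemma twisted_shift_pow_commute:
  assumes "\<And>h. f (twisted_shift X d h) = twisted_shift X d (f h)"
    and "\<And>h. f (twisted_shift (\<lambda>w. Y (w - d)) (- d) h) = twisted_shift (\<lambda>w. Y (w - d)) (- d) (f h)"
  shows "f (twisted_shift_pow X Y d n h) = twisted_shift_pow X Y d n (f h)"
proof -
  have "f ((\<phi> ^^ m) h) = (\<phi> ^^ m) (f h)" if "\<And>h. f (\<phi> h) = \<phi> (f h)" for \<phi> m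
    by (induction m) (simp_all add: that)
  then show ?thesis using assms by (simp add: twisted_shift_pow_def)
qed

text \<open>The complex operators extend the real ones, so every identity that needs invertibility is proved on the
real plane, and only bounds and holomorphy are proved on the strip.\<close>

lemma twisted_shift_pow_cvec:
  assumes "\<And>w. X' (cvec w) = X w" "\<And>w. Y' (cvec w) = Y w" "\<And>w. h' (cvec w) = h w" "cvec d = d'"
  shows "twisted_shift_pow X' Y' d' n h' (cvec w) = twisted_shift_pow X Y d n h w"
proof -
  have gen: "(twisted_shift X' d' ^^ m) h' (cvec w) = (twisted_shift X d ^^ m) h w"
    if "\<And>w. X' (cvec w) = X w" "cvec d = d'" for X' d' X d m w
    by (induction m arbitrary: w) (simp_all add: twisted_shift_def that assms(3) flip: that(2) cvec_add)
  have m: "cvec (w - d) = cvec w - d'" for w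
    by (simp add: cvec_def vec_eq_iff flip: assms(4))
  have Yc: "Y' (cvec w - d') = Y (w - d)" for w
    using assms(2)[of "w - d"] m by simp
  have md: "cvec (- d) = - d'"
    by (simp add: cvec_def vec_eq_iff flip: assms(4))
  show ?thesis
  proof (cases "n \<ge> 0")
    case True
    then show ?thesis
      using gen[of X' X d d' "nat n" w] assms by (simp add: twisted_shift_pow_def)
  next
    case False
    then show ?thesis
      using gen[of "\<lambda>w. Y' (w - d')" "\<lambda>w. Y (w - d)" "- d" "- d'" "nat (- n)" w, OF Yc md]
      by (simp add: twisted_shift_pow_def)
  qed
qed

section \<open>Bounded holomorphic matrices on the strip\<close>

definition open_strip :: "real \<Rightarrow> (complex^2) set" where
  "open_strip \<delta> = {w. \<bar>Im (w $ 1)\<bar> < \<delta> \<and> \<bar>Im (w $ 2)\<bar> < \<delta>}"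

lemma open_open_strip: "open (open_strip \<delta>)"
  unfolding open_strip_def by (intro open_Collect_conj open_Collect_less continuous_intros)

lemma cvec_in_open_strip: "\<delta> > 0 \<Longrightarrow> cvec w \<in> open_strip \<delta>"
  by (simp add: open_strip_def cvec_def)

lemma open_strip_shift: "w + axis i 1 \<in> open_strip \<delta> \<longleftrightarrow> w \<in> open_strip \<delta>"
  by (simp add: open_strip_def axis_def)

lemma vcnj_open_strip: "vcnj w \<in> open_strip \<delta> \<longleftrightarrow> w \<in> open_strip \<delta>"
  by (simp add: open_strip_def vcnj_def)

definition bounded_holomorphic :: "real \<Rightarrow> real \<Rightarrow> (complex^2 \<Rightarrow> complex^2^2) \<Rightarrow> bool" where
  "bounded_holomorphic \<delta> C X \<longleftrightarrow> (\<forall>i j. line_holomorphic (\<lambda>w. X w $ i $ j) (open_strip \<delta>)) \<and>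
     (\<forall>w\<in>open_strip \<delta>. \<forall>i j. norm (X w $ i $ j) \<le> C)"

lemma bounded_holomorphic_adjoint:
  assumes "bounded_holomorphic \<delta> C X" shows "bounded_holomorphic \<delta> C (\<lambda>w. adjoint_mat (X (vcnj w)))"
  unfolding bounded_holomorphic_def
proof (intro conjI allI ballI)
  fix i j
  have "line_holomorphic (\<lambda>w. cnj (X (vcnj w) $ j $ i)) {w. vcnj w \<in> open_strip \<delta>}"
    using assms by (intro line_holomorphic_reflect open_open_strip) (auto simp: bounded_holomorphic_def)
  then show "line_holomorphic (\<lambda>w. adjoint_mat (X (vcnj w)) $ i $ j) (open_strip \<delta>)"
    by (simp add: adjoint_mat_def vcnj_open_strip)
next
  fix w i j assume "w \<in> open_strip \<delta>"
  then show "norm (adjoint_mat (X (vcnj w)) $ i $ j) \<le> C"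
    using assms vcnj_open_strip[of w] by (simp add: bounded_holomorphic_def adjoint_mat_def)
qed

lemma bounded_holomorphic_shift:
  assumes "bounded_holomorphic \<delta> C X" shows "bounded_holomorphic \<delta> C (\<lambda>w. X (w - axis i 1))"
  unfolding bounded_holomorphic_def
proof (intro conjI allI ballI)
  have s: "w - axis i 1 \<in> open_strip \<delta> \<longleftrightarrow> w \<in> open_strip \<delta>" for w
    using open_strip_shift[of "w - axis i 1" i] by simp
  fix k j
  have "line_holomorphic (\<lambda>w. X (w + - axis i 1) $ k $ j) {w. w + - axis i 1 \<in> open_strip \<delta>}"
    using assms by (intro line_holomorphic_shift[where f = "\<lambda>w. X w $ k $ j"]) (auto simp: bounded_holomorphic_def)
  then show "line_holomorphic (\<lambda>w. X (w - axis i 1) $ k $ j) (open_strip \<delta>)"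
    by (simp add: s)
  fix w assume "w \<in> open_strip \<delta>"
  then show "norm (X (w - axis i 1) $ k $ j) \<le> C"
    using assms s by (simp add: bounded_holomorphic_def)
qed

lemma bounded_holomorphic_norm_le:
  assumes "bounded_holomorphic \<delta> C X" "w \<in> open_strip \<delta>"
  shows "norm (X w *v v) \<le> 4 * C * norm v"
proof -
  have "norm ((X w *v v) $ i) \<le> 2 * C * norm v" for i
  proof -
    have "norm ((X w *v v) $ i) \<le> norm (X w $ i $ 1) * norm (v $ 1) + norm (X w $ i $ 2) * norm (v $ 2)"
      by (simp add: matrix_vector_mult_def sum_2 norm_triangle_le norm_mult)
    also have "\<dots> \<le> C * norm v + C * norm v"
    proof -
      have c: "norm (X w $ i $ j) \<le> C" for j using assms by (auto simp: bounded_holomorphic_def)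
      have "0 \<le> C" using c[of 1] norm_ge_zero order_trans by blast
      then show ?thesis by (intro add_mono mult_mono c Finite_Cartesian_Product.norm_nth_le) auto
    qed
    finally show ?thesis by simp
  qed
  from this[of 1] this[of 2] show ?thesis
    using norm_vec2_le[of "X w *v v"] by simp
qed

lemma line_holomorphic_twisted_shift:
  assumes X: "\<And>i j. line_holomorphic (\<lambda>w. X w $ i $ j) S" and S: "\<And>w. w \<in> S \<Longrightarrow> w + d \<in> S"
    and h: "\<And>i. line_holomorphic (\<lambda>w. h w $ i) S"
  shows "line_holomorphic (\<lambda>w. twisted_shift X d h w $ i) S"
proof -
  have hs: "line_holomorphic (\<lambda>w. h (w + d) $ i) S" for i
    by (rule line_holomorphic_subset[OF line_holomorphic_shift[OF h]]) (use S in auto)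
  show ?thesis
    unfolding twisted_shift_def matrix_vector_mult_def
    by (simp add: sum_2) (intro line_holomorphic_add line_holomorphic_mult X hs)
qed

lemma line_holomorphic_twisted_shift_pow:
  assumes X: "bounded_holomorphic \<delta> C X" and Y: "bounded_holomorphic \<delta> C Y" and h: "\<And>i. line_holomorphic (\<lambda>w. h w $ i) (open_strip \<delta>)"
  shows "line_holomorphic (\<lambda>w. twisted_shift_pow X Y (axis k 1) n h w $ i) (open_strip \<delta>)"
proof -
  have gen: "line_holomorphic (\<lambda>w. (twisted_shift X d ^^ m) h w $ i) (open_strip \<delta>)"
    if "bounded_holomorphic \<delta> C X" "\<And>w. w \<in> open_strip \<delta> \<Longrightarrow> w + d \<in> open_strip \<delta>" for X d m i
    using that h by (induction m arbitrary: i) (auto intro!: line_holomorphic_twisted_shift simp: bounded_holomorphic_def)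
  have "w - axis k 1 \<in> open_strip \<delta> \<longleftrightarrow> w \<in> open_strip \<delta>" for w
    using open_strip_shift[of "w - axis k 1" k] by simp
  then show ?thesis
    using gen[OF X, of "axis k 1"] gen[OF bounded_holomorphic_shift[OF Y, of k], of "- axis k 1"] open_strip_shift
    by (simp add: twisted_shift_pow_def)
qed

section \<open>Gaussian estimates\<close>

lemma summable_exp_abs_int: "(\<lambda>k::int. exp (- \<bar>real_of_int k\<bar>)) summable_on UNIV"
proof -
  have s: "(\<lambda>n::nat. exp (- real n)) summable_on UNIV"
  proof (rule norm_summable_imp_summable_on)
    have "summable (\<lambda>n. exp (- 1 :: real) ^ n)"
      by (rule summable_geometric) simp
    then show "summable (\<lambda>n::nat. norm (exp (- real n)))"
      by (simp flip: exp_of_nat_mult)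
  qed
  have "(\<lambda>k::int. exp (- \<bar>real_of_int k\<bar>)) summable_on range int"
    by (subst summable_on_reindex) (auto simp: o_def s)
  moreover have "(\<lambda>k::int. exp (- \<bar>real_of_int k\<bar>)) summable_on range (\<lambda>n. - int n)"
    by (subst summable_on_reindex) (auto simp: o_def s inj_on_def)
  ultimately have "(\<lambda>k::int. exp (- \<bar>real_of_int k\<bar>)) summable_on (range int \<union> range (\<lambda>n. - int n))"
    by (rule summable_on_union)
  moreover have "range int \<union> range (\<lambda>n. - int n) = UNIV"
    by (auto simp: image_iff) (metis int_cases2)
  ultimately show ?thesis by simp
qed

definition exp_abs_sum :: real where "exp_abs_sum = (\<Sum>\<^sub>\<infinity>k::int. exp (- \<bar>real_of_int k\<bar>))"

lemma shifted_exp_sum: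
  fixes u :: real
  shows "(\<lambda>k::int. exp (- \<bar>u - of_int k\<bar>)) summable_on UNIV"
    and "(\<Sum>\<^sub>\<infinity>k::int. exp (- \<bar>u - of_int k\<bar>)) \<le> exp 1 * exp_abs_sum"
proof -
  have bij: "bij_betw (\<lambda>k::int. k - \<lfloor>u\<rfloor>) UNIV UNIV"
    by (rule bij_betw_byWitness[where f' = "\<lambda>k. k + \<lfloor>u\<rfloor>"]) auto
  have le: "exp (- \<bar>u - of_int k\<bar>) \<le> exp 1 * exp (- \<bar>real_of_int (k - \<lfloor>u\<rfloor>)\<bar>)" for k
    unfolding exp_add[symmetric] by (simp add: abs_if) linarith
  have s: "(\<lambda>k. exp 1 * exp (- \<bar>real_of_int (k - \<lfloor>u\<rfloor>)\<bar>)) summable_on UNIV"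
    using summable_on_reindex_bij_betw[OF bij, of "\<lambda>k. exp (- \<bar>real_of_int k\<bar>)"] summable_exp_abs_int
    by (intro summable_on_cmult_right) simp
  show 1: "(\<lambda>k::int. exp (- \<bar>u - of_int k\<bar>)) summable_on UNIV"
    by (rule summable_on_comparison_test[OF s]) (use le in auto)
  have "(\<Sum>\<^sub>\<infinity>k::int. exp (- \<bar>u - of_int k\<bar>)) \<le> (\<Sum>\<^sub>\<infinity>k. exp 1 * exp (- \<bar>real_of_int (k - \<lfloor>u\<rfloor>)\<bar>))"
    by (rule infsum_mono[OF 1 s le])
  also have "\<dots> = exp 1 * exp_abs_sum"
    using infsum_reindex_bij_betw[OF bij, of "\<lambda>k. exp (- \<bar>real_of_int k\<bar>)"]
    by (simp add: infsum_cmult_right' exp_abs_sum_def)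
  finally show "(\<Sum>\<^sub>\<infinity>k::int. exp (- \<bar>u - of_int k\<bar>)) \<le> exp 1 * exp_abs_sum" .
qed

text \<open>All Gaussian sums are compared with sums of \<open>exp (- |u - k|)\<close>, which are bounded uniformly in \<open>u\<close>.\<close>

lemma gaussian_moment_le:
  fixes x y :: real
  shows "exp (- x\<^sup>2) * exp (- y\<^sup>2) * (x\<^sup>2 + y\<^sup>2) \<le> 2 * exp 1 * (exp (- \<bar>x\<bar>) * exp (- \<bar>y\<bar>))"
    and "exp (- x\<^sup>2) * exp (- y\<^sup>2) \<le> exp 1 * exp 1 * (exp (- \<bar>x\<bar>) * exp (- \<bar>y\<bar>))"
proof -
  define q where "q = x\<^sup>2 + y\<^sup>2"
  have a: "\<bar>t\<bar> \<le> t\<^sup>2 / 2 + 1 / 2" for t :: real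
    using zero_le_power2[of "\<bar>t\<bar> - 1"] by (simp add: power2_diff)
  have "q / 2 \<le> exp (q / 2)"
    using exp_ge_add_one_self[of "q / 2"] by linarith
  then have "exp (- q) * q \<le> exp (- q) * (2 * exp (q / 2))"
    by (intro mult_left_mono) auto
  also have "\<dots> = 2 * exp (- q / 2)"
    by (simp flip: exp_add)
  also have "exp (- q / 2) \<le> exp (1 - \<bar>x\<bar> - \<bar>y\<bar>)"
    using a[of x] a[of y] by (simp add: q_def)
  also have "exp (1 - \<bar>x\<bar> - \<bar>y\<bar>) = exp 1 * (exp (- \<bar>x\<bar>) * exp (- \<bar>y\<bar>))"
    by (simp flip: exp_add)
  finally show "exp (- x\<^sup>2) * exp (- y\<^sup>2) * (x\<^sup>2 + y\<^sup>2) \<le> 2 * exp 1 * (exp (- \<bar>x\<bar>) * exp (- \<bar>y\<bar>))"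
    unfolding q_def minus_add_distrib exp_add by (simp add: mult_ac)
  have "- x\<^sup>2 - y\<^sup>2 \<le> 1 + 1 - \<bar>x\<bar> - \<bar>y\<bar>"
    using a[of x] a[of y] zero_le_power2[of x] zero_le_power2[of y] by linarith
  then have "exp (- x\<^sup>2 - y\<^sup>2) \<le> exp (1 + 1 - \<bar>x\<bar> - \<bar>y\<bar>)" by simp
  also have "exp (- x\<^sup>2 - y\<^sup>2) = exp (- x\<^sup>2) * exp (- y\<^sup>2)" by (simp flip: exp_add)
  also have "exp (1 + 1 - \<bar>x\<bar> - \<bar>y\<bar>) = exp 1 * exp 1 * (exp (- \<bar>x\<bar>) * exp (- \<bar>y\<bar>))"
    by (simp flip: exp_add)
  finally show "exp (- x\<^sup>2) * exp (- y\<^sup>2) \<le> exp 1 * exp 1 * (exp (- \<bar>x\<bar>) * exp (- \<bar>y\<bar>))" .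
qed

text \<open>At a complex point the Gaussian loses at most the factor \<open>exp ((M \<delta>)\<^sup>2)\<close>, and a quadratic exponent absorbs
the growth \<open>D\<^sup>n\<close> of a product of \<open>n\<close> matrices of norm at most \<open>D\<close>, with room for a summable bound.\<close>

lemma gaussian_beats_power:
  fixes D R \<delta> :: real and M :: int
  assumes D: "D \<ge> 1" and M: "M > 0"
  obtains K where "\<And>(k::int) z. \<bar>Re z\<bar> \<le> R \<Longrightarrow> \<bar>Im z\<bar> \<le> \<delta> \<Longrightarrow>
    D ^ nat \<bar>- (k div M)\<bar> * norm (exp (- (of_int M * z - of_int k)\<^sup>2)) \<le> K * exp (- \<bar>real_of_int k\<bar>)"
proof
  define L where "L = ln D"
  have L: "L \<ge> 0" using D by (simp add: L_def)
  \<comment> \<open>From \<open>(k - a)\<^sup>2 \<ge> k\<^sup>2/2 - a\<^sup>2\<close>, and \<open>(L + 1) |k| \<le> (L + 1)\<^sup>2/2 + k\<^sup>2/2\<close> with \<open>D = exp L\<close>.\<close>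
  define E where "E = (M * \<delta>)\<^sup>2 + L + (M * R)\<^sup>2 + (L + 1)\<^sup>2 / 2"
  fix k :: int and z assume z: "\<bar>Re z\<bar> \<le> R" "\<bar>Im z\<bar> \<le> \<delta>"
  have "\<bar>k div M\<bar> \<le> \<bar>k\<bar> + 1"
  proof (cases "k div M \<ge> 0")
    case True
    then have "1 * (k div M) \<le> M * (k div M)"
      using M by (intro mult_right_mono) auto
    also have "\<dots> \<le> k"
      using M pos_mod_sign[OF M, of k] mult_div_mod_eq[of M k] by linarith
    finally show ?thesis using True by linarith
  next
    case False
    have "k < M * (k div M) + M"
      using M pos_mod_bound[OF M, of k] mult_div_mod_eq[of M k] by linarith
    also have "\<dots> = M * (k div M + 1)" by (simp add: algebra_simps)
    also have "\<dots> \<le> 1 * (k div M + 1)"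
      using False M by (intro mult_right_mono_neg) auto
    finally have "k \<le> k div M" by simp
    moreover have "\<bar>k div M\<bar> = - (k div M)" using False by simp
    ultimately show ?thesis by linarith
  qed
  then have n: "real (nat \<bar>- (k div M)\<bar>) \<le> \<bar>real_of_int k\<bar> + 1" by linarith
  have "D ^ nat \<bar>- (k div M)\<bar> = exp (L * real (nat \<bar>- (k div M)\<bar>))"
    using D unfolding L_def exp_of_nat2_mult by simp
  also have "\<dots> \<le> exp (L * (\<bar>real_of_int k\<bar> + 1))"
    using n L by (simp only: exp_le_cancel_iff) (rule mult_left_mono)
  finally have 1: "D ^ nat \<bar>- (k div M)\<bar> \<le> exp (L * (\<bar>real_of_int k\<bar> + 1))" .
  define a where "a = M * Re z"
  define b where "b = M * Im z"
  have a: "a\<^sup>2 \<le> (M * R)\<^sup>2" and b: "b\<^sup>2 \<le> (M * \<delta>)\<^sup>2"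
    unfolding a_def b_def using z M
    by (auto simp: power_mult_distrib intro!: mult_left_mono power2_le_iff_abs_le[THEN iffD2])
  have "norm (exp (- (of_int M * z - of_int k)\<^sup>2)) = exp (b\<^sup>2 - (a - k)\<^sup>2)"
    by (simp add: power2_eq_square a_def b_def algebra_simps)
  moreover have "(k::real)\<^sup>2 / 2 - a\<^sup>2 \<le> (a - k)\<^sup>2"
    using zero_le_power2[of "2 * a - k"] by (simp add: power2_eq_square algebra_simps)
  ultimately have 2: "norm (exp (- (of_int M * z - of_int k)\<^sup>2)) \<le> exp ((M * \<delta>)\<^sup>2 + (M * R)\<^sup>2 - (k::real)\<^sup>2 / 2)"
    using a b by simp
  have "D ^ nat \<bar>- (k div M)\<bar> * norm (exp (- (of_int M * z - of_int k)\<^sup>2)) \<le>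
      exp (L * (\<bar>real_of_int k\<bar> + 1)) * exp ((M * \<delta>)\<^sup>2 + (M * R)\<^sup>2 - (k::real)\<^sup>2 / 2)"
    by (rule mult_mono[OF 1 2]) auto
  also have "\<dots> \<le> exp (E - \<bar>real_of_int k\<bar>)"
  proof -
    have "(L + 1) * \<bar>real_of_int k\<bar> \<le> (L + 1)\<^sup>2 / 2 + (real_of_int k)\<^sup>2 / 2"
      using zero_le_power2[of "\<bar>real_of_int k\<bar> - (L + 1)"]
      unfolding power2_diff power2_abs by (simp add: algebra_simps)
    then show ?thesis
      unfolding exp_add[symmetric] exp_le_cancel_iff E_def by (simp add: distrib_left distrib_right)
  qed
  also have "\<dots> = exp E * exp (- \<bar>real_of_int k\<bar>)" by (simp flip: exp_add)
  finally show "D ^ nat \<bar>- (k div M)\<bar> * norm (exp (- (of_int M * z - of_int k)\<^sup>2)) \<le> exp E * exp (- \<bar>real_of_int k\<bar>)" .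
qed

section \<open>The Poincare series\<close>

lemma bounded_linear_mat_vec: "bounded_linear (\<lambda>v. (M :: complex^2^2) *v v)"
  unfolding linear_conv_bounded_linear[symmetric]
  by (rule linearI) (simp_all add: matrix_vector_right_distrib vec_eq_iff matrix_vector_mult_def
      scaleR_sum_right distrib_left sum.distrib)

lemma infsum_linear_image:
  assumes "bounded_linear h" "f summable_on A"
  shows "(\<Sum>\<^sub>\<infinity>x\<in>A. h (f x)) = h (infsum f A)"
  by (rule infsumI[OF has_sum_bounded_linear[OF assms(1) has_sum_infsum[OF assms(2)]]])

lemma cvec_nth: "cvec w $ i = of_real (w $ i)"
  by (simp add: cvec_def)

lemma bounded_linear_smult_left: "bounded_linear (\<lambda>c. c *s (v :: complex^2))"
  unfolding linear_conv_bounded_linear[symmetric]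
  by (rule linearI) (simp_all add: vec_eq_iff algebra_simps)

text \<open>The setting of the approximation: \<open>Y1\<close>, \<open>Y2\<close> is a unitary sewing system with bounded holomorphic extensions
\<open>Z1\<close>, \<open>Z2\<close> to a strip, and \<open>e\<close> is the equivariant unit field to be approximated.\<close>

locale analytic_sewing =
  fixes Y1 Y2 :: "real^2 \<Rightarrow> complex^2^2" and Z1 Z2 :: "complex^2 \<Rightarrow> complex^2^2" and \<delta> C :: real
    and e :: "real^2 \<Rightarrow> complex^2"
  assumes unitary: "unitary_mat (Y1 w)" "unitary_mat (Y2 w)"
    and relation: "Y1 (w + e\<^sub>2) ** Y2 w = Y2 (w + e\<^sub>1) ** Y1 w"
    and \<delta>: "\<delta> > 0" and bounded_holomorphic: "bounded_holomorphic \<delta> C Z1" "bounded_holomorphic \<delta> C Z2"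
    and Z: "Z1 (cvec w) = Y1 w" "Z2 (cvec w) = Y2 w"
    and e_cont: "continuous_on UNIV e" and e_norm: "norm (e w) = 1"
    and e_shift: "e (w + e\<^sub>1) = Y1 w *v e w" "e (w + e\<^sub>2) = Y2 w *v e w"
begin

text \<open>\<open>W1\<close> and \<open>W2\<close> extend the inverses \<open>X1\<close> and \<open>X2\<close> of the sewing matrices holomorphically.\<close>

abbreviation "X1 w \<equiv> adjoint_mat (Y1 w)"
abbreviation "X2 w \<equiv> adjoint_mat (Y2 w)"
abbreviation "W1 w \<equiv> adjoint_mat (Z1 (vcnj w))"
abbreviation "W2 w \<equiv> adjoint_mat (Z2 (vcnj w))"

lemma XY: "X1 w ** Y1 w = mat 1" "Y1 w ** X1 w = mat 1" "X2 w ** Y2 w = mat 1" "Y2 w ** X2 w = mat 1"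
  using unitary[of w] by (simp_all add: unitary_mat_iff)

text \<open>The vector \<open>e(p)\<close> at the grid point \<open>p = (r/M, s/M)\<close>, weighted by a Gaussian of width \<open>1/M\<close> around \<open>p\<close>.\<close>

definition bump :: "nat \<Rightarrow> int \<Rightarrow> int \<Rightarrow> complex^2 \<Rightarrow> complex^2" where
  "bump M r s w = (exp (- (of_int (int M) * w $ 1 - of_int r)\<^sup>2) * exp (- (of_int (int M) * w $ 2 - of_int s)\<^sup>2)) *s
     e (point (r / M) (s / M))"

text \<open>Grid points of the unit square and lattice vectors are enumerated together: \<open>k\<close> stands for the grid point
\<open>(k mod M) / M\<close> and the lattice vector \<open>- (k div M)\<close>. Then the Gaussian in the term of index \<open>k\<close> is centred at
\<open>k/M\<close>, and a shift of the argument by a lattice vector permutes the terms.\<close>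

definition complex_term :: "nat \<Rightarrow> int \<times> int \<Rightarrow> complex^2 \<Rightarrow> complex^2" where
  "complex_term M k = twisted_shift_pow W1 Z1 e\<^sub>1 (- (fst k div int M)) (twisted_shift_pow W2 Z2 e\<^sub>2 (- (snd k div int M))
     (bump M (fst k mod int M) (snd k mod int M)))"

definition real_term :: "nat \<Rightarrow> int \<times> int \<Rightarrow> real^2 \<Rightarrow> complex^2" where
  "real_term M k = twisted_shift_pow X1 Y1 e\<^sub>1 (- (fst k div int M)) (twisted_shift_pow X2 Y2 e\<^sub>2 (- (snd k div int M))
     (\<lambda>w. bump M (fst k mod int M) (snd k mod int M) (cvec w)))"

lemma cvec_axis: "cvec (axis i 1) = axis i 1"
  by (simp add: cvec_def vec_eq_iff axis_def)

lemma complex_term_cvec: "complex_term M k (cvec w) = real_term M k w"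
  unfolding complex_term_def real_term_def
  by (intro twisted_shift_pow_cvec) (simp_all add: Z cvec_axis)

lemma complex_term_holomorphic: "line_holomorphic (\<lambda>w. complex_term M k w $ i) (open_strip \<delta>)"
  unfolding complex_term_def
proof (intro line_holomorphic_twisted_shift_pow[of \<delta> C] bounded_holomorphic bounded_holomorphic_adjoint)
  have g: "line_holomorphic (\<lambda>w. exp (- (of_int (int M) * w $ j - of_int r)\<^sup>2)) (open_strip \<delta>)" for j r
  proof (rule line_holomorphic_compose[OF line_holomorphic_coord, of "\<lambda>z. exp (- (of_int (int M) * z - of_int r)\<^sup>2)" UNIV])
    show "(\<lambda>z. exp (- (of_int (int M) * z - of_int r)\<^sup>2)) holomorphic_on UNIV"
      by (intro holomorphic_intros)
  qed simp
  show "line_holomorphic (\<lambda>w. bump M (fst k mod int M) (snd k mod int M) w $ i) (open_strip \<delta>)" for i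
    unfolding bump_def by (simp del: of_int_of_nat_eq) (intro line_holomorphic_mult g line_holomorphic_const)
qed

lemma complex_term_bound:
  assumes M: "M > 0"
  obtains K where "\<And>k w. w \<in> open_strip \<delta> \<Longrightarrow> \<bar>Re (w $ 1)\<bar> \<le> R \<Longrightarrow> \<bar>Re (w $ 2)\<bar> \<le> R \<Longrightarrow>
     norm (complex_term M k w) \<le> (K * exp (- \<bar>real_of_int (fst k)\<bar>)) * (K * exp (- \<bar>real_of_int (snd k)\<bar>))"
proof -
  define D where "D = max 1 (4 * C)"
  have D: "D \<ge> 1" by (simp add: D_def)
  have tD: "norm (X w *v v) \<le> D * norm v" if "bounded_holomorphic \<delta> C X" "w \<in> open_strip \<delta>" for X w v
    using bounded_holomorphic_norm_le[OF that] by (rule order_trans) (simp add: D_def mult_right_mono)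
  obtain K where K: "\<And>(k::int) z. \<bar>Re z\<bar> \<le> R \<Longrightarrow> \<bar>Im z\<bar> \<le> \<delta> \<Longrightarrow>
    D ^ nat \<bar>- (k div int M)\<bar> * norm (exp (- (of_int (int M) * z - of_int k)\<^sup>2)) \<le> K * exp (- \<bar>real_of_int k\<bar>)"
    using gaussian_beats_power[OF D, of "int M" R \<delta>] M by auto
  show ?thesis
  proof
    fix k :: "int \<times> int" and w
    assume w: "w \<in> open_strip \<delta>" "\<bar>Re (w $ 1)\<bar> \<le> R" "\<bar>Re (w $ 2)\<bar> \<le> R"
    define n1 n2 where "n1 = - (fst k div int M)" and "n2 = - (snd k div int M)"
    let ?b = "bump M (fst k mod int M) (snd k mod int M)"
    have s: "w + of_int n *\<^sub>R axis i 1 \<in> open_strip \<delta>" for n i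
      using w(1) by (simp add: open_strip_def axis_def)
    have "norm (complex_term M k w) \<le> D ^ nat \<bar>n1\<bar> * norm (twisted_shift_pow W2 Z2 e\<^sub>2 n2 ?b (w + of_int n1 *\<^sub>R e\<^sub>1))"
      unfolding complex_term_def n1_def[symmetric] n2_def[symmetric]
      by (rule twisted_shift_pow_norm_le[of "open_strip \<delta>"])
        (use tD[OF bounded_holomorphic_adjoint[OF bounded_holomorphic(1)]] tD[OF bounded_holomorphic(1)] w D open_strip_shift in auto)
    also have "\<dots> \<le> D ^ nat \<bar>n1\<bar> * (D ^ nat \<bar>n2\<bar> * norm (?b (w + of_int n1 *\<^sub>R e\<^sub>1 + of_int n2 *\<^sub>R e\<^sub>2)))"
      by (intro mult_left_mono twisted_shift_pow_norm_le[of "open_strip \<delta>"])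
        (use tD[OF bounded_holomorphic_adjoint[OF bounded_holomorphic(2)]] tD[OF bounded_holomorphic(2)] s D open_strip_shift in auto)
    also have "?b (w + of_int n1 *\<^sub>R e\<^sub>1 + of_int n2 *\<^sub>R e\<^sub>2) =
        (exp (- (of_int (int M) * w $ 1 - of_int (fst k))\<^sup>2) * exp (- (of_int (int M) * w $ 2 - of_int (snd k))\<^sup>2)) *s
          e (point ((fst k mod int M) / M) ((snd k mod int M) / M))"
    proof -
      have d: "of_int (int M) * (z + of_int (- (m div int M))) - of_int (m mod int M) = of_int (int M) * z - of_int m"
        for m and z :: complex
      proof -
        have "(of_int m :: complex) = of_int (int M) * of_int (m div int M) + of_int (m mod int M)"
          by (metis mult_div_mod_eq of_int_add of_int_mult)
        then show ?thesis by (simp add: algebra_simps)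
      qed
      have c: "(w + of_int n1 *\<^sub>R e\<^sub>1 + of_int n2 *\<^sub>R e\<^sub>2) $ 1 = w $ 1 + of_int n1"
        "(w + of_int n1 *\<^sub>R e\<^sub>1 + of_int n2 *\<^sub>R e\<^sub>2) $ 2 = w $ 2 + of_int n2"
        by (simp_all add: axis_def scaleR_conv_of_real[where 'a = complex])
      show ?thesis
        unfolding bump_def c unfolding n1_def n2_def d ..
    qed
    also have "norm \<dots> = norm (exp (- (of_int (int M) * w $ 1 - of_int (fst k))\<^sup>2)) *
        norm (exp (- (of_int (int M) * w $ 2 - of_int (snd k))\<^sup>2))"
      unfolding norm_smult norm_mult e_norm by simp
    also have "D ^ nat \<bar>n1\<bar> * (D ^ nat \<bar>n2\<bar> * \<dots>) =
        (D ^ nat \<bar>n1\<bar> * norm (exp (- (of_int (int M) * w $ 1 - of_int (fst k))\<^sup>2))) *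
        (D ^ nat \<bar>n2\<bar> * norm (exp (- (of_int (int M) * w $ 2 - of_int (snd k))\<^sup>2)))"
      by (simp only: mult_ac)
    also have "\<dots> \<le> (K * exp (- \<bar>real_of_int (fst k)\<bar>)) * (K * exp (- \<bar>real_of_int (snd k)\<bar>))"
    proof (rule mult_mono)
      show a: "D ^ nat \<bar>n1\<bar> * norm (exp (- (of_int (int M) * w $ 1 - of_int (fst k))\<^sup>2)) \<le> K * exp (- \<bar>real_of_int (fst k)\<bar>)"
        unfolding n1_def using w by (intro K) (auto simp: open_strip_def)
      show "D ^ nat \<bar>n2\<bar> * norm (exp (- (of_int (int M) * w $ 2 - of_int (snd k))\<^sup>2)) \<le> K * exp (- \<bar>real_of_int (snd k)\<bar>)"
        unfolding n2_def using w by (intro K) (auto simp: open_strip_def)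
      show "0 \<le> K * exp (- \<bar>real_of_int (fst k)\<bar>)"
        using a D by (intro order_trans[OF _ a]) auto
    qed (use D in auto)
    finally show "norm (complex_term M k w) \<le> (K * exp (- \<bar>real_of_int (fst k)\<bar>)) * (K * exp (- \<bar>real_of_int (snd k)\<bar>))" .
  qed
qed

lemma majorant_summable: "(\<lambda>k::int \<times> int. (K * exp (- \<bar>real_of_int (fst k)\<bar>)) * (K * exp (- \<bar>real_of_int (snd k)\<bar>))) summable_on UNIV"
proof -
  have "(\<lambda>k::int \<times> int. (K * K) * (case k of (x, y) \<Rightarrow> exp (- \<bar>real_of_int x\<bar>) * exp (- \<bar>real_of_int y\<bar>))) summable_on UNIV"
    by (intro summable_on_cmult_right summable_on_prod_mult summable_exp_abs_int) auto
  then show ?thesis by (simp add: case_prod_unfold mult_ac)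
qed

lemma real_term_summable:
  assumes "M > 0" shows "(\<lambda>k. real_term M k w) summable_on UNIV"
proof -
  obtain K where K: "\<And>k v. v \<in> open_strip \<delta> \<Longrightarrow> \<bar>Re (v $ 1)\<bar> \<le> \<bar>w $ 1\<bar> + \<bar>w $ 2\<bar> \<Longrightarrow> \<bar>Re (v $ 2)\<bar> \<le> \<bar>w $ 1\<bar> + \<bar>w $ 2\<bar> \<Longrightarrow>
     norm (complex_term M k v) \<le> (K * exp (- \<bar>real_of_int (fst k)\<bar>)) * (K * exp (- \<bar>real_of_int (snd k)\<bar>))"
    using complex_term_bound[OF assms, of "\<bar>w $ 1\<bar> + \<bar>w $ 2\<bar>"] by metis
  have "norm (real_term M k w) \<le> (K * exp (- \<bar>real_of_int (fst k)\<bar>)) * (K * exp (- \<bar>real_of_int (snd k)\<bar>))" for k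
    using K[of "cvec w" k] cvec_in_open_strip[OF \<delta>, of w] by (simp add: complex_term_cvec cvec_nth)
  then have "(\<lambda>k. norm (real_term M k w)) summable_on UNIV"
    by (intro summable_on_comparison_test[OF majorant_summable]) auto
  then show ?thesis by (rule abs_summable_summable)
qed

definition poincare :: "nat \<Rightarrow> real^2 \<Rightarrow> complex^2" where
  "poincare M w = (\<Sum>\<^sub>\<infinity>k. real_term M k w)"

lemma poincare_nth:
  assumes "M > 0" shows "poincare M w $ i = (\<Sum>\<^sub>\<infinity>k. real_term M k w $ i)"
  unfolding poincare_def
  using infsum_linear_image[OF bounded_linear_vec_nth[of i] real_term_summable[OF assms]] by simp

lemma poincare_analytic:
  assumes M: "M > 0" shows "analytic_at (\<lambda>w. poincare M w $ i) p"
proof (rule analytic_atI[OF open_open_strip cvec_in_open_strip[OF \<delta>]])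
  show "line_holomorphic (\<lambda>w. \<Sum>\<^sub>\<infinity>k. complex_term M k w $ i) (open_strip \<delta>)"
  proof (rule line_holomorphic_infsum[OF open_open_strip complex_term_holomorphic])
    fix w assume w: "w \<in> open_strip \<delta>"
    define R where "R = max \<bar>Re (w $ 1)\<bar> \<bar>Re (w $ 2)\<bar> + 1"
    define N where "N = open_strip \<delta> \<inter> {v. \<bar>Re (v $ 1)\<bar> < R \<and> \<bar>Re (v $ 2)\<bar> < R}"
    obtain K where K: "\<And>k v. v \<in> open_strip \<delta> \<Longrightarrow> \<bar>Re (v $ 1)\<bar> \<le> R \<Longrightarrow> \<bar>Re (v $ 2)\<bar> \<le> R \<Longrightarrow>
       norm (complex_term M k v) \<le> (K * exp (- \<bar>real_of_int (fst k)\<bar>)) * (K * exp (- \<bar>real_of_int (snd k)\<bar>))"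
      using complex_term_bound[OF M, of R] by metis
    have "open N"
      unfolding N_def by (intro open_Int open_open_strip open_Collect_conj open_Collect_less continuous_intros)
    moreover have "w \<in> N" using w by (auto simp: N_def R_def)
    moreover have "norm (complex_term M k v $ i) \<le> (K * exp (- \<bar>real_of_int (fst k)\<bar>)) * (K * exp (- \<bar>real_of_int (snd k)\<bar>))"
      if "v \<in> N" for k v
      using K[of v k] that Finite_Cartesian_Product.norm_nth_le[of "complex_term M k v" i] by (auto simp: N_def)
    ultimately show "\<exists>N Ma. open N \<and> w \<in> N \<and> N \<subseteq> open_strip \<delta> \<and> Ma summable_on UNIV \<and>
        (\<forall>k. \<forall>v\<in>N. norm (complex_term M k v $ i) \<le> Ma k)"
      using majorant_summable[of K] by (intro exI conjI) (assumption | auto simp: N_def)+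
  qed
  show "(\<Sum>\<^sub>\<infinity>k. complex_term M k (cvec x) $ i) = poincare M x $ i" for x
    by (simp add: complex_term_cvec poincare_nth[OF M])
qed

text \<open>The twisted shift in direction 1 subtracts \<open>M\<close> from the first component of the index of each term; in direction 2
it first has to be moved past the powers in direction 1, with which it commutes by the sewing relation.\<close>

lemma poincare_shift:
  assumes M: "M > 0"
  shows "poincare M (w + e\<^sub>1) = Y1 w *v poincare M w" "poincare M (w + e\<^sub>2) = Y2 w *v poincare M w"
proof -
  have div: "- ((a - int M) div int M) = - (a div int M) + 1" "(a - int M) mod int M = a mod int M" for a
    using M div_add_self2[of "int M" "a - int M"] by (simp_all add: mod_diff_right_eq[symmetric]) 
  have t1: "twisted_shift X1 e\<^sub>1 (real_term M k) = real_term M (fst k - int M, snd k)" for k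
    unfolding real_term_def fst_conv snd_conv div by (rule twisted_shift_pow_Suc[OF XY(1), symmetric])
  have comm1: "twisted_shift X2 e\<^sub>2 (twisted_shift X1 e\<^sub>1 h) = twisted_shift X1 e\<^sub>1 (twisted_shift X2 e\<^sub>2 h)" for h
  proof
    fix w
    have "X2 w ** X1 (w + e\<^sub>2) = X1 w ** X2 (w + e\<^sub>1)"
      using arg_cong[OF relation[of w], of adjoint_mat] by (simp add: adjoint_mult)
    then show "twisted_shift X2 e\<^sub>2 (twisted_shift X1 e\<^sub>1 h) w = twisted_shift X1 e\<^sub>1 (twisted_shift X2 e\<^sub>2 h) w"
      by (simp add: twisted_shift_def matrix_vector_mul_assoc ac_simps)
  qed
  have comm2: "twisted_shift X2 e\<^sub>2 (twisted_shift (\<lambda>w. Y1 (w - e\<^sub>1)) (- e\<^sub>1) h) = twisted_shift (\<lambda>w. Y1 (w - e\<^sub>1)) (- e\<^sub>1) (twisted_shift X2 e\<^sub>2 h)" for h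
  proof
    fix w :: "real^2"
    define v where "v = w - e\<^sub>1"
    have w: "w = v + e\<^sub>1" by (simp add: v_def)
    have "X2 (v + e\<^sub>1) ** Y1 (v + e\<^sub>2) = X2 (v + e\<^sub>1) ** (Y1 (v + e\<^sub>2) ** Y2 v) ** X2 v"
      by (simp add: matrix_mul_assoc[symmetric] XY)
    also have "\<dots> = Y1 v ** X2 v"
      unfolding relation by (simp add: matrix_mul_assoc XY)
    finally have "X2 (v + e\<^sub>1) ** Y1 (v + e\<^sub>2) = Y1 v ** X2 v" .
    then show "twisted_shift X2 e\<^sub>2 (twisted_shift (\<lambda>w. Y1 (w - e\<^sub>1)) (- e\<^sub>1) h) w = twisted_shift (\<lambda>w. Y1 (w - e\<^sub>1)) (- e\<^sub>1) (twisted_shift X2 e\<^sub>2 h) w"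
      by (simp add: twisted_shift_def matrix_vector_mul_assoc w algebra_simps)
  qed
  have t2: "twisted_shift X2 e\<^sub>2 (real_term M k) = real_term M (fst k, snd k - int M)" for k
    unfolding real_term_def fst_conv snd_conv div twisted_shift_pow_Suc[OF XY(3)]
    by (rule twisted_shift_pow_commute[where f = "twisted_shift X2 e\<^sub>2", OF comm1 comm2])
  have b1: "bij_betw (\<lambda>k::int \<times> int. (fst k - int M, snd k)) UNIV UNIV"
    by (rule bij_betw_byWitness[where f' = "\<lambda>k. (fst k + int M, snd k)"]) auto
  have b2: "bij_betw (\<lambda>k::int \<times> int. (fst k, snd k - int M)) UNIV UNIV"
    by (rule bij_betw_byWitness[where f' = "\<lambda>k. (fst k, snd k + int M)"]) auto
  have "X1 w *v poincare M (w + e\<^sub>1) = (\<Sum>\<^sub>\<infinity>k. twisted_shift X1 e\<^sub>1 (real_term M k) w)"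
    unfolding poincare_def twisted_shift_def
    by (rule infsum_linear_image[OF bounded_linear_mat_vec real_term_summable[OF M], symmetric])
  also have "\<dots> = poincare M w"
    unfolding t1 poincare_def using infsum_reindex_bij_betw[OF b1, of "\<lambda>k. real_term M k w"] .
  finally have 1: "X1 w *v poincare M (w + e\<^sub>1) = poincare M w" .
  have "X2 w *v poincare M (w + e\<^sub>2) = (\<Sum>\<^sub>\<infinity>k. twisted_shift X2 e\<^sub>2 (real_term M k) w)"
    unfolding poincare_def twisted_shift_def
    by (rule infsum_linear_image[OF bounded_linear_mat_vec real_term_summable[OF M], symmetric])
  also have "\<dots> = poincare M w"
    unfolding t2 poincare_def using infsum_reindex_bij_betw[OF b2, of "\<lambda>k. real_term M k w"] .
  finally have 2: "X2 w *v poincare M (w + e\<^sub>2) = poincare M w" .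
  show "poincare M (w + e\<^sub>1) = Y1 w *v poincare M w"
    by (simp add: 1[symmetric] matrix_vector_mul_assoc XY)
  show "poincare M (w + e\<^sub>2) = Y2 w *v poincare M w"
    by (simp add: 2[symmetric] matrix_vector_mul_assoc XY)
qed

end

context analytic_sewing
begin

definition weight :: "nat \<Rightarrow> int \<times> int \<Rightarrow> real^2 \<Rightarrow> real" where
  "weight M k w = exp (- (real M * w $ 1 - of_int (fst k))\<^sup>2) * exp (- (real M * w $ 2 - of_int (snd k))\<^sup>2)"

section \<open>The series approximates the continuous section\<close>

text \<open>Since \<open>e\<close> is equivariant, the operator that produces the term of index \<open>k\<close> from \<open>\<gamma> e(p)\<close>, with \<open>\<gamma>\<close> the
Gaussian around \<open>p\<close>, also produces \<open>weight e\<close> from \<open>\<gamma> e\<close>. It preserves norms up to translation, so the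
difference is governed by the oscillation of \<open>e\<close> between \<open>p\<close> and the translate of \<open>w\<close>.\<close>

lemma real_term_error:
  assumes M: "M > 0"
  defines "p k \<equiv> point ((fst k mod int M) / M) ((snd k mod int M) / M)"
    and "q k w \<equiv> w + of_int (- (fst k div int M)) *\<^sub>R e\<^sub>1 + of_int (- (snd k div int M)) *\<^sub>R e\<^sub>2"
  shows "norm (real_term M k w - of_real (weight M k w) *s e w) = weight M k w * norm (e (p k) - e (q k w))"
proof -
  define r s where "r = fst k mod int M" and "s = snd k mod int M"
  define \<gamma> where "\<gamma> v = complex_of_real (exp (- (real M * v $ 1 - of_int r)\<^sup>2) * exp (- (real M * v $ 2 - of_int s)\<^sup>2))"
    for v :: "real^2"
  define n1 n2 where "n1 = - (fst k div int M)" and "n2 = - (snd k div int M)"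
  define T where "T h = twisted_shift_pow X1 Y1 e\<^sub>1 n1 (twisted_shift_pow X2 Y2 e\<^sub>2 n2 h)" for h
  have bump: "bump M r s (cvec v) = \<gamma> v *s e (p k)" for v
  proof -
    have "exp (- (of_int (int M) * complex_of_real a - of_int m)\<^sup>2) = complex_of_real (exp (- (real M * a - of_int m)\<^sup>2))"
      for a m
      unfolding exp_of_real[symmetric] by simp
    then show ?thesis
      unfolding bump_def \<gamma>_def cvec_nth p_def r_def s_def of_real_mult by (simp only:)
  qed
  have \<gamma>: "\<gamma> (w + of_int n1 *\<^sub>R e\<^sub>1 + of_int n2 *\<^sub>R e\<^sub>2) = of_real (weight M k w)" for w
  proof -
    have d: "real M * (x + of_int (- (m div int M))) - of_int (m mod int M) = real M * x - of_int m" for m x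
    proof -
      have "real_of_int m = real M * of_int (m div int M) + of_int (m mod int M)"
        by (metis mult_div_mod_eq of_int_add of_int_mult of_int_of_nat_eq)
      then show ?thesis by (simp add: algebra_simps)
    qed
    have c: "(w + of_int n1 *\<^sub>R e\<^sub>1 + of_int n2 *\<^sub>R e\<^sub>2) $ 1 = w $ 1 + of_int n1"
      "(w + of_int n1 *\<^sub>R e\<^sub>1 + of_int n2 *\<^sub>R e\<^sub>2) $ 2 = w $ 2 + of_int n2"
      by (simp_all add: axis_def)
    show ?thesis
      unfolding \<gamma>_def weight_def c unfolding n1_def n2_def r_def s_def d ..
  qed
  have sm: "T (\<lambda>v. \<gamma> v *s h v) w = of_real (weight M k w) *s T h w" for h w
  proof -
    have "twisted_shift_pow X2 Y2 e\<^sub>2 n2 (\<lambda>v. \<gamma> v *s h v) = (\<lambda>v. \<gamma> (v + of_int n2 *\<^sub>R e\<^sub>2) *s twisted_shift_pow X2 Y2 e\<^sub>2 n2 h v)"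
      by (rule ext) (rule twisted_shift_pow_smult)
    then show ?thesis
      unfolding T_def by (simp add: twisted_shift_pow_smult \<gamma>)
  qed
  have Te: "T e = e"
    unfolding T_def by (simp add: twisted_shift_pow_fixed XY e_shift)
  have Td: "T (\<lambda>v. f v - g v) w = T f w - T g w" for f g
  proof -
    have "twisted_shift_pow X2 Y2 e\<^sub>2 n2 (\<lambda>v. f v - g v) = (\<lambda>v. twisted_shift_pow X2 Y2 e\<^sub>2 n2 f v - twisted_shift_pow X2 Y2 e\<^sub>2 n2 g v)"
      by (rule ext) (rule twisted_shift_pow_diff)
    then show ?thesis unfolding T_def by (simp add: twisted_shift_pow_diff)
  qed
  have rt: "real_term M k w = T (\<lambda>v. \<gamma> v *s e (p k)) w"
    unfolding real_term_def T_def n1_def n2_def r_def[symmetric] s_def[symmetric] bump ..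
  have "real_term M k w - of_real (weight M k w) *s e w = T (\<lambda>v. \<gamma> v *s e (p k)) w - T (\<lambda>v. \<gamma> v *s e v) w"
    unfolding rt sm Te ..
  also have "\<dots> = T (\<lambda>v. \<gamma> v *s (e (p k) - e v)) w"
    unfolding Td[symmetric] by (simp add: vector_sub_rdistrib vector_ssub_ldistrib)
  also have "\<dots> = of_real (weight M k w) *s T (\<lambda>v. e (p k) - e v) w"
    by (rule sm)
  also have "norm \<dots> = weight M k w * norm (e (p k) - e (q k w))"
  proof -
    have "norm (complex_of_real (weight M k w)) = weight M k w"
      unfolding norm_of_real by (simp add: weight_def)
    then show ?thesis
      unfolding norm_smult T_def q_def n1_def[symmetric] n2_def[symmetric]
      using unitary unitary_adjoint by (simp add: twisted_shift_pow_norm norm_unitary)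
  qed
  finally show ?thesis .
qed

text \<open>A modulus of continuity that is cheap to sum against Gaussians: uniform continuity handles near points, and for
points at distance at least \<open>D\<close> the trivial bound \<open>2\<close> is at most \<open>2 |p - v|\<^sup>2 / D\<^sup>2\<close>. Points within distance
1 of the unit square lie in the compact square with corners \<open>(-1, -1)\<close> and \<open>(2, 2)\<close>, where \<open>e\<close> is
uniformly continuous.\<close>

lemma e_modulus:
  obtains B where "B \<ge> 0"
    "\<And>p v. 0 \<le> p $ 1 \<Longrightarrow> p $ 1 \<le> 1 \<Longrightarrow> 0 \<le> p $ 2 \<Longrightarrow> p $ 2 \<le> 1 \<Longrightarrow>
       norm (e p - e v) \<le> 1 / 2 + B * (norm (p - v))\<^sup>2"
proof -
  define Q where "Q = cbox (-1 :: real^2) 2"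
  have "uniformly_continuous_on Q e"
    unfolding Q_def by (intro compact_uniformly_continuous continuous_on_subset[OF e_cont]) auto
  then obtain d where d: "d > 0" "\<And>x y. x \<in> Q \<Longrightarrow> y \<in> Q \<Longrightarrow> dist y x < d \<Longrightarrow> dist (e y) (e x) < 1 / 2"
    unfolding uniformly_continuous_on_def by (metis half_gt_zero_iff zero_less_one)
  define D where "D = min d 1"
  have D: "D > 0" "D \<le> d" "D \<le> 1" using d by (auto simp: D_def)
  show ?thesis
  proof
    show "2 / D\<^sup>2 \<ge> 0" by simp
    fix p v :: "real^2" assume p: "0 \<le> p $ 1" "p $ 1 \<le> 1" "0 \<le> p $ 2" "p $ 2 \<le> 1"
    show "norm (e p - e v) \<le> 1 / 2 + 2 / D\<^sup>2 * (norm (p - v))\<^sup>2"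
    proof (cases "norm (p - v) < D")
      case True
      have "\<bar>p $ i - v $ i\<bar> \<le> 1" for i
        using component_le_norm_cart[of "p - v" i] True D by simp
      from this[of 1] this[of 2] have "v \<in> Q" "p \<in> Q"
        using p by (auto simp: Q_def mem_box_cart forall_2)
      then have "dist (e p) (e v) < 1 / 2"
        using True D by (intro d(2)) (auto simp: dist_norm)
      moreover have "0 \<le> 2 / D\<^sup>2 * (norm (p - v))\<^sup>2" by simp
      ultimately show ?thesis unfolding dist_norm by linarith
    next
      case False
      then have "D\<^sup>2 \<le> (norm (p - v))\<^sup>2" using D by (intro power_mono) auto
      then have "2 \<le> 2 / D\<^sup>2 * (norm (p - v))\<^sup>2" using D by (simp add: field_simps)
      moreover have "norm (e p - e v) \<le> 2"
        using norm_triangle_ineq4[of "e p" "e v"] by (simp add: e_norm)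
      ultimately show ?thesis by linarith
    qed
  qed
qed

text \<open>By \<open>e_modulus\<close> the error is at most \<open>\<theta>/2 + B/M\<^sup>2\<close> times a second moment of the Gaussian weights in the
rescaled variable \<open>M w\<close>. That moment is bounded, and \<open>\<theta>\<close> is bounded below, both uniformly in \<open>w\<close> and \<open>M\<close>;
so \<open>M\<close> large suffices.\<close>

lemma poincare_close:
  obtains M where "M > 0" "\<And>w. \<exists>\<theta>>0. norm (poincare M w - of_real \<theta> *s e w) < \<theta>"
proof -
  obtain B where B: "B \<ge> 0" "\<And>p v. 0 \<le> p $ 1 \<Longrightarrow> p $ 1 \<le> 1 \<Longrightarrow> 0 \<le> p $ 2 \<Longrightarrow> p $ 2 \<le> 1 \<Longrightarrow>
       norm (e p - e v) \<le> 1 / 2 + B * (norm (p - v))\<^sup>2"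
    using e_modulus by metis
  define S where "S = 2 * exp 1 * ((exp 1 * exp_abs_sum) * (exp 1 * exp_abs_sum))"
  obtain M :: nat where M: "real M > max 1 (B * S * (2 * exp 2))" using reals_Archimedean2 by blast
  have M0: "M > 0" using M by (cases M) auto
  have M1: "real M \<ge> 1" using M by simp
  have "\<exists>\<theta>>0. norm (poincare M w - of_real \<theta> *s e w) < \<theta>" for w
  proof -
    define x where "x k = real M * w $ 1 - of_int (fst k)" for k :: "int \<times> int"
    define y where "y k = real M * w $ 2 - of_int (snd k)" for k :: "int \<times> int"
    define \<mu> where "\<mu> k = exp (- \<bar>x k\<bar>) * exp (- \<bar>y k\<bar>)" for k
    have wt: "weight M k w = exp (- (x k)\<^sup>2) * exp (- (y k)\<^sup>2)" for k
      by (simp add: weight_def x_def y_def)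
    have \<mu>: "\<mu> summable_on UNIV" "infsum \<mu> UNIV \<le> (exp 1 * exp_abs_sum) * (exp 1 * exp_abs_sum)"
    proof -
      note s = shifted_exp_sum[of "real M * w $ 1"] shifted_exp_sum[of "real M * w $ 2"]
      have \<mu>': "\<mu> = (\<lambda>(j, k). exp (- \<bar>real M * w $ 1 - of_int j\<bar>) * exp (- \<bar>real M * w $ 2 - of_int k\<bar>))"
        by (auto simp: \<mu>_def x_def y_def fun_eq_iff)
      show "\<mu> summable_on UNIV"
        unfolding \<mu>' by (intro summable_on_prod_mult s) auto
      have "infsum \<mu> UNIV = (\<Sum>\<^sub>\<infinity>k::int. exp (- \<bar>real M * w $ 1 - of_int k\<bar>)) * (\<Sum>\<^sub>\<infinity>k::int. exp (- \<bar>real M * w $ 2 - of_int k\<bar>))"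
        unfolding \<mu>' by (intro summable_on_prod_mult(2) s) auto
      also have "\<dots> \<le> (exp 1 * exp_abs_sum) * (exp 1 * exp_abs_sum)"
        by (intro mult_mono s order_trans[OF infsum_nonneg s(2)] infsum_nonneg) auto
      finally show "infsum \<mu> UNIV \<le> (exp 1 * exp_abs_sum) * (exp 1 * exp_abs_sum)" .
    qed
    have wts: "(\<lambda>k. weight M k w) summable_on UNIV"
    proof (rule summable_on_comparison_test[OF summable_on_cmult_right[OF \<mu>(1), of "exp 1 * exp 1"]])
      show "weight M k w \<le> exp 1 * exp 1 * \<mu> k" for k
        unfolding wt \<mu>_def by (rule gaussian_moment_le(2))
    qed (simp add: wt)
    define \<theta> where "\<theta> = (\<Sum>\<^sub>\<infinity>k. weight M k w)"
    \<comment> \<open>The Gaussian centred at the lattice point below \<open>M w\<close> alone contributes this much.\<close>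
    have \<theta>: "\<theta> \<ge> exp (- 2)"
    proof -
      define k where "k = (\<lfloor>real M * w $ 1\<rfloor>, \<lfloor>real M * w $ 2\<rfloor>)"
      have u: "(t - of_int \<lfloor>t\<rfloor>)\<^sup>2 \<le> 1" for t :: real
      proof -
        have "0 \<le> t - of_int \<lfloor>t\<rfloor>" "t - of_int \<lfloor>t\<rfloor> \<le> 1" by linarith+
        then show ?thesis by (simp add: power_le_one)
      qed
      have "exp (- 2) \<le> exp (- (x k)\<^sup>2 - (y k)\<^sup>2)"
        using u[of "real M * w $ 1"] u[of "real M * w $ 2"] by (simp add: x_def y_def k_def)
      also have "\<dots> = weight M k w" unfolding wt by (simp flip: exp_add)
      also have "\<dots> = infsum (\<lambda>k. weight M k w) {k}" by simp
      also have "\<dots> \<le> \<theta>"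
        unfolding \<theta>_def by (rule infsum_mono_neutral) (use wts in \<open>auto simp: wt\<close>)
      finally show ?thesis .
    qed
    then have \<theta>0: "\<theta> > 0" using exp_gt_zero[of "-2 :: real"] by linarith
    have we: "(\<lambda>k. of_real (weight M k w) *s e w) summable_on UNIV"
      "(\<Sum>\<^sub>\<infinity>k. of_real (weight M k w) *s e w) = of_real \<theta> *s e w"
    proof -
      have bl: "bounded_linear (\<lambda>t. complex_of_real t *s e w)"
        using bounded_linear_compose[OF bounded_linear_smult_left bounded_linear_of_real] .
      show "(\<lambda>k. of_real (weight M k w) *s e w) summable_on UNIV"
        by (rule summable_on_bounded_linear[OF bl wts])
      show "(\<Sum>\<^sub>\<infinity>k. of_real (weight M k w) *s e w) = of_real \<theta> *s e w"
        unfolding \<theta>_def by (rule infsum_linear_image[OF bl wts])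
    qed
    have est: "norm (real_term M k w - of_real (weight M k w) *s e w) \<le> 1 / 2 * weight M k w + B / (real M)\<^sup>2 * (2 * exp 1) * \<mu> k" for k
    proof -
      define p where "p = point ((fst k mod int M) / M) ((snd k mod int M) / M)"
      define q where "q = w + of_int (- (fst k div int M)) *\<^sub>R e\<^sub>1 + of_int (- (snd k div int M)) *\<^sub>R e\<^sub>2"
      have m: "0 \<le> real_of_int (m mod int M) / M" "real_of_int (m mod int M) / M \<le> 1" for m
      proof -
        have "m mod int M \<le> int M" using M0 by (intro less_imp_le pos_mod_bound) simp
        then have "real_of_int (m mod int M) \<le> real_of_int (int M)" by (simp only: of_int_le_iff)
        then show "real_of_int (m mod int M) / M \<le> 1" using M0 by (simp add: divide_le_eq)
      qed (use M0 in simp)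
      have d: "of_int (m mod int M) / real M - (t + of_int (- (m div int M))) = - (real M * t - of_int m) / real M" for m t
      proof -
        have "real_of_int m = real M * of_int (m div int M) + of_int (m mod int M)"
          by (metis mult_div_mod_eq of_int_add of_int_mult of_int_of_nat_eq)
        then show ?thesis using M0 by (simp add: field_simps)
      qed
      have c: "(p - q) $ 1 = - x k / M" "(p - q) $ 2 = - y k / M"
        using d[of "fst k" "w $ 1"] d[of "snd k" "w $ 2"]
        by (simp_all add: p_def q_def x_def y_def axis_def)
      have n: "(norm (p - q))\<^sup>2 = ((x k)\<^sup>2 + (y k)\<^sup>2) / (real M)\<^sup>2"
        unfolding norm_vec_def L2_set_def sum_2 c by (simp add: power_divide add_divide_distrib)
      have "norm (real_term M k w - of_real (weight M k w) *s e w) = weight M k w * norm (e p - e q)"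
        unfolding p_def q_def by (rule real_term_error[OF M0])
      also have "\<dots> \<le> weight M k w * (1 / 2 + B * (norm (p - q))\<^sup>2)"
        using m by (intro mult_left_mono B(2)) (auto simp: p_def wt)
      also have "\<dots> = 1 / 2 * weight M k w + B / (real M)\<^sup>2 * (exp (- (x k)\<^sup>2) * exp (- (y k)\<^sup>2) * ((x k)\<^sup>2 + (y k)\<^sup>2))"
        unfolding n wt by (simp add: algebra_simps add_divide_distrib)
      also have "\<dots> \<le> 1 / 2 * weight M k w + B / (real M)\<^sup>2 * (2 * exp 1 * \<mu> k)"
        unfolding \<mu>_def by (intro add_left_mono mult_left_mono gaussian_moment_le) (use B in auto)
      finally show ?thesis by (simp add: mult.assoc)
    qed
    have maj: "(\<lambda>k. 1 / 2 * weight M k w + B / (real M)\<^sup>2 * (2 * exp 1) * \<mu> k) summable_on UNIV"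
      by (intro summable_on_add summable_on_cmult_right wts \<mu>)
    have ns: "(\<lambda>k. norm (real_term M k w - of_real (weight M k w) *s e w)) summable_on UNIV"
      by (rule summable_on_comparison_test[OF maj]) (use est in auto)
    have "poincare M w - of_real \<theta> *s e w = (\<Sum>\<^sub>\<infinity>k. real_term M k w - of_real (weight M k w) *s e w)"
      unfolding poincare_def we(2)[symmetric]
      using infsum_add[OF abs_summable_summable[OF ns] we(1)] by simp
    also have "norm \<dots> \<le> (\<Sum>\<^sub>\<infinity>k. norm (real_term M k w - of_real (weight M k w) *s e w))"
      by (rule norm_infsum_bound[OF ns])
    also have "\<dots> \<le> (\<Sum>\<^sub>\<infinity>k. 1 / 2 * weight M k w + B / (real M)\<^sup>2 * (2 * exp 1) * \<mu> k)"
      by (rule infsum_mono[OF ns maj est])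
    also have "\<dots> = 1 / 2 * \<theta> + B / (real M)\<^sup>2 * (2 * exp 1) * infsum \<mu> UNIV"
      unfolding \<theta>_def
      unfolding infsum_add[OF summable_on_cmult_right[OF wts] summable_on_cmult_right[OF \<mu>(1)]] infsum_cmult_right' ..
    also have "\<dots> \<le> 1 / 2 * \<theta> + B / (real M)\<^sup>2 * S"
      unfolding S_def mult.assoc using \<mu>(2) B(1) by (intro add_left_mono mult_left_mono) auto
    also have "B / (real M)\<^sup>2 * S < exp (- 2) / 2"
    proof -
      have "B * S * (2 * exp 2) < real M" using M by simp
      also have "\<dots> \<le> (real M)\<^sup>2" using M1 by (simp add: power2_eq_square)
      finally show ?thesis using M0 by (simp add: exp_minus field_simps)
    qed
    also have "1 / 2 * \<theta> + exp (- 2) / 2 \<le> \<theta>" using \<theta> by simp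
    finally show ?thesis using \<theta>0 by auto
  qed
  then show ?thesis using that M0 by blast
qed

lemma analytic_section:
  obtains F where "\<And>i p. analytic_at (\<lambda>w. F w $ i) p"
    "\<And>w. F (w + e\<^sub>1) = Y1 w *v F w" "\<And>w. F (w + e\<^sub>2) = Y2 w *v F w" "\<And>w. herm (F w) (e w) \<noteq> 0"
proof -
  obtain M where M: "M > 0" "\<And>w. \<exists>\<theta>>0. norm (poincare M w - of_real \<theta> *s e w) < \<theta>"
    by (rule poincare_close) blast
  have "herm (poincare M w) (e w) \<noteq> 0" for w
  proof
    assume 0: "herm (poincare M w) (e w) = 0"
    obtain \<theta> where \<theta>: "\<theta> > 0" "norm (poincare M w - of_real \<theta> *s e w) < \<theta>" using M(2) by blast
    have "herm (poincare M w - of_real \<theta> *s e w) (e w) = - of_real \<theta>"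
      using 0 e_norm[of w] by (simp add: herm_diff_left herm_scale_left herm_self)
    then have "\<theta> \<le> norm (poincare M w - of_real \<theta> *s e w)"
      using norm_herm_le[of "poincare M w - of_real \<theta> *s e w" "e w"] \<theta>(1) e_norm[of w] by simp
    then show False using \<theta>(2) by simp
  qed
  then show ?thesis
    using that[of "poincare M"] poincare_analytic[OF M(1)] poincare_shift[OF M(1)] by blast
qed

end

section \<open>Analytic projection onto the line field\<close>

lemma chart_vector:
  assumes L: "L \<in> chart_domain i" and ij: "(i, j) \<in> {(1, 2), (2, 1)}"
  defines "v \<equiv> axis i 1 + axis j (chart i j L)"
  shows "v \<in> L" "v \<noteq> 0"
proof -
  obtain u where u: "L \<in> CP1" "u \<in> L" "u $ i \<noteq> 0" using L by (auto simp: chart_domain_def)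
  have Lu: "L = complex_line u"
    using u by (intro CP1_eq_complex_line) auto
  have c: "chart i j L = u $ j / u $ i"
    unfolding chart_def
  proof (rule the_equality)
    show "\<exists>v\<in>L. v $ i \<noteq> 0 \<and> u $ j / u $ i = v $ j / v $ i" using u by blast
    show "z = u $ j / u $ i" if "\<exists>v\<in>L. v $ i \<noteq> 0 \<and> z = v $ j / v $ i" for z
      using that unfolding Lu complex_line_def by auto
  qed
  have v: "v = (1 / u $ i) *s u"
    using ij u(3) unfolding v_def c by (auto simp: vec_eq_iff forall_2 axis_def)
  show "v \<in> L" unfolding v using u by (intro smult_in_CP1)
  show "v \<noteq> 0" unfolding v using u(3) by auto
qed

lemma openin_chart_domain: "openin CP1_topology (chart_domain i)"
proof -
  have "{v. v \<noteq> 0 \<and> complex_line v \<in> chart_domain i} = {v. v $ i \<noteq> 0}"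
  proof safe
    fix v :: "complex^2" assume "v $ i \<noteq> 0"
    then show "complex_line v \<in> chart_domain i"
      by (auto simp: chart_domain_def CP1_def complex_line_def intro!: exI[of _ 1] image_eqI[of _ _ v])
  next
    fix v :: "complex^2" assume "complex_line v \<in> chart_domain i" "v $ i = 0"
    then show False by (auto simp: chart_domain_def complex_line_def)
  qed auto
  moreover have "open {v :: complex^2. v $ i \<noteq> 0}"
    by (intro open_Collect_neq continuous_intros)
  ultimately show ?thesis
    by (auto simp: openin_CP1_topology chart_domain_def)
qed

lemma CP1_in_chart_domain: "L \<in> CP1 \<Longrightarrow> L \<in> chart_domain 1 \<or> L \<in> chart_domain 2"
proof -
  assume L: "L \<in> CP1"
  then obtain v where v: "v \<noteq> 0" "L = complex_line v" by (rule CP1_nonzero)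
  have "v \<in> L" unfolding v(2) complex_line_def by (auto simp: image_iff intro!: exI[of _ 1])
  moreover have "v $ 1 \<noteq> 0 \<or> v $ 2 \<noteq> 0" using v(1) by (auto simp: vec_eq_iff forall_2)
  ultimately show ?thesis using L by (auto simp: chart_domain_def)
qed

lemma analytic_local_frame:
  assumes lt: "holomorphic2_CP1 lt X" and X: "open X" "range cvec \<subseteq> X" and l: "\<And>x. lt (cvec x) = l x"
  obtains N v where "open N" "p \<in> N" "\<And>x. x \<in> N \<Longrightarrow> v x \<in> l x \<and> v x \<noteq> 0"
    "\<And>k. analytic_at (\<lambda>x. v x $ k) p"
proof -
  have cont: "continuous_map (top_of_set X) CP1_topology lt" using lt by (simp add: holomorphic2_CP1_def)
  have "lt (cvec p) \<in> CP1"
    using cont X(2) by (auto simp: continuous_map_def topspace_CP1_topology)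
  then obtain i j :: 2 where ij: "(i, j) \<in> {(1, 2), (2, 1)}" "lt (cvec p) \<in> chart_domain i"
    using CP1_in_chart_domain by blast
  define D where "D = {w \<in> X. lt w \<in> chart_domain i}"
  have "openin (top_of_set X) D"
    using openin_continuous_map_preimage[OF cont openin_chart_domain[of i]] by (simp add: D_def)
  then have D: "open D" using X(1) by (simp add: openin_open_eq)
  have pD: "cvec p \<in> D" using ij X(2) by (auto simp: D_def)
  have "holomorphic2 (\<lambda>w. chart i j (lt w)) D"
    using lt ij(1) unfolding holomorphic2_CP1_def D_def by blast
  then have "line_holomorphic (\<lambda>w. chart i j (lt w)) D"
    by (rule holomorphic2_imp_line_holomorphic)
  then have an: "analytic_at (\<lambda>x. chart i j (l x)) p"
    by (rule analytic_atI[OF D pD]) (simp add: l)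
  define v where "v x = axis i 1 + axis j (chart i j (l x))" for x
  show ?thesis
  proof
    have "continuous_on UNIV cvec" unfolding cvec_def[abs_def] by (intro continuous_intros)
    then show "open (cvec -` D)" using D by (intro open_vimage)
    show "p \<in> cvec -` D" using pD by simp
    show "v x \<in> l x \<and> v x \<noteq> 0" if "x \<in> cvec -` D" for x
      using that chart_vector[of "l x" i j] ij(1) by (simp add: D_def l v_def)
    show "analytic_at (\<lambda>x. v x $ k) p" for k
      using ij(1) exhaust_2[of k] an by (auto simp: v_def axis_def analytic_at_const)
  qed
qed

lemma analytic_at_herm:
  assumes "\<And>k. analytic_at (\<lambda>x. f x $ k) p" "\<And>k. analytic_at (\<lambda>x. g x $ k) p"
  shows "analytic_at (\<lambda>x. herm (f x) (g x)) p"
  unfolding herm_def by (intro analytic_at_add analytic_at_mult analytic_at_cnj assms)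

text \<open>The projection onto a line can be computed from any spanning vector: with the unit vector \<open>e\<close> it is visibly
equivariant, with the analytic frame \<open>v\<close> it is visibly analytic.\<close>

lemma analytic_at_projection:
  assumes frame: "open N" "p \<in> N" "\<And>x. x \<in> N \<Longrightarrow> v x \<in> l x \<and> v x \<noteq> 0" "\<And>k. analytic_at (\<lambda>x. v x $ k) p"
    and l: "\<And>x. l x \<in> CP1" and e: "\<And>x. norm (e x) = 1 \<and> e x \<in> l x"
    and F: "\<And>k. analytic_at (\<lambda>x. F x $ k) p"
  shows "analytic_at (\<lambda>x. (herm (F x) (e x) *s e x) $ k) p"
proof (rule analytic_at_transform[OF _ frame(1,2)])
  have "herm (v p) (v p) \<in> - {0}"
    using frame(2,3) by (auto simp: herm_self)
  then have "analytic_at (\<lambda>x. inverse (herm (v x) (v x))) p"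
    by (intro analytic_at_compose[of "\<lambda>x. herm (v x) (v x)" p inverse "- {0}"] analytic_at_herm frame)
      (auto intro!: holomorphic_intros)
  then show "analytic_at (\<lambda>x. herm (F x) (v x) * inverse (herm (v x) (v x)) * v x $ k) p"
    by (intro analytic_at_mult analytic_at_herm F frame)
  fix x assume "x \<in> N"
  then have v: "v x \<in> l x" "v x \<noteq> 0" using frame(3) by auto
  have e0: "e x \<noteq> 0" using e[of x] by auto
  have "l x = complex_line (v x)" "l x = complex_line (e x)"
    using CP1_eq_complex_line[OF l v] CP1_eq_complex_line[OF l _ e0] e by auto
  then have "line_proj (complex_line (v x)) *v F x = line_proj (complex_line (e x)) *v F x" by simp
  then have "(herm (F x) (v x) / herm (v x) (v x)) *s v x = (herm (F x) (e x) / herm (e x) (e x)) *s e x"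
    using v(2) e0 by (simp add: line_proj_apply herm_self)
  then have "herm (F x) (e x) *s e x = (herm (F x) (v x) / herm (v x) (v x)) *s v x"
    using e[of x] by (simp add: herm_self)
  then show "herm (F x) (v x) * inverse (herm (v x) (v x)) * v x $ k = (herm (F x) (e x) *s e x) $ k"
    by (simp add: divide_inverse)
qed

text \<open>Division by the norm. The complex square root of \<open>herm y y\<close> shows that it preserves analyticity.\<close>

definition normalize_vec :: "complex^2 \<Rightarrow> complex^2" where
  "normalize_vec y = inverse (csqrt (herm y y)) *s y"

lemma csqrt_herm_self: "csqrt (herm y y) = of_real (norm y)"
  by (simp add: herm_self csqrt_of_real_nonneg)

lemma norm_normalize_vec: "y \<noteq> 0 \<Longrightarrow> norm (normalize_vec y) = 1"
  unfolding normalize_vec_def norm_smult csqrt_herm_self norm_inverse norm_of_real by simp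

lemma analytic_at_normalize_vec:
  assumes "\<And>k. analytic_at (\<lambda>x. y x $ k) p" "y p \<noteq> 0"
  shows "analytic_at (\<lambda>x. normalize_vec (y x) $ k) p"
proof -
  have "herm (y p) (y p) \<in> - \<real>\<^sub>\<le>\<^sub>0"
    using assms(2) by (auto simp: herm_self simp flip: of_real_power)
  then have "analytic_at (\<lambda>x. inverse (csqrt (herm (y x) (y x)))) p"
    by (intro analytic_at_compose[of "\<lambda>x. herm (y x) (y x)" p "\<lambda>z. inverse (csqrt z)" "- \<real>\<^sub>\<le>\<^sub>0"] analytic_at_herm assms)
      (auto intro!: holomorphic_intros simp: closed_nonpos_Reals_complex)
  then show ?thesis
    unfolding normalize_vec_def by (simp add: analytic_at_mult assms)
qed

lemma normalize_vec_unitary: "unitary_mat M \<Longrightarrow> normalize_vec (M *v y) = M *v normalize_vec y"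
  by (simp add: normalize_vec_def herm_unitary vector_scalar_commute)

lemma bounded_holomorphic_strip_extension:
  assumes "strip_extension \<delta> F G"
  obtains C where "bounded_holomorphic \<delta> C G"
proof -
  obtain W where W: "strip \<delta> \<subseteq> W" "holomorphic2_mat G W" and b: "bounded (G ` strip \<delta>)"
    using assms unfolding strip_extension_def by blast
  have sub: "open_strip \<delta> \<subseteq> strip \<delta>" by (auto simp: open_strip_def strip_def)
  obtain C where C: "\<forall>x\<in>G ` strip \<delta>. norm x \<le> C"
    using b unfolding bounded_iff by blast
  have "norm (G w $ i $ j) \<le> C" if "w \<in> open_strip \<delta>" for w i j
  proof -
    have "norm (G w $ i $ j) \<le> norm (G w $ i)" "norm (G w $ i) \<le> norm (G w)"
      by (rule Finite_Cartesian_Product.norm_nth_le)+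
    moreover have "norm (G w) \<le> C" using that sub C by blast
    ultimately show ?thesis by linarith
  qed
  moreover have "line_holomorphic (\<lambda>w. G w $ i $ j) (open_strip \<delta>)" for i j
  proof (rule line_holomorphic_subset)
    show "line_holomorphic (\<lambda>w. G w $ i $ j) W"
      using W(2) unfolding holomorphic2_mat_def by (intro holomorphic2_imp_line_holomorphic) blast
    show "open_strip \<delta> \<subseteq> W" using W(1) sub by blast
  qed
  ultimately have "bounded_holomorphic \<delta> C G" unfolding bounded_holomorphic_def by blast
  then show ?thesis by (rule that)
qed

text \<open>On the strip the phase \<open>exp (2 \<pi> \<i> m w\<^sub>1)\<close> is not of modulus 1, but the imaginary part of \<open>w\<^sub>1\<close> is bounded.\<close>

lemma bounded_holomorphic_phase:
  assumes G: "bounded_holomorphic \<delta> C G"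
  shows "bounded_holomorphic \<delta> (exp (2 * pi * \<bar>real_of_int m\<bar> * \<delta>) * C)
    (\<lambda>w. scale_mat (exp (2 * complex_of_real pi * \<i> * of_int m * w $ 1)) (G w))"
proof -
  have entry: "scale_mat c M $ i $ j = c * M $ i $ j" for c M i j
    by (simp add: scale_mat_def)
  have "line_holomorphic (\<lambda>w. exp (2 * complex_of_real pi * \<i> * of_int m * w $ 1)) (open_strip \<delta>)"
  proof (rule line_holomorphic_compose[OF line_holomorphic_coord])
    show "(\<lambda>z. exp (2 * complex_of_real pi * \<i> * of_int m * z)) holomorphic_on UNIV"
      by (intro holomorphic_intros)
  qed (rule subset_UNIV)
  moreover have "line_holomorphic (\<lambda>w. G w $ i $ j) (open_strip \<delta>)" for i j
    using G unfolding bounded_holomorphic_def by blast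
  ultimately have 1: "line_holomorphic (\<lambda>w. exp (2 * complex_of_real pi * \<i> * of_int m * w $ 1) * G w $ i $ j)
      (open_strip \<delta>)" for i j
    by (rule line_holomorphic_mult)
  have 2: "norm (exp (2 * complex_of_real pi * \<i> * of_int m * w $ 1) * G w $ i $ j)
      \<le> exp (2 * pi * \<bar>real_of_int m\<bar> * \<delta>) * C" if w: "w \<in> open_strip \<delta>" for w i j
  proof -
    have "- (m * Im (w $ 1)) \<le> \<bar>m * Im (w $ 1)\<bar>" by linarith
    also have "\<dots> = \<bar>real_of_int m\<bar> * \<bar>Im (w $ 1)\<bar>" by (rule abs_mult)
    also have "\<dots> \<le> \<bar>real_of_int m\<bar> * \<delta>"
      using w by (intro mult_left_mono) (auto simp: open_strip_def)
    finally have "2 * pi * (- (m * Im (w $ 1))) \<le> 2 * pi * (\<bar>real_of_int m\<bar> * \<delta>)"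
      by (intro mult_left_mono) auto
    moreover have "Re (2 * complex_of_real pi * \<i> * of_int m * w $ 1) = 2 * pi * (- (m * Im (w $ 1)))"
      by simp
    ultimately have "norm (exp (2 * complex_of_real pi * \<i> * of_int m * w $ 1)) \<le> exp (2 * pi * \<bar>real_of_int m\<bar> * \<delta>)"
      unfolding norm_exp_eq_Re by (simp only: exp_le_cancel_iff mult.assoc)
    moreover have "norm (G w $ i $ j) \<le> C"
      using G w unfolding bounded_holomorphic_def by blast
    ultimately show ?thesis
      unfolding norm_mult by (rule mult_mono) auto
  qed
  show ?thesis
    unfolding bounded_holomorphic_def entry using 1 2 by blast
qed

lemma bounded_holomorphic_mono: "bounded_holomorphic \<delta> C G \<Longrightarrow> C \<le> C' \<Longrightarrow> bounded_holomorphic \<delta> C' G"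
  unfolding bounded_holomorphic_def by (meson order_trans)

section \<open>The analytic section\<close>

theorem theorem7p2:
  fixes \<tau> :: "real^2"
    and U1 U2 A :: "real^2 \<Rightarrow> complex^2^2"
    and V1 V2 B :: "complex^2 \<Rightarrow> complex^2^2"
    and \<delta>\<^sub>0 \<delta> :: real
    and ls lu :: "real^2 \<Rightarrow> (complex^2) set"
    and lt :: "complex^2 \<Rightarrow> (complex^2) set"
  assumes "strip_admissible \<tau> U1 U2 A \<delta>\<^sub>0 V1 V2 B"
    and "dominated_splitting \<tau> U1 U2 A ls lu"
    and "0 < \<delta>" and "\<delta> \<le> \<delta>\<^sub>0"
    and "holomorphic_equivariant_extension \<tau> V1 V2 B \<delta> ls lt"
  shows "\<exists>e_an. real_analytic2 e_an \<and> unit_section ls e_an \<and>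
           quasi_periodic U1 U2 (charge U1 U2 ls) e_an"
proof -
  have adm: "sewing_system U1 U2" "\<delta>\<^sub>0 > 0" "strip_extension \<delta>\<^sub>0 U1 V1" "strip_extension \<delta>\<^sub>0 U2 V2"
    using assms(1) by (auto simp: strip_admissible_def)
  have inv: "invariant_line \<tau> U1 U2 A ls"
    using assms(2) by (simp add: dominated_splitting_def)
  interpret S: sewn_line U1 U2 ls
    using adm(1) inv by unfold_locales (auto simp: invariant_line_def)
  define m where "m = charge U1 U2 ls"
  obtain e where e: "continuous_on UNIV e" "unit_section ls e" "quasi_periodic U1 U2 m e"
    using S.charge_section unfolding m_def by blast
  define Z2 where "Z2 w = scale_mat (exp (2 * complex_of_real pi * \<i> * of_int m * w $ 1)) (V2 w)" for w
  obtain C1 C2 where C: "bounded_holomorphic \<delta>\<^sub>0 C1 V1" "bounded_holomorphic \<delta>\<^sub>0 C2 V2"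
    using bounded_holomorphic_strip_extension[OF adm(3)] bounded_holomorphic_strip_extension[OF adm(4)] by metis
  define C where "C = max C1 (exp (2 * pi * \<bar>real_of_int m\<bar> * \<delta>\<^sub>0) * C2)"
  have bounded_holomorphic: "bounded_holomorphic \<delta>\<^sub>0 C V1" "bounded_holomorphic \<delta>\<^sub>0 C Z2"
    unfolding Z2_def[abs_def] by (rule bounded_holomorphic_mono[OF C(1)] bounded_holomorphic_mono[OF bounded_holomorphic_phase[OF C(2)]]; simp add: C_def)+
  have V: "V1 (cvec w) = U1 w" "V2 (cvec w) = U2 w" for w
    using adm(3,4) by (auto simp: strip_extension_def)
  have e': "norm (e w) = 1 \<and> e w \<in> ls w" for w
    using e(2) by (simp add: unit_section_def)
  interpret A: analytic_sewing U1 "S.twisted_U2 m" V1 Z2 \<delta>\<^sub>0 C e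
  proof
    show "unitary_mat (U1 w)" "unitary_mat (S.twisted_U2 m w)" for w
      by (rule S.unitary S.unitary_twisted_U2)+
    show "U1 (w + e\<^sub>2) ** S.twisted_U2 m w = S.twisted_U2 m (w + e\<^sub>1) ** U1 w" for w
      by (rule S.twisted_U2_relation)
    show "V1 (cvec w) = U1 w" "Z2 (cvec w) = S.twisted_U2 m w" for w
      by (simp_all only: V Z2_def S.twisted_U2_def cvec_nth)
    show "norm (e w) = 1" for w using e' by blast
    show "e (w + e\<^sub>1) = U1 w *v e w" "e (w + e\<^sub>2) = S.twisted_U2 m w *v e w" for w
      using e(3) unfolding S.quasi_periodic_iff by blast+
  qed (fact adm(2) bounded_holomorphic e(1))+
  obtain F where F: "\<And>i p. analytic_at (\<lambda>w. F w $ i) p"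
    "\<And>w. F (w + e\<^sub>1) = U1 w *v F w" "\<And>w. F (w + e\<^sub>2) = S.twisted_U2 m w *v F w" "\<And>w. herm (F w) (e w) \<noteq> 0"
    using A.analytic_section by blast
  define y where "y w = herm (F w) (e w) *s e w" for w
  have y0: "y w \<noteq> 0" for w
    using F(4)[of w] e'[of w] by (auto simp: y_def)
  have lt: "holomorphic2_CP1 lt (interior (strip \<delta>))" "\<And>w. lt (cvec w) = ls w"
    using assms(5) by (auto simp: holomorphic_equivariant_extension_def)
  have "open_strip \<delta> \<subseteq> interior (strip \<delta>)"
    by (intro interior_maximal open_open_strip) (auto simp: open_strip_def strip_def)
  then have cv: "range cvec \<subseteq> interior (strip \<delta>)"
    using cvec_in_open_strip[OF assms(3)] by blast
  have ya: "analytic_at (\<lambda>w. y w $ k) p" for k p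
  proof -
    obtain N v where "open N" "p \<in> N" "\<And>x. x \<in> N \<Longrightarrow> v x \<in> ls x \<and> v x \<noteq> 0" "\<And>k. analytic_at (\<lambda>x. v x $ k) p"
      using analytic_local_frame[OF lt(1) open_interior cv lt(2), where p = p] by blast
    then show ?thesis
      unfolding y_def by (rule analytic_at_projection[where l = ls]) (use S.l_CP1 e' F in auto)
  qed
  have yq: "y (w + e\<^sub>1) = U1 w *v y w" "y (w + e\<^sub>2) = S.twisted_U2 m w *v y w" for w
    by (simp_all add: y_def F A.e_shift herm_unitary S.unitary S.unitary_twisted_U2 vector_scalar_commute)
  show ?thesis
  proof (intro exI conjI)
    show "real_analytic2 (\<lambda>w. normalize_vec (y w))"
      by (intro real_analytic2I analytic_at_normalize_vec ya y0)
    show "unit_section ls (\<lambda>w. normalize_vec (y w))"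
      unfolding unit_section_def
      using norm_normalize_vec[OF y0] e' S.l_CP1 by (auto simp: normalize_vec_def y_def intro!: smult_in_CP1)
    show "quasi_periodic U1 U2 (charge U1 U2 ls) (\<lambda>w. normalize_vec (y w))"
      unfolding m_def[symmetric] S.quasi_periodic_iff
      by (simp add: yq normalize_vec_unitary S.unitary S.unitary_twisted_U2)
  qed
qed

end
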